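(* Let $a_{1J},a_{2J},a_{3J},b_{1J},b_{2J},b_{3J}\in\mathbb{R}$ for $J\in\{L,R\}$, and consider the family of planar piecewise-linear Filippov systems with parameter $\mu\in\mathbb{R}$ $$\begin{bmatrix}\dot x\\ \dot y\end{bmatrix}=\begin{cases}F_L(x,y;\mu), & x<0,\\ F_R(x,y;\mu), & x>0,\end{cases}\qquad F_J(x,y;\mu)=\begin{bmatrix}a_{1J}x+a_{2J}y+a_{3J}\mu\\ b_{1J}x+b_{2J}y+b_{3J}\mu\end{bmatrix}.$$ Let $A_J=\begin{bmatrix}a_{1J}&a_{2J}\\ b_{1J}&b_{2J}\end{bmatrix}$ and suppose that $A_L$ has eigenvalues $\lambda_L\pm \mathrm{i}\,\omega_L$ with $\lambda_L>0$, $\omega_L>0$, and $A_R$ has eigenvalues $\lambda_R\pm \mathrm{i}\,\omega_R$ with $\lambda_R<0$, $\omega_R>0$. Let $$\beta_J=a_{3J}b_{2J}-a_{2J}b_{3J}\ (J\in\{L,R\}),\qquad \gamma=a_{2L}a_{3R}-a_{3L}a_{2R},\qquad \alpha=\frac{\lambda_L}{\omega_L}+\frac{\lambda_R}{\omega_R}.$$ Suppose $\beta_L>0$, $\beta_R>0$, $a_{2L}a_{2R}>0$, and $a_{2L}\gamma\ge 0$. Then the system has: 1. a stable focus in $x>0$ for $\mu<0$, and an unstable focus in $x<0$ for $\mu>0$; and 2. if $\alpha<0$, a unique limit cycle for every $\mu>0$, which is stable, and no limit cycle for $\mu<0$; if $\alpha>0$, a unique limit cycle for every $\mu<0$, which is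 unstable, and no limit cycle for $\mu>0$. Moreover, when the limit cycle exists, let $q_L,q_R,t_L,t_R\in\mathbb{R}$ be the quantities (independent of $\mu$) such that the limit cycle crosses, as time increases, from $x<0$ to $x>0$ at $(0,q_R\mu)$ and from $x>0$ to $x<0$ at $(0,q_L\mu)$, and such that its evolution time in $x<0$ is $t_L$ and its evolution time in $x>0$ is $t_R$. These satisfy $$q_R+\frac{a_{3R}}{a_{2R}}=\frac{\xi_R\,e^{-\lambda_R t_R}\,\varrho\!\left(\omega_R t_R;\frac{\lambda_R}{\omega_R}\right)}{\sin(\omega_R t_R)},\qquad q_L+\frac{a_{3R}}{a_{2R}}=\frac{-\xi_R\,e^{\lambda_R t_R}\,\varrho\!\left(\omega_R t_R;-\frac{\lambda_R}{\omega_R}\right)}{\sin(\omega_R t_R)},$$ $$q_L+\frac{a_{3L}}{a_{2L}}=\frac{\xi_L\,e^{-\lambda_L t_L}\,\varrho\!\left(\omega_L t_L;\frac{\lambda_L}{\omega_L}\right)}{\sin(\omega_L t_L)},\qquad q_R+\frac{a_{3L}}{a_{2L}}=\frac{-\xi_L\,e^{\lambda_L t_L}\,\varrho\!\left(\omega_L t_L;-\frac{\lambda_L}{\omega_L}\right)}{\sin(\omega_L t_L)},$$ where $\xi_J=\dfrac{\beta_J\omega_J}{a_{2J}(\lambda_J^2+\omega_J^2)}$ for each $J\in\{L,R\}$, and $\varrho(s;\nu)=1-e^{\nu s}\left(\cos(s)-\nu\sin(s)\right)$.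
   Context: Solutions are understood in the sense of Filippov. Write $f_J$ and $g_J$ for the first and second components of $F_J$. At points of the switching manifold $x=0$ where $f_L$ and $f_R$ are nonzero and have the same sign, orbits cross $x=0$. A sliding region is a subset of $x=0$ where $f_L>0$ and $f_R<0$ (attracting) or where $f_L<0$ and $f_R>0$ (repelling); on it, sliding orbits obey $\dot y=g_{\rm slide}(y;\mu)=\left.\dfrac{f_Lg_R-f_Rg_L}{f_L-f_R}\right|_{x=0}$, the convex combination of $F_L$ and $F_R$ tangent to $x=0$. "A stable (unstable) focus in $x>0$ ($x<0$)" means an equilibrium of $F_R$ lying in $x>0$ (respectively of $F_L$ lying in $x<0$) whose Jacobian has complex eigenvalues with negative (respectively positive) real part. A limit cycle is an isolated periodic orbit of the Filippov system. "Stable" for a limit cycle means asymptotically stable. For $\mu\neq0$ the scaling $(x,y)\mapsto(x/|\mu|,y/|\mu|)$ leaves the system unchanged except that $\mu$ is replaced by $\mu/|\mu|$; this is why $q_L,q_R,t_L,t_R$ do not depend on $\mu$ (over the sign of $\mu$ for which the limit cycle exists). *)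

theory Defs
  imports "HOL-Analysis.Analysis"
begin

datatype side = L | R

text \<open>
  A planar piecewise-smooth system with switching manifold \<open>x = 0\<close> is given by its two
  fields \<open>V L\<close> (used for \<open>x < 0\<close>) and \<open>V R\<close> (used for \<open>x > 0\<close>); \<open>z $ 1\<close> is \<open>x\<close> and
  \<open>z $ 2\<close> is \<open>y\<close>.
\<close>

type_synonym pws_field = "side \<Rightarrow> real^2 \<Rightarrow> real^2"

text \<open>
  Filippov's set-valued field. Where both first components have the same sign the inclusion
  forces crossing of \<open>x = 0\<close>; where they have opposite signs, the only element of the segment
  tangent to \<open>x = 0\<close> has second component
  \<open>(f\<^sub>L g\<^sub>R - f\<^sub>R g\<^sub>L) / (f\<^sub>L - f\<^sub>R)\<close>, the sliding field.
\<close>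

definition filippov_set :: "pws_field \<Rightarrow> real^2 \<Rightarrow> (real^2) set" where
  "filippov_set V z =
     (if z $ 1 < 0 then {V L z} else if z $ 1 > 0 then {V R z}
      else closed_segment (V L z) (V R z))"

text \<open>
  Absolute continuity of a function of a real variable; the members of a division are
  finitely many compact intervals with disjoint interiors.
\<close>

definition absolutely_continuous_on :: "real set \<Rightarrow> (real \<Rightarrow> 'a::real_normed_vector) \<Rightarrow> bool" where
  "absolutely_continuous_on S f \<longleftrightarrow>
     (\<forall>\<epsilon>>0. \<exists>\<delta>>0. \<forall>d T. d division_of T \<and> T \<subseteq> S \<and> (\<Sum>k\<in>d. measure lborel k) < \<delta>
        \<longrightarrow> (\<Sum>k\<in>d. norm (f (Sup k) - f (Inf k))) < \<epsilon>)"

definition filippov_solution :: "pws_field \<Rightarrow> real set \<Rightarrow> (real \<Rightarrow> real^2) \<Rightarrow> bool" where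
  "filippov_solution V I z \<longleftrightarrow>
     (\<forall>a b. {a..b} \<subseteq> I \<longrightarrow> absolutely_continuous_on {a..b} z) \<and>
     (AE t in lebesgue. t \<in> I \<longrightarrow>
        (\<exists>v\<in>filippov_set V (z t). (z has_vector_derivative v) (at t within I)))"

definition periodic_orbit :: "pws_field \<Rightarrow> (real^2) set \<Rightarrow> bool" where
  "periodic_orbit V \<Gamma> \<longleftrightarrow>
     (\<exists>z T. 0 < T \<and> filippov_solution V UNIV z \<and> (\<forall>t. z (t + T) = z t) \<and>
            (\<exists>t. z t \<noteq> z 0) \<and> \<Gamma> = range z)"

definition limit_cycle :: "pws_field \<Rightarrow> (real^2) set \<Rightarrow> bool" where
  "limit_cycle V \<Gamma> \<longleftrightarrow> periodic_orbit V \<Gamma> \<and>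
     (\<exists>U. open U \<and> \<Gamma> \<subseteq> U \<and> (\<forall>\<Gamma>'. periodic_orbit V \<Gamma>' \<and> \<Gamma>' \<inter> U \<noteq> {} \<longrightarrow> \<Gamma>' = \<Gamma>))"

text \<open>
  Forward solutions through a given point need not be unique, so both notions refer to all
  forward solutions.
\<close>

definition lyapunov_stable :: "pws_field \<Rightarrow> (real^2) set \<Rightarrow> bool" where
  "lyapunov_stable V \<Gamma> \<longleftrightarrow>
     (\<forall>\<epsilon>>0. \<exists>\<delta>>0. \<forall>z. filippov_solution V {0..} z \<and> infdist (z 0) \<Gamma> < \<delta>
        \<longrightarrow> (\<forall>t\<ge>0. infdist (z t) \<Gamma> < \<epsilon>))"

definition asymptotically_stable :: "pws_field \<Rightarrow> (real^2) set \<Rightarrow> bool" where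
  "asymptotically_stable V \<Gamma> \<longleftrightarrow> lyapunov_stable V \<Gamma> \<and>
     (\<exists>\<delta>>0. \<forall>z. filippov_solution V {0..} z \<and> infdist (z 0) \<Gamma> < \<delta>
        \<longrightarrow> ((\<lambda>t. infdist (z t) \<Gamma>) \<longlongrightarrow> 0) at_top)"

text \<open>
  \<open>\<Gamma>\<close> consists of one excursion into \<open>x > 0\<close> of duration \<open>tR\<close>, from \<open>(0, yR)\<close> to \<open>(0, yL)\<close>,
  followed by one excursion into \<open>x < 0\<close> of duration \<open>tL\<close>, back to \<open>(0, yR)\<close>. Both points
  lie in crossing regions of \<open>x = 0\<close>: the first components of the two fields are nonzero there
  and have the same sign.
\<close>

definition two_zone_cycle ::
    "pws_field \<Rightarrow> (real^2) set \<Rightarrow> real \<Rightarrow> real \<Rightarrow> real \<Rightarrow> real \<Rightarrow> bool" where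
  "two_zone_cycle V \<Gamma> yL yR tL tR \<longleftrightarrow> 0 < tL \<and> 0 < tR \<and>
     (\<exists>z. filippov_solution V UNIV z \<and> range z = \<Gamma> \<and> (\<forall>t. z (t + (tR + tL)) = z t) \<and>
          z 0 = vector [0, yR] \<and> (\<forall>J. V J (z 0) $ 1 > 0) \<and>
          (\<forall>t. 0 < t \<and> t < tR \<longrightarrow> z t $ 1 > 0) \<and>
          z tR = vector [0, yL] \<and> (\<forall>J. V J (z tR) $ 1 < 0) \<and>
          (\<forall>t. tR < t \<and> t < tR + tL \<longrightarrow> z t $ 1 < 0))"

text \<open>
  The same numbers \<open>qL\<close>, \<open>qR\<close>, \<open>tL\<close>, \<open>tR\<close> describe the limit cycles for all parameter
  values \<open>\<mu> \<in> M\<close>.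
\<close>

definition cycle_data ::
    "(real \<Rightarrow> pws_field) \<Rightarrow> real set \<Rightarrow> real \<Rightarrow> real \<Rightarrow> real \<Rightarrow> real \<Rightarrow> bool" where
  "cycle_data F M qL qR tL tR \<longleftrightarrow>
     (\<forall>\<mu>\<in>M. \<forall>\<Gamma>. limit_cycle (F \<mu>) \<Gamma> \<longrightarrow> two_zone_cycle (F \<mu>) \<Gamma> (qL * \<mu>) (qR * \<mu>) tL tR)"

definition eigenvalues :: "real^'n^'n \<Rightarrow> complex set" where
  "eigenvalues A =
     {k. \<exists>v::complex^'n. v \<noteq> 0 \<and> (\<chi> i j. complex_of_real (A $ i $ j)) *v v = k *s v}"

definition stable_focus :: "(real^2 \<Rightarrow> real^2) \<Rightarrow> real^2 \<Rightarrow> bool" where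
  "stable_focus f p \<longleftrightarrow> f p = 0 \<and> f differentiable (at p) \<and>
     (\<forall>k\<in>eigenvalues (jacobian f (at p)). Im k \<noteq> 0 \<and> Re k < 0)"

definition unstable_focus :: "(real^2 \<Rightarrow> real^2) \<Rightarrow> real^2 \<Rightarrow> bool" where
  "unstable_focus f p \<longleftrightarrow> f p = 0 \<and> f differentiable (at p) \<and>
     (\<forall>k\<in>eigenvalues (jacobian f (at p)). Im k \<noteq> 0 \<and> Re k > 0)"

definition \<rho> :: "real \<Rightarrow> real \<Rightarrow> real" where
  "\<rho> s \<nu> = 1 - exp (\<nu> * s) * (cos s - \<nu> * sin s)"

end

theory Submission imports Defs begin

text \<open>
  For fixed sign of \<open>\<mu>\<close> the whole family is one system up to a change of variables: rescaling by
  \<open>\<bar>\<mu>\<bar>\<close>, reflecting \<open>y\<close> if \<open>a2 < 0\<close>, and, if \<open>\<mu> < 0\<close>, reflecting \<open>x\<close> while reversing time and exchanging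
  the two sides. In the resulting normal form (locale \<open>two_foci\<close>) both foci lie in \<open>x < 0\<close>, so that the
  left one is an unstable equilibrium of the system and the right one is virtual, and the rotation is
  clockwise. The two fields are tangent to the switching line at heights \<open>tang R \<le> tang L\<close>. Solutions
  cross to the right above \<open>tang L\<close> and to the left below \<open>tang R\<close>; the segment between the two heights
  is repelling. The sign of \<open>\<alpha>\<close> changes under time reversal, so both cases with a limit cycle become the
  case \<open>\<alpha> < 0\<close> and both cases without one become \<open>\<alpha> > 0\<close>.

  A repelling segment can be entered only from within or along the left orbit that touches the line at
  height \<open>tang L\<close>, and that orbit comes out of the left focus. On the segment itself the motion is a scalar
  autonomous equation. Hence a periodic solution that is not constant must cross the line below
  \<open>tang R\<close> (\<open>periodic_solution_crosses\<close>). From there its future is determined: one excursion through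
  \<open>x < 0\<close> and one through \<open>x > 0\<close> bring it back at a distance below \<open>tang R\<close> given by the return map
  \<open>ret u = PR (w + PL (u + w))\<close>, where \<open>w = tang L - tang R \<ge> 0\<close>. Periodic orbits therefore correspond to
  periodic points of \<open>ret\<close>.

  Parametrised by the angle \<open>s = \<omega> t\<close> swept in an excursion, the distances of departure and arrival
  from the tangency are multiples of \<open>chi \<nu> s / sin s\<close> and \<open>chi (- \<nu>) s / sin s\<close> with \<open>\<nu> = \<lambda> / \<omega>\<close>. Their
  ratio \<open>chi_ratio \<nu>\<close> is monotone in \<open>s\<close> on the relevant range, so the ratio of arrival to departure
  decreases with the departure distance for both half maps, and strictly for \<open>PL\<close>. Since \<open>w \<ge> 0\<close> this
  property passes to the composition: \<open>ret u / u\<close> is strictly decreasing (\<open>ret_sublinear\<close>). It is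
  everywhere larger than \<open>exp (\<pi> \<alpha>)\<close>, which is its limit at infinity. If \<open>\<alpha> \<ge> 0\<close> then \<open>ret u > u\<close> throughout
  and there is no periodic orbit. If \<open>\<alpha> < 0\<close>, the increasing map \<open>ret\<close>, which is positive at \<open>0\<close>, has
  exactly one fixed point, and all its iterates converge to it monotonically.

  A Filippov solution is only absolutely continuous, but its increments are integrals of its derivative,
  so that near a crossing point it moves across the line at positive speed. This gives uniqueness forward
  in time through crossing points (\<open>solution_follows\<close>) and reduces the dynamics of all solutions near
  the cycle to the return map. For stability it then suffices that every solution starting close to the
  cycle remains close until it reaches the section close to the fixed point; transversality and continuous
  dependence give this. The cycle is not stable in reversed time, because the orbit touching the line at
  height \<open>tang L\<close> is defined for all past times and its future approaches the cycle.
\<close>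

section \<open>Absolutely continuous functions on an interval\<close>

lemma sum_content_le_measure:
  fixes d :: "real set set"
  assumes d: "d division_of T" and "T \<subseteq> U" "U \<in> lmeasurable"
  shows "(\<Sum>k\<in>d. measure lborel k) \<le> measure lebesgue U"
proof -
  have "(\<Sum>k\<in>d. measure lborel k) = measure lebesgue T"
  proof (subst content_division[OF d, symmetric], rule sum.cong)
    fix k assume "k \<in> d"
    then obtain a b where "k = cbox a b" using d by (metis cbox_division_memE)
    then show "measure lborel k = measure lebesgue k" by (simp add: measure_completion)
  qed simp
  also have "\<dots> \<le> measure lebesgue U"
    using assms(2,3) lmeasurable_division[OF d] by (intro measure_mono_fmeasurable) (auto simp: fmeasurable_def)
  finally show ?thesis .
qed

text \<open>
  The fundamental theorem of calculus for absolutely continuous functions, by the gauge definition of the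
  integral. Tags outside the null set contribute the usual derivative estimate. Intervals tagged in the
  null set lie in an open set of small measure, and absolute continuity bounds the increments over them.
\<close>

lemma absolutely_continuous_has_integral:
  fixes f g :: "real \<Rightarrow> 'a::real_normed_vector"
  assumes ac: "absolutely_continuous_on {a..b} f" and ab: "a \<le> b"
    and ae: "AE t in lebesgue. t \<in> {a..b} \<longrightarrow> (f has_vector_derivative g t) (at t within {a..b})"
  shows "(g has_integral (f b - f a)) {a..b}"
proof -
  obtain N where N: "negligible N"
    and der: "\<And>t. t \<in> {a..b} - N \<Longrightarrow> (f has_vector_derivative g t) (at t within {a..b})"
    using ae unfolding eventually_ae_filter_negligible by blast
  \<comment> \<open>On the null set the integrand may be chosen freely; with the value 0 the Riemann sums over these tags vanish.\<close>
  define h where "h t = (if t \<in> N then 0 else g t)" for t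
  have "(h has_integral (f b - f a)) {a..b}"
    unfolding has_integral_real
  proof (intro allI impI)
    fix e :: real assume e: "e > 0"
    define \<eta> where "\<eta> = e / (2 * (b - a + 1))"
    have \<eta>: "\<eta> > 0" "\<eta> * (b - a) < e / 2"
      using ab e by (auto simp: \<eta>_def field_simps)
    obtain \<delta> where \<delta>: "\<delta> > 0" and D: "\<forall>d T. d division_of T \<and> T \<subseteq> {a..b} \<and>
        (\<Sum>k\<in>d. measure lborel k) < \<delta> \<longrightarrow> (\<Sum>k\<in>d. norm (f (Sup k) - f (Inf k))) < e / 2"
      using ac[unfolded absolutely_continuous_on_def, rule_format, OF half_gt_zero[OF e]] by (elim exE conjE)
    obtain G where G: "open G" "N \<subseteq> G" "(G - N) \<in> lmeasurable" "emeasure lebesgue (G - N) < ennreal \<delta>"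
      using sets_lebesgue_outer_open[OF negligible_imp_sets[OF N] \<delta>] by blast
    have Gm: "G \<in> lmeasurable" "measure lebesgue G < \<delta>"
    proof -
      have eq: "G = (G - N) \<union> N" using G by auto
      show "G \<in> lmeasurable"
        by (subst eq, rule fmeasurable.Un) (use G N in \<open>auto simp: negligible_imp_measurable\<close>)
      have "measure lebesgue G \<le> measure lebesgue (G - N) + measure lebesgue N"
        by (subst eq, rule measure_Un_le) (use G N in \<open>auto simp: negligible_imp_sets\<close>)
      also have "measure lebesgue N = 0" using N by (simp add: negligible_imp_measure0)
      also have "measure lebesgue (G - N) < \<delta>"
        using G(3,4) \<delta> by (subst (asm) emeasure_eq_measure2) (auto simp: ennreal_less_iff)
      finally show "measure lebesgue G < \<delta>" by simp
    qed
    have "\<exists>r>0. (t \<in> N \<longrightarrow> ball t r \<subseteq> G) \<and> (t \<in> {a..b} - N \<longrightarrow>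
        (\<forall>u\<in>{a..b}. \<bar>u - t\<bar> < r \<longrightarrow> norm (f u - f t - (u - t) *\<^sub>R g t) \<le> \<eta> * \<bar>u - t\<bar>))" for t
    proof (cases "t \<in> N")
      case True
      then show ?thesis using G by (metis DiffD2 open_contains_ball_eq subsetD)
    next
      case False
      show ?thesis
      proof (cases "t \<in> {a..b}")
        case True
        have "(f has_derivative (\<lambda>x. x *\<^sub>R g t)) (at t within {a..b})"
          using der[of t] True False by (simp add: has_vector_derivative_def)
        then show ?thesis using \<eta> False
          unfolding has_derivative_within_alt by fastforce
      next
        case False then show ?thesis using \<open>t \<notin> N\<close> by (auto intro: exI[of _ 1])
      qed
    qed
    then obtain r where r: "\<And>t. r t > 0" "\<And>t. t \<in> N \<Longrightarrow> ball t (r t) \<subseteq> G"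
      "\<And>t u. t \<in> {a..b} - N \<Longrightarrow> u \<in> {a..b} \<Longrightarrow> \<bar>u - t\<bar> < r t \<Longrightarrow>
         norm (f u - f t - (u - t) *\<^sub>R g t) \<le> \<eta> * \<bar>u - t\<bar>"
      by metis
    show "\<exists>\<gamma>. gauge \<gamma> \<and> (\<forall>p. p tagged_division_of {a..b} \<and> \<gamma> fine p \<longrightarrow>
            norm ((\<Sum>(x, k)\<in>p. measure lborel k *\<^sub>R h x) - (f b - f a)) < e)"
    proof (intro exI conjI allI impI)
      show "gauge (\<lambda>t. ball t (r t))" using r by (simp add: gauge_ball_dependent)
      fix p assume "p tagged_division_of {a..b} \<and> (\<lambda>t. ball t (r t)) fine p"
      then have p: "p tagged_division_of {a..b}" and fine: "(\<lambda>t. ball t (r t)) fine p" by auto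
      have finp: "finite p" using p by auto
      have box: "\<exists>u v. k = {u..v} \<and> u \<le> x \<and> x \<le> v \<and> a \<le> u \<and> v \<le> b \<and> \<bar>u - x\<bar> < r x \<and> \<bar>v - x\<bar> < r x"
        if xkp: "(x, k) \<in> p" for x k
      proof -
        obtain u v where k: "k = {u..v}" using tagged_division_ofD(4)[OF p xkp] by auto
        have xk: "x \<in> k" "k \<subseteq> {a..b}" using tagged_division_ofD(2,3)[OF p xkp] by auto
      then have "u \<in> k" "v \<in> k" "u \<le> x" "x \<le> v" using k by auto
      moreover have "k \<subseteq> ball x (r x)" using fine xkp by (auto simp: fine_def)
      ultimately have "u \<in> ball x (r x)" "v \<in> ball x (r x)" "u \<in> {a..b}" "v \<in> {a..b}" "u \<le> x" "x \<le> v"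
        using xk by blast+
      then show ?thesis using k by (auto simp: dist_real_def)
      qed
      let ?q = "\<lambda>(x::real, k). measure lborel k *\<^sub>R h x - (f (Sup k) - f (Inf k))"
      define p1 where "p1 = {(x, k) \<in> p. x \<in> N}"
      define p2 where "p2 = {(x, k) \<in> p. x \<notin> N}"
      have pp: "p = p1 \<union> p2" "p1 \<inter> p2 = {}" "finite p1" "finite p2" "p1 \<subseteq> p" "p2 \<subseteq> p"
        using finp by (auto simp: p1_def p2_def intro: finite_subset)
      have "(\<Sum>(x, k)\<in>p. measure lborel k *\<^sub>R h x) - (f b - f a) = sum ?q p"
        using additive_tagged_division_1[OF ab p, of f]
        by (simp add: case_prod_unfold sum_subtractf)
      also have "\<dots> = sum ?q p1 + sum ?q p2"
        unfolding pp(1) by (rule sum.union_disjoint[OF pp(3,4,2)])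
      finally have split: "(\<Sum>(x, k)\<in>p. measure lborel k *\<^sub>R h x) - (f b - f a) = sum ?q p1 + sum ?q p2" .
      have "norm (sum ?q p2) \<le> (\<Sum>(x,k)\<in>p2. \<eta> * measure lborel k)"
      proof (rule sum_norm_le)
        fix y assume y: "y \<in> p2"
        obtain x k where yxk: "y = (x, k)" by (cases y)
        have xk: "(x, k) \<in> p" "x \<notin> N" using y yxk by (auto simp: p2_def)
        obtain u v where uv: "k = {u..v}" "u \<le> x" "x \<le> v" "a \<le> u" "v \<le> b" "\<bar>u - x\<bar> < r x" "\<bar>v - x\<bar> < r x"
          using box[OF xk(1)] by blast
        have "norm (f v - f x - (v - x) *\<^sub>R g x) \<le> \<eta> * (v - x)"
             "norm (f u - f x - (u - x) *\<^sub>R g x) \<le> \<eta> * (x - u)"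
          using r(3)[of x v] r(3)[of x u] uv xk by auto
        moreover have "measure lborel k *\<^sub>R h x - (f (Sup k) - f (Inf k))
            = (f u - f x - (u - x) *\<^sub>R g x) - (f v - f x - (v - x) *\<^sub>R g x)"
          using uv xk by (simp add: h_def algebra_simps)
        ultimately have "norm (measure lborel k *\<^sub>R h x - (f (Sup k) - f (Inf k))) \<le> \<eta> * (x - u) + \<eta> * (v - x)"
          by (metis add_mono norm_triangle_le_diff)
        then show "norm (?q y) \<le> (case y of (x, k) \<Rightarrow> \<eta> * measure lborel k)"
          using uv yxk by (simp add: algebra_simps)
      qed
      also have "\<dots> \<le> (\<Sum>(x,k)\<in>p. \<eta> * measure lborel k)"
        using finp pp \<eta> by (intro sum_mono2) (auto simp: case_prod_unfold)
      also have "\<dots> = \<eta> * (b - a)"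
        using additive_content_tagged_division[of p a b] p ab
        by (simp add: sum_distrib_left[symmetric] case_prod_unfold)
      also have "\<dots> < e / 2" by (rule \<eta>)
      finally have n2: "norm (sum ?q p2) < e / 2" .
      have p1t: "p1 tagged_division_of \<Union>(snd ` p1)"
        using p pp(5) tagged_partial_division_subset[of p "{a..b}" p1]
        by (auto simp: tagged_division_of_def[of p] intro: tagged_partial_division_of_Union_self)
      then have div: "(snd ` p1) division_of \<Union>(snd ` p1)" by (rule division_of_tagged_division)
      have "\<Union>(snd ` p1) \<subseteq> G"
      proof (clarsimp)
        fix y x k assume "(x, k) \<in> p1" "y \<in> k"
        then show "y \<in> G" using fine r(2)[of x] unfolding p1_def fine_def by blast
      qed
      from sum_content_le_measure[OF div this Gm(1)] Gm(2)
      have "(\<Sum>k\<in>snd ` p1. measure lborel k) < \<delta>" by simp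
      moreover have "\<Union>(snd ` p1) \<subseteq> {a..b}"
        using tagged_division_ofD(3)[OF p] pp(5) by fastforce
      ultimately have *: "(\<Sum>k\<in>snd ` p1. norm (f (Sup k) - f (Inf k))) < e / 2"
        using div by (intro D[rule_format]) auto
      have ne: "k \<noteq> {}" if "(x, k) \<in> p1" for x k
        using tagged_division_ofD(2)[OF p1t that] by auto
      let ?h = "\<lambda>k. if k = {} then 0 else norm (f (Sup k) - f (Inf k))"
      have "(\<Sum>(x,k)\<in>p1. norm (f (Sup k) - f (Inf k))) = (\<Sum>(x,k)\<in>p1. ?h k)"
        using ne by (intro sum.cong) auto
      also have "\<dots> = (\<Sum>k\<in>snd ` p1. ?h k)"
      proof (rule sum.over_tagged_division_lemma[OF p1t])
        fix u v :: real assume "box u v = {}"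
        then have "cbox u v = {} \<or> u = v" by (auto simp: not_less)
        then show "?h (cbox u v) = 0" by auto
      qed
      also have "\<dots> = (\<Sum>k\<in>snd ` p1. norm (f (Sup k) - f (Inf k)))"
        using ne by (intro sum.cong) auto
      finally have "(\<Sum>(x,k)\<in>p1. norm (f (Sup k) - f (Inf k))) = (\<Sum>k\<in>snd ` p1. norm (f (Sup k) - f (Inf k)))" .
      moreover have "norm (sum ?q p1) \<le> (\<Sum>(x,k)\<in>p1. norm (f (Sup k) - f (Inf k)))"
        by (rule sum_norm_le) (auto simp: p1_def h_def norm_minus_commute)
      ultimately have n1: "norm (sum ?q p1) < e / 2" using * by simp
      show "norm ((\<Sum>(x, k)\<in>p. measure lborel k *\<^sub>R h x) - (f b - f a)) < e"
        unfolding split using norm_triangle_ineq[of "sum ?q p1" "sum ?q p2"] n1 n2 by linarith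
    qed
  qed
  then show ?thesis
    by (rule has_integral_spike[OF N, rotated]) (auto simp: h_def)
qed

lemma lipschitz_on_imp_absolutely_continuous_on:
  fixes f :: "real \<Rightarrow> 'a::real_normed_vector"
  assumes "K-lipschitz_on S f"
  shows "absolutely_continuous_on S f"
  unfolding absolutely_continuous_on_def
proof (intro allI impI)
  fix e :: real assume "e > 0"
  have K: "K \<ge> 0" using assms lipschitz_on_nonneg by blast
  show "\<exists>\<delta>>0. \<forall>d T. d division_of T \<and> T \<subseteq> S \<and> (\<Sum>k\<in>d. measure lborel k) < \<delta>
        \<longrightarrow> (\<Sum>k\<in>d. norm (f (Sup k) - f (Inf k))) < e"
  proof (intro exI conjI allI impI)
    show "e / (K + 1) > 0" using K \<open>e > 0\<close> by simp
    fix d T assume d: "d division_of T \<and> T \<subseteq> S \<and> (\<Sum>k\<in>d. measure lborel k) < e / (K + 1)"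
    have "norm (f (Sup k) - f (Inf k)) \<le> K * measure lborel k" if kd: "k \<in> d" for k
    proof -
      have "k \<noteq> {}" "k \<subseteq> S" using d that division_ofD(2,3)[of d T k] by auto
      obtain u v where uv: "k = cbox u v"
        using division_ofD(4)[OF conjunct1[OF d] kd] by (elim exE)
      then have "k = {u..v}" "u \<le> v" using \<open>k \<noteq> {}\<close> by auto
      then show ?thesis
        using lipschitz_onD[OF assms, of v u] subsetD[OF \<open>k \<subseteq> S\<close>, of u] subsetD[OF \<open>k \<subseteq> S\<close>, of v]
        by (auto simp: dist_norm)
    qed
    then have "(\<Sum>k\<in>d. norm (f (Sup k) - f (Inf k))) \<le> K * (\<Sum>k\<in>d. measure lborel k)"
      by (simp add: sum_distrib_left sum_mono)
    also have "\<dots> \<le> (K + 1) * (\<Sum>k\<in>d. measure lborel k)"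
      by (intro mult_right_mono) (auto simp: sum_nonneg)
    also have "\<dots> < e" using d K by (simp add: field_simps)
    finally show "(\<Sum>k\<in>d. norm (f (Sup k) - f (Inf k))) < e" .
  qed
qed

lemma absolutely_continuous_on_imp_continuous_on:
  fixes f :: "real \<Rightarrow> 'a::real_normed_vector"
  assumes "absolutely_continuous_on {a..b} f"
  shows "continuous_on {a..b} f"
  unfolding continuous_on_iff
proof (intro ballI allI impI)
  fix x e assume x: "x \<in> {a..b}" and "(0::real) < e"
  obtain \<delta> where \<delta>: "\<delta> > 0" and D: "\<forall>d T. d division_of T \<and> T \<subseteq> {a..b} \<and>
      (\<Sum>k\<in>d. measure lborel k) < \<delta> \<longrightarrow> (\<Sum>k\<in>d. norm (f (Sup k) - f (Inf k))) < e"
    using assms[unfolded absolutely_continuous_on_def, rule_format, OF \<open>0 < e\<close>] by (elim exE conjE)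
  have near: "dist (f v) (f u) < e" if "u \<in> {a..b}" "v \<in> {a..b}" "u \<le> v" "v - u < \<delta>" for u v
    using D[rule_format, of "{{u..v}}" "{u..v}"] that division_of_self[of u v] by (auto simp: dist_norm)
  have "dist (f y) (f x) < e" if "y \<in> {a..b}" "\<bar>y - x\<bar> < \<delta>" for y
  proof (cases "x \<le> y")
    case True
    then show ?thesis using that x by (intro near) auto
  next
    case False
    then have "dist (f x) (f y) < e" using that x by (intro near) auto
    then show ?thesis by (simp add: dist_commute)
  qed
  then show "\<exists>d>0. \<forall>x'\<in>{a..b}. dist x' x < d \<longrightarrow> dist (f x') (f x) < e"
    using \<delta> by (auto simp: dist_real_def)
qed

lemma absolutely_continuous_on_subset:
  "absolutely_continuous_on S f \<Longrightarrow> T \<subseteq> S \<Longrightarrow> absolutely_continuous_on T f"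
  unfolding absolutely_continuous_on_def by (meson subset_trans)

text \<open>
  If the derivative agrees almost everywhere with a continuous function, the exceptional set is empty.
  This turns solutions inside one half-plane into classical ones.
\<close>

lemma absolutely_continuous_C1:
  fixes f g :: "real \<Rightarrow> 'a::banach"
  assumes ac: "absolutely_continuous_on {a..b} f" and cont: "continuous_on {a..b} g" and t: "t \<in> {a..b}"
    and ae: "AE t in lebesgue. t \<in> {a..b} \<longrightarrow> (f has_vector_derivative g t) (at t within {a..b})"
  shows "(f has_vector_derivative g t) (at t within {a..b})"
proof -
  have "f s = f a + integral {a..s} g" if s: "s \<in> {a..b}" for s
  proof -
    have "(g has_integral (f s - f a)) {a..s}"
    proof (rule absolutely_continuous_has_integral)
      show "absolutely_continuous_on {a..s} f"
        using s by (intro absolutely_continuous_on_subset[OF ac]) auto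
      show "AE t in lebesgue. t \<in> {a..s} \<longrightarrow> (f has_vector_derivative g t) (at t within {a..s})"
        using ae by eventually_elim (use s in \<open>auto intro: has_vector_derivative_within_subset\<close>)
    qed (use s in auto)
    then show ?thesis by (simp add: integral_unique)
  qed
  moreover have "((\<lambda>s. f a + integral {a..s} g) has_vector_derivative g t) (at t within {a..b})"
    using integral_has_vector_derivative[OF cont t] by (auto intro!: derivative_eq_intros)
  ultimately show ?thesis
    using t by (metis (no_types, lifting) has_vector_derivative_transform)
qed

section \<open>Filippov solutions of Lipschitz fields\<close>

text \<open>
  With the sign of the side one statement covers both half-planes: \<open>z\<close> lies on side \<open>J\<close> iff
  \<open>side_sgn J * z $ 1 > 0\<close>.
\<close>

definition side_sgn :: "side \<Rightarrow> real" where
  "side_sgn J = (case J of L \<Rightarrow> -1 | R \<Rightarrow> 1)"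

lemma side_sgn_simps [simp]: "side_sgn L = -1" "side_sgn R = 1"
  by (auto simp: side_sgn_def)

lemma side_sgn_cases: "side_sgn J = 1 \<or> side_sgn J = -1"
  by (cases J) auto

lemma forall_side: "(\<forall>J. P J) \<longleftrightarrow> P L \<and> P R"
  by (metis side.exhaust)

lemma filippov_set_side: "side_sgn J * z $ 1 > 0 \<Longrightarrow> filippov_set V z = {V J z}"
  by (cases J) (auto simp: filippov_set_def)

lemma filippov_set_subset_segment: "filippov_set V z \<subseteq> closed_segment (V L z) (V R z)"
  by (auto simp: filippov_set_def)

lemma filippov_set_subset_convex:
  assumes "convex C" "\<And>J. V J z \<in> C"
  shows "filippov_set V z \<subseteq> C"
  using filippov_set_subset_segment closed_segment_subset[OF assms(2,2,1)] by blast

lemma first_nonpos: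
  fixes f :: "real \<Rightarrow> real"
  assumes cont: "continuous_on {0..b} f" and f0: "f 0 > 0" and b: "0 < b" "f b \<le> 0"
  obtains \<tau> where "0 < \<tau>" "\<tau> \<le> b" "f \<tau> = 0" "\<And>s. 0 \<le> s \<Longrightarrow> s < \<tau> \<Longrightarrow> f s > 0"
proof -
  define S where "S = {s \<in> {0..b}. f s \<le> 0}"
  have "closed S" unfolding S_def
    by (rule continuous_on_closed_Collect_le) (use cont in \<open>auto intro!: continuous_intros\<close>)
  moreover have "bounded S" by (rule bounded_subset[of "{0..b}"]) (auto simp: S_def)
  moreover have "b \<in> S" using b by (auto simp: S_def)
  ultimately obtain m where m: "m \<in> S" "\<And>r. r \<in> S \<Longrightarrow> m \<le> r"
    using compact_attains_inf[of S] by (auto simp: compact_eq_bounded_closed)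
  have pos: "f s > 0" if "0 \<le> s" "s < m" for s
    using m(2)[of s] m(1) that by (force simp: S_def)
  have "0 \<le> m" "m \<le> b" "f m \<le> 0" using m(1) by (auto simp: S_def)
  moreover have "m \<noteq> 0" using \<open>f m \<le> 0\<close> f0 by auto
  ultimately have m0: "0 < m" "m \<le> b" "f m \<le> 0" by auto
  moreover have "f m \<ge> 0"
  proof (rule tendsto_lowerbound)
    have "continuous_on {0..m} f" using m0 by (intro continuous_on_subset[OF cont]) auto
    then have "(f \<longlongrightarrow> f m) (at m within {0..m})" using m0(1) by (simp add: continuous_on_def)
    then show "(f \<longlongrightarrow> f m) (at_left m)" by (simp only: at_within_Icc_at_left[OF m0(1)])
    show "\<forall>\<^sub>F s in at_left m. 0 \<le> f s"
      using eventually_at_left_real[OF m0(1)] by eventually_elim (use pos in \<open>auto intro: less_imp_le\<close>)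
  qed simp
  ultimately show ?thesis using pos that by (meson antisym)
qed

text \<open>
  The squared distance of two solutions, damped by \<open>exp (- 2 K t)\<close>, cannot increase.
\<close>

lemma lipschitz_ode_unique:
  fixes \<phi> \<psi> :: "real \<Rightarrow> 'a::real_inner"
  assumes lip: "K-lipschitz_on UNIV f"
    and \<phi>: "\<And>t. t \<in> {a..b} \<Longrightarrow> (\<phi> has_vector_derivative f (\<phi> t)) (at t within {a..b})"
    and \<psi>: "\<And>t. t \<in> {a..b} \<Longrightarrow> (\<psi> has_vector_derivative f (\<psi> t)) (at t within {a..b})"
    and init: "\<phi> a = \<psi> a" and t: "t \<in> {a..b}"
  shows "\<phi> t = \<psi> t"
proof -
  define g where "g s = exp (- 2 * K * s) * ((\<phi> s - \<psi> s) \<bullet> (\<phi> s - \<psi> s))" for s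
  have g': "(g has_real_derivative exp (- 2 * K * s) *
        (2 * ((\<phi> s - \<psi> s) \<bullet> (f (\<phi> s) - f (\<psi> s))) - 2 * K * ((\<phi> s - \<psi> s) \<bullet> (\<phi> s - \<psi> s)))) (at s within {a..b})"
    if "s \<in> {a..b}" for s
  proof -
    have d: "((\<lambda>s. \<phi> s - \<psi> s) has_vector_derivative (f (\<phi> s) - f (\<psi> s))) (at s within {a..b})"
      using \<phi>[OF that] \<psi>[OF that] by (rule has_vector_derivative_diff)
    have "((\<lambda>s. (\<phi> s - \<psi> s) \<bullet> (\<phi> s - \<psi> s)) has_derivative
        (\<lambda>h. (\<phi> s - \<psi> s) \<bullet> (h *\<^sub>R (f (\<phi> s) - f (\<psi> s))) + (h *\<^sub>R (f (\<phi> s) - f (\<psi> s))) \<bullet> (\<phi> s - \<psi> s)))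
        (at s within {a..b})"
      using d by (intro has_derivative_inner) (auto simp: has_vector_derivative_def)
    moreover have "(\<lambda>h. (\<phi> s - \<psi> s) \<bullet> (h *\<^sub>R (f (\<phi> s) - f (\<psi> s))) + (h *\<^sub>R (f (\<phi> s) - f (\<psi> s))) \<bullet> (\<phi> s - \<psi> s))
        = (*) (2 * ((\<phi> s - \<psi> s) \<bullet> (f (\<phi> s) - f (\<psi> s))))"
      by (simp add: fun_eq_iff inner_commute)
    moreover have e: "((\<lambda>s. exp (- 2 * K * s)) has_real_derivative - 2 * K * exp (- 2 * K * s)) (at s within {a..b})"
      by (auto intro!: derivative_eq_intros)
    ultimately have "((\<lambda>s. (\<phi> s - \<psi> s) \<bullet> (\<phi> s - \<psi> s)) has_real_derivative
        2 * ((\<phi> s - \<psi> s) \<bullet> (f (\<phi> s) - f (\<psi> s)))) (at s within {a..b})"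
      by (simp add: has_field_derivative_def)
    then show ?thesis
      unfolding g_def by (rule DERIV_cong[OF DERIV_mult[OF e]]) (simp add: algebra_simps)
  qed
  have "g t \<le> g a"
  proof (rule DERIV_nonpos_imp_decreasing_open[where f = g and a = a and b = t])
    show "a \<le> t" using t by simp
  next
    fix s assume s: "a < s" "s < t"
    then have sab: "s \<in> {a..b}" using t by auto
    have "(\<phi> s - \<psi> s) \<bullet> (f (\<phi> s) - f (\<psi> s)) \<le> norm (\<phi> s - \<psi> s) * norm (f (\<phi> s) - f (\<psi> s))"
      by (rule norm_cauchy_schwarz)
    also have "\<dots> \<le> norm (\<phi> s - \<psi> s) * (K * norm (\<phi> s - \<psi> s))"
      using lipschitz_onD[OF lip, of "\<phi> s" "\<psi> s"] by (intro mult_left_mono) (auto simp: dist_norm)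
    also have "\<dots> = K * ((\<phi> s - \<psi> s) \<bullet> (\<phi> s - \<psi> s))"
      by (simp add: power2_norm_eq_inner[symmetric] power2_eq_square)
    finally have "exp (- 2 * K * s) * (2 * ((\<phi> s - \<psi> s) \<bullet> (f (\<phi> s) - f (\<psi> s)))
        - 2 * K * ((\<phi> s - \<psi> s) \<bullet> (\<phi> s - \<psi> s))) \<le> 0"
      by (simp add: mult_le_0_iff)
    moreover have "at s within {a..b} = at s"
      using s t by (intro at_within_interior) auto
    ultimately show "\<exists>y. DERIV g s :> y \<and> y \<le> 0"
      using g'[OF sab] by auto
  next
    show "continuous_on {a..t} g"
      by (rule continuous_on_subset[of "{a..b}"], rule DERIV_continuous_on[OF g']) (use t in auto)
  qed
  also have "g a = 0" using init by (simp add: g_def)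
  finally have "(\<phi> t - \<psi> t) \<bullet> (\<phi> t - \<psi> t) \<le> 0"
    by (simp add: g_def mult_le_0_iff)
  then have "(\<phi> t - \<psi> t) \<bullet> (\<phi> t - \<psi> t) = 0" by (intro antisym inner_ge_zero)
  then show ?thesis by simp
qed

locale lipschitz_pws =
  fixes V :: pws_field and K :: real
  assumes lip: "\<And>J. K-lipschitz_on UNIV (V J)"
begin

lemma continuous_field: "continuous_on S (V J)"
  using lipschitz_on_continuous_on[OF lip] continuous_on_subset by blast

lemma field_near:
  assumes "e \<bullet> V J p > c"
  shows "\<forall>\<^sub>F q in nhds p. e \<bullet> V J q > c"
proof -
  have "open {q. c < e \<bullet> V J q}"
    by (intro open_Collect_less continuous_intros continuous_field)
  then show ?thesis using assms eventually_nhds_in_open by fastforce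
qed

lemma solution_continuous:
  assumes "filippov_solution V I z" "{a..b} \<subseteq> I"
  shows "continuous_on {a..b} z"
  using assms absolutely_continuous_on_imp_continuous_on unfolding filippov_solution_def by blast

text \<open>
  Off a null set the derivative itself is a selection from the inclusion whose integral is the increment.
\<close>

lemma solution_integral:
  assumes sol: "filippov_solution V I z" and I: "{a..b} \<subseteq> I" and ab: "a \<le> b"
  obtains g N where "(g has_integral (z b - z a)) {a..b}" "negligible N"
    "\<And>t. t \<in> {a<..<b} - N \<Longrightarrow> g t \<in> filippov_set V (z t)"
proof -
  obtain N where N: "negligible N" and der: "\<And>t. t \<in> I - N \<Longrightarrow>
      \<exists>v\<in>filippov_set V (z t). (z has_vector_derivative v) (at t within I)"
    using sol unfolding filippov_solution_def eventually_ae_filter_negligible by blast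
  define g where "g t = (SOME v. v \<in> filippov_set V (z t) \<and> (z has_vector_derivative v) (at t within I))" for t
  have g: "g t \<in> filippov_set V (z t) \<and> (z has_vector_derivative g t) (at t within I)" if "t \<in> I - N" for t
    unfolding g_def by (rule someI_ex) (use der[OF that] in blast)
  have "AE t in lebesgue. t \<in> {a..b} \<longrightarrow> (z has_vector_derivative g t) (at t within {a..b})"
    unfolding eventually_ae_filter_negligible
    by (rule exI[of _ N]) (use N g I has_vector_derivative_within_subset in blast)
  then have "(g has_integral (z b - z a)) {a..b}"
    using sol I ab by (intro absolutely_continuous_has_integral) (auto simp: filippov_solution_def)
  then show ?thesis
    using N g I by (intro that[of g N]) (auto simp: subset_iff)
qed

text \<open>
  A half-space that contains both field vectors contains their convex hull. So a lower bound for the speed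
  of the two fields in some direction bounds the speed of every Filippov solution in that direction.
\<close>

lemma solution_speed:
  assumes sol: "filippov_solution V I z" and I: "{a..b} \<subseteq> I" and ab: "a \<le> b"
    and speed: "\<And>t J. a < t \<Longrightarrow> t < b \<Longrightarrow> e \<bullet> V J (z t) \<ge> c"
  shows "e \<bullet> (z b - z a) \<ge> c * (b - a)"
proof -
  obtain g N where g: "(g has_integral (z b - z a)) {a..b}" and N: "negligible N"
    and gN: "\<And>t. t \<in> {a<..<b} - N \<Longrightarrow> g t \<in> filippov_set V (z t)"
    using solution_integral[OF sol I ab] by blast
  have "((\<lambda>t. e \<bullet> g t) has_integral e \<bullet> (z b - z a)) {a..b}"
    using has_integral_linear[OF g bounded_linear_inner_right[of e]] by (simp add: o_def)
  then have *: "((\<lambda>t. if t \<in> N \<union> {a, b} then c else e \<bullet> g t) has_integral e \<bullet> (z b - z a)) {a..b}"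
    by (rule has_integral_spike[of "N \<union> {a, b}", rotated 2]) (use N in auto)
  have c: "((\<lambda>t. c) has_integral c * (b - a)) {a..b}"
    using has_integral_const_real[of c a b] ab by (simp add: mult.commute)
  show ?thesis
  proof (rule has_integral_le[OF c *])
    fix t assume "t \<in> {a..b}"
    show "c \<le> (if t \<in> N \<union> {a, b} then c else e \<bullet> g t)"
    proof (cases "t \<in> N \<union> {a, b}")
      case False
      then have t: "t \<in> {a<..<b} - N" using \<open>t \<in> {a..b}\<close> by auto
      have "filippov_set V (z t) \<subseteq> {v. e \<bullet> v \<ge> c}"
        using speed t by (intro filippov_set_subset_convex convex_halfspace_ge) auto
      then show ?thesis using gN[OF t] False by auto
    qed auto
  qed
qed

lemma solution_in_side_classical:
  assumes sol: "filippov_solution V I z" and I: "{a..b} \<subseteq> I"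
    and side: "\<And>t. a < t \<Longrightarrow> t < b \<Longrightarrow> side_sgn J * z t $ 1 > 0" and t: "t \<in> {a..b}"
  shows "(z has_vector_derivative V J (z t)) (at t within {a..b})"
proof (rule absolutely_continuous_C1[OF _ _ t])
  show "absolutely_continuous_on {a..b} z" using sol I by (auto simp: filippov_solution_def)
  show "continuous_on {a..b} (\<lambda>s. V J (z s))"
    using continuous_on_compose2[OF continuous_field[of UNIV J] solution_continuous[OF sol I]] by auto
  obtain N where N: "negligible N" and der: "\<And>t. t \<in> I - N \<Longrightarrow>
      \<exists>v\<in>filippov_set V (z t). (z has_vector_derivative v) (at t within I)"
    using sol unfolding filippov_solution_def eventually_ae_filter_negligible by blast
  have "(z has_vector_derivative V J (z s)) (at s within {a..b})" if s: "s \<in> {a..b}" "s \<notin> N \<union> {a, b}" for s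
  proof -
    have "filippov_set V (z s) = {V J (z s)}" using s by (intro filippov_set_side side) auto
    then have "(z has_vector_derivative V J (z s)) (at s within I)" using der[of s] s I by auto
    then show ?thesis using I by (rule has_vector_derivative_within_subset)
  qed
  then show "AE s in lebesgue. s \<in> {a..b} \<longrightarrow> (z has_vector_derivative V J (z s)) (at s within {a..b})"
    unfolding eventually_ae_filter_negligible by (intro exI[of _ "N \<union> {a, b}"]) (use N in auto)
qed

lemma field_bounded_on_compact:
  assumes "continuous_on {a..b} z"
  obtains C where "C > 0" "\<And>t v. t \<in> {a..b::real} \<Longrightarrow> v \<in> filippov_set V (z t) \<Longrightarrow> norm v \<le> C"
proof -
  have "\<exists>C. \<forall>t\<in>{a..b}. norm (V J (z t)) \<le> C" for J
  proof -
    have "compact ((\<lambda>t. V J (z t)) ` {a..b})"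
      using continuous_on_compose2[OF continuous_field[of UNIV J] assms]
      by (intro compact_continuous_image) auto
    then show ?thesis by (meson bounded_iff compact_imp_bounded imageI)
  qed
  then obtain C where C: "\<And>J t. t \<in> {a..b} \<Longrightarrow> norm (V J (z t)) \<le> C J" by metis
  have "filippov_set V (z t) \<subseteq> cball 0 (max 1 (max (C L) (C R)))" if "t \<in> {a..b}" for t
  proof (rule filippov_set_subset_convex)
    fix J show "V J (z t) \<in> cball 0 (max 1 (max (C L) (C R)))"
      using C[OF that, of J] by (cases J) auto
  qed simp
  then show ?thesis by (intro that[of "max 1 (max (C L) (C R))"]) (auto simp: subset_iff)
qed

lemma solution_lipschitz:
  assumes sol: "filippov_solution V I z" and I: "{a..b} \<subseteq> I"
  obtains C where "C-lipschitz_on {a..b} z"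
proof -
  obtain C where C: "C > 0" "\<And>t v. t \<in> {a..b} \<Longrightarrow> v \<in> filippov_set V (z t) \<Longrightarrow> norm v \<le> C"
    using field_bounded_on_compact[OF solution_continuous[OF sol I]] by blast
  have "norm (z t - z s) \<le> C * (t - s)" if st: "s \<in> {a..b}" "t \<in> {a..b}" "s \<le> t" for s t
  proof -
    have "{s..t} \<subseteq> I" using st I by auto
    from solution_integral[OF sol this st(3)] obtain g N where
      g: "(g has_integral (z t - z s)) {s..t}" and N: "negligible N"
      and gN: "\<And>u. u \<in> {s<..<t} - N \<Longrightarrow> g u \<in> filippov_set V (z u)" by blast
    have *: "((\<lambda>u. if u \<in> N \<union> {s, t} then 0 else g u) has_integral z t - z s) (cbox s t)"
      by (simp, rule has_integral_spike[of "N \<union> {s, t}", OF _ _ g]) (use N in auto)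
    have "norm (z t - z s) \<le> C * measure lborel (cbox s t)"
    proof (rule has_integral_bound[OF _ *])
      fix u assume "u \<in> cbox s t"
      then show "norm (if u \<in> N \<union> {s, t} then 0 else g u) \<le> C"
        using gN[of u] C(2)[of u "g u"] C(1) st by auto
    qed (use C in auto)
    then show ?thesis using st by simp
  qed
  then have "C-lipschitz_on {a..b} z"
    using C(1) by (intro lipschitz_on_leI) (auto simp: dist_norm norm_minus_commute)
  then show ?thesis by (rule that)
qed

text \<open>
  The converse construction: a continuous curve that solves the inclusion off a locally finite set. Its
  derivative is bounded on compact intervals, so it is Lipschitz there and hence absolutely continuous.
\<close>

lemma filippov_solutionI:
  assumes cont: "\<And>a b. {a..b} \<subseteq> I \<Longrightarrow> continuous_on {a..b} z"
    and fin: "\<And>a b. {a..b} \<subseteq> I \<Longrightarrow> finite (S \<inter> {a..b})" and cnt: "countable S"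
    and der: "\<And>t. t \<in> I - S \<Longrightarrow> \<exists>v\<in>filippov_set V (z t). (z has_vector_derivative v) (at t within I)"
  shows "filippov_solution V I z"
  unfolding filippov_solution_def
proof (intro conjI allI impI)
  fix a b assume I: "{a..b} \<subseteq> I"
  obtain C where C: "C > 0" "\<And>t v. t \<in> {a..b} \<Longrightarrow> v \<in> filippov_set V (z t) \<Longrightarrow> norm v \<le> C"
    using field_bounded_on_compact[OF cont[OF I]] by blast
  have "norm (z t - z s) \<le> C * (t - s)" if st: "s \<in> {a..b}" "t \<in> {a..b}" "s \<le> t" for s t
  proof -
    define g where "g u = (if u \<in> S \<union> {s,t} then 0 else (SOME v. v \<in> filippov_set V (z u) \<and> (z has_vector_derivative v) (at u within I)))" for u
    have gu: "g u \<in> filippov_set V (z u) \<and> (z has_vector_derivative g u) (at u)"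
      if u: "u \<in> {s<..<t} - S" for u
    proof -
      have uI: "u \<in> I - S" and "{s..t} \<subseteq> I" using u st I by auto
      then have "u \<in> interior I" using u interior_mono[of "{s..t}" I] by auto
      then have at: "at u within I = at u" by (rule at_within_interior)
      have "g u = (SOME v. v \<in> filippov_set V (z u) \<and> (z has_vector_derivative v) (at u within I))"
        using u by (auto simp: g_def)
      then show ?thesis
        using someI_ex[of "\<lambda>v. v \<in> filippov_set V (z u) \<and> (z has_vector_derivative v) (at u within I)"]
          der[OF uI] at by auto
    qed
    have *: "(g has_integral (z t - z s)) (cbox s t)"
    proof (simp, rule fundamental_theorem_of_calculus_interior_strong[of "S \<inter> {s..t}"])
      show "finite (S \<inter> {s..t})" using st I by (intro fin) (auto simp: subset_iff)
      show "continuous_on {s..t} z" using st I by (intro cont) (auto simp: subset_iff)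
      show "\<And>x. x \<in> {s<..<t} - S \<inter> {s..t} \<Longrightarrow> (z has_vector_derivative g x) (at x)"
        using gu by auto
    qed (use st in auto)
    have "norm (z t - z s) \<le> C * measure lborel (cbox s t)"
    proof (rule has_integral_bound[OF _ *])
      fix u assume "u \<in> cbox s t"
      then show "norm (g u) \<le> C"
        using gu[of u] C(2)[of u "g u"] C(1) st by (cases "u \<in> S \<union> {s,t}") (auto simp: g_def)
    qed (use C in auto)
    then show ?thesis using st by simp
  qed
  then have "C-lipschitz_on {a..b} z"
    using C(1) by (intro lipschitz_on_leI) (auto simp: dist_norm norm_minus_commute)
  then show "absolutely_continuous_on {a..b} z" by (rule lipschitz_on_imp_absolutely_continuous_on)
next
  show "AE t in lebesgue. t \<in> I \<longrightarrow> (\<exists>v\<in>filippov_set V (z t). (z has_vector_derivative v) (at t within I))"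
    unfolding eventually_ae_filter_negligible
    by (rule exI[of _ S]) (use der countable_imp_null_set_lborel[OF cnt] in
      \<open>auto simp: negligible_iff_null_sets null_sets_completionI\<close>)
qed

text \<open>
  Forward uniqueness. At a crossing point both fields point into side \<open>J\<close>, so the solution enters this
  side at positive speed and has no other choice; inside the side it is a classical solution, and it can
  leave only where the classical solution leaves.
\<close>

lemma solution_follows:
  assumes sol: "filippov_solution V I z" and I: "{t0..t0 + \<tau>} \<subseteq> I"
    and \<psi>: "\<And>t. t \<in> {0..\<tau>} \<Longrightarrow> (\<psi> has_vector_derivative V J (\<psi> t)) (at t within {0..\<tau>})"
    and init: "\<psi> 0 = z t0"
    and side: "\<And>t. 0 < t \<Longrightarrow> t < \<tau> \<Longrightarrow> side_sgn J * \<psi> t $ 1 > 0"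
    and start: "side_sgn J * z t0 $ 1 > 0 \<or> z t0 $ 1 = 0 \<and> (\<forall>K. side_sgn J * V K (z t0) $ 1 > 0)"
    and t: "t \<in> {0..\<tau>}"
  shows "z (t0 + t) = \<psi> t"
proof -
  define f where "f s = side_sgn J * z (t0 + s) $ 1" for s
  define e where "e = side_sgn J *\<^sub>R (axis 1 1 :: real^2)"
  have e: "e \<bullet> v = side_sgn J * v $ 1" for v by (simp add: e_def inner_axis')
  have contz: "continuous_on {t0..t0 + \<tau>} z" using solution_continuous[OF sol I] .
  have contz': "continuous_on {0..\<tau>} (\<lambda>s. z (t0 + s))"
    by (rule continuous_on_compose2[OF contz]) (auto intro!: continuous_intros)
  have contf: "continuous_on {0..\<tau>} f"
    unfolding f_def by (intro continuous_intros contz')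
  have classical: "z (t0 + s) = \<psi> s" if m: "m \<le> \<tau>" and pos: "\<And>s. 0 < s \<Longrightarrow> s < m \<Longrightarrow> f s > 0"
    and s: "s \<in> {0..m}" for m s
  proof (rule lipschitz_ode_unique[OF lip[of J], where a = 0 and b = m])
    fix u assume u: "u \<in> {0..m}"
    have "side_sgn J * z r $ 1 > 0" if "t0 < r" "r < t0 + m" for r
      using pos[of "r - t0"] that by (simp add: f_def)
    then have "(z has_vector_derivative V J (z (t0 + u))) (at (t0 + u) within {t0..t0 + m})"
      using I m u by (intro solution_in_side_classical[OF sol]) auto
    then have "(z has_vector_derivative V J (z (t0 + u))) (at (t0 + u) within (+) t0 ` {0..m})"
      by (simp add: add.commute)
    moreover have "((+) t0 has_vector_derivative 1) (at u within {0..m})"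
      by (auto intro!: derivative_eq_intros)
    ultimately show "((\<lambda>s. z (t0 + s)) has_vector_derivative V J (z (t0 + u))) (at u within {0..m})"
      using vector_diff_chain_within[of "(+) t0" 1 u "{0..m}" z] by (simp add: o_def)
    show "(\<psi> has_vector_derivative V J (\<psi> u)) (at u within {0..m})"
      using \<psi>[of u] u m has_vector_derivative_within_subset[of \<psi> _ u "{0..\<tau>}" "{0..m}"] by auto
  qed (use init s in auto)
  have "\<exists>h>0. \<forall>s. 0 < s \<and> s < h \<and> s \<le> \<tau> \<longrightarrow> f s > 0"
  proof (cases "\<tau> > 0")
    case False
    then show ?thesis by (intro exI[of _ 1]) auto
  next
    case True
    show ?thesis
    proof (cases "f 0 > 0")
      case True
      have "(f \<longlongrightarrow> f 0) (at 0 within {0..\<tau>})"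
        using contf \<open>0 < \<tau>\<close> by (auto simp: continuous_on_def)
      then have "\<forall>\<^sub>F s in at 0 within {0..\<tau>}. f s > 0"
        using True by (simp add: order_tendsto_iff)
      then show ?thesis unfolding eventually_at by (force simp: dist_real_def)
    next
      case False
      then have st: "z t0 $ 1 = 0" "\<And>K. e \<bullet> V K (z t0) > 0" using start by (auto simp: f_def e)
      define c where "c = min (e \<bullet> V L (z t0)) (e \<bullet> V R (z t0)) / 2"
      have c: "c > 0" "e \<bullet> V K (z t0) > c" for K
        using st(2)[of L] st(2)[of R] by (cases K; auto simp: c_def min_def)+
      have "\<forall>\<^sub>F q in nhds (z t0). \<forall>K. e \<bullet> V K q > c"
        using field_near[OF c(2)[of L]] field_near[OF c(2)[of R]]
        by eventually_elim (simp add: forall_side)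
      moreover have "filterlim (\<lambda>s. z (t0 + s)) (nhds (z t0)) (at 0 within {0..\<tau>})"
        using contz' \<open>0 < \<tau>\<close> by (force simp: continuous_on_def)
      ultimately have "\<forall>\<^sub>F s in at 0 within {0..\<tau>}. \<forall>K. e \<bullet> V K (z (t0 + s)) > c"
        by (rule eventually_compose_filterlim)
      then obtain h where h: "h > 0" "\<And>s K. s \<in> {0..\<tau>} \<Longrightarrow> s \<noteq> 0 \<Longrightarrow> \<bar>s\<bar> < h \<Longrightarrow> e \<bullet> V K (z (t0 + s)) > c"
        unfolding eventually_at by (auto simp: dist_real_def)
      have "f s > 0" if s: "0 < s" "s < h" "s \<le> \<tau>" for s
      proof -
        have "e \<bullet> (z (t0 + s) - z t0) \<ge> c * (t0 + s - t0)"
        proof (rule solution_speed[OF sol])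
          show "{t0..t0 + s} \<subseteq> I" using I s by auto
          fix r K assume "t0 < r" "r < t0 + s"
          then show "c \<le> e \<bullet> V K (z r)" using h(2)[of "r - t0" K] s by auto
        qed (use s in auto)
        moreover have "c * s > 0" using c s by simp
        ultimately show ?thesis using st(1) by (simp add: e f_def inner_diff_right)
      qed
      then show ?thesis using h(1) by blast
    qed
  qed
  then obtain h where h: "h > 0" "\<And>s. 0 < s \<Longrightarrow> s < h \<Longrightarrow> s \<le> \<tau> \<Longrightarrow> f s > 0" by blast
  have "f s > 0" if s: "0 < s" "s < \<tau>" for s
  proof (rule ccontr)
    assume neg: "\<not> f s > 0"
    \<comment> \<open>At the first time \<open>m\<close> with \<open>f m \<le> 0\<close> the solution would still agree with \<open>\<psi>\<close>, which is inside the side.\<close>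
    define S where "S = {r \<in> {h/2..s}. f r \<le> 0}"
    have "s \<ge> h" using neg h(2)[of s] s by force
    have "closed S" unfolding S_def
      by (rule continuous_on_closed_Collect_le)
        (use h s in \<open>auto intro!: continuous_on_subset[OF contf] continuous_intros\<close>)
    moreover have "bounded S" by (rule bounded_subset[of "{h/2..s}"]) (auto simp: S_def)
    moreover have "s \<in> S" using neg \<open>s \<ge> h\<close> h by (auto simp: S_def)
    ultimately obtain m where m: "m \<in> S" "\<And>r. r \<in> S \<Longrightarrow> m \<le> r"
      using compact_attains_inf[of S] by (auto simp: compact_eq_bounded_closed)
    have "m \<ge> h/2" "m \<le> s" "f m \<le> 0" using m by (auto simp: S_def)
    have "f r > 0" if r: "0 < r" "r < m" for r
    proof (cases "r < h")
      case True then show ?thesis using h(2)[of r] r \<open>m \<le> s\<close> s by auto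
    next
      case False
      then have "r \<notin> S" using m(2) r by force
      then show ?thesis using False r \<open>m \<le> s\<close> h by (auto simp: S_def)
    qed
    then have "z (t0 + m) = \<psi> m"
      using \<open>m \<le> s\<close> \<open>m \<ge> h/2\<close> s h by (intro classical[of m]) auto
    then have "f m > 0" using side[of m] \<open>m \<le> s\<close> \<open>m \<ge> h/2\<close> s h by (simp add: f_def)
    then show False using \<open>f m \<le> 0\<close> by simp
  qed
  then show ?thesis using classical[of \<tau> t] t by blast
qed

text \<open>
  With \<open>T\<close> the identity this is a time shift or, with the field negated, a reversal of time; with a
  diagonal \<open>T\<close> it is the passage to the normal form. Solutions are Lipschitz on compact intervals, which
  makes absolute continuity of the new curve immediate.
\<close>

lemma solution_transform:
  assumes sol: "filippov_solution V I z" and \<tau>: "\<tau> = 1 \<or> \<tau> = -1" and T: "bounded_linear T"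
    and conj: "\<And>p v. v \<in> filippov_set V p \<Longrightarrow> \<tau> *\<^sub>R T v \<in> filippov_set V' (T p)"
    and I': "\<And>t. t \<in> I' \<Longrightarrow> \<tau> * t + c \<in> I"
  shows "filippov_solution V' I' (\<lambda>t. T (z (\<tau> * t + c)))"
  unfolding filippov_solution_def
proof (intro conjI allI impI)
  fix a b assume ab: "{a..b} \<subseteq> I'"
  define a' b' where "a' = min (\<tau> * a + c) (\<tau> * b + c)" and "b' = max (\<tau> * a + c) (\<tau> * b + c)"
  show "absolutely_continuous_on {a..b} (\<lambda>t. T (z (\<tau> * t + c)))"
  proof (cases "a \<le> b")
    case True
    have "{a'..b'} \<subseteq> I"
    proof
      fix s assume s: "s \<in> {a'..b'}"
      have "\<tau> * (s - c) \<in> {a..b}" using \<tau> True s by (auto simp: a'_def b'_def)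
      then have "\<tau> * (\<tau> * (s - c)) + c \<in> I" using I' ab by blast
      then show "s \<in> I" using \<tau> by auto
    qed
    then obtain C where C: "C-lipschitz_on {a'..b'} z" using solution_lipschitz[OF sol] by blast
    obtain B where B: "B > 0" "\<And>v. norm (T v) \<le> norm v * B" using bounded_linear.pos_bounded[OF T] by blast
    have "(B * C)-lipschitz_on {a..b} (\<lambda>t. T (z (\<tau> * t + c)))"
    proof (rule lipschitz_onI)
      fix s t assume st: "s \<in> {a..b}" "t \<in> {a..b}"
      have "\<tau> * s + c \<in> {a'..b'}" "\<tau> * t + c \<in> {a'..b'}" using st \<tau> by (auto simp: a'_def b'_def)
      then have "norm (z (\<tau> * s + c) - z (\<tau> * t + c)) \<le> C * \<bar>s - t\<bar>"
        using lipschitz_onD[OF C, of "\<tau> * s + c" "\<tau> * t + c"] \<tau> by (auto simp: dist_norm abs_minus_commute)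
      then have "norm (z (\<tau> * s + c) - z (\<tau> * t + c)) * B \<le> C * \<bar>s - t\<bar> * B"
        using B by (intro mult_right_mono) auto
      then show "dist (T (z (\<tau> * s + c))) (T (z (\<tau> * t + c))) \<le> B * C * dist s t"
        using B(2)[of "z (\<tau> * s + c) - z (\<tau> * t + c)"]
        by (simp add: dist_norm linear_diff[OF bounded_linear.linear[OF T]] algebra_simps)
    qed (use B lipschitz_on_nonneg[OF C] in auto)
    then show ?thesis by (rule lipschitz_on_imp_absolutely_continuous_on)
  next
    case False
    then have "0-lipschitz_on {a..b} (\<lambda>t. T (z (\<tau> * t + c)))" by auto
    then show ?thesis by (rule lipschitz_on_imp_absolutely_continuous_on)
  qed
next
  obtain N where N: "negligible N" and der: "\<And>t. t \<in> I - N \<Longrightarrow>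
      \<exists>v\<in>filippov_set V (z t). (z has_vector_derivative v) (at t within I)"
    using sol unfolding filippov_solution_def eventually_ae_filter_negligible by blast
  define N' where "N' = (\<lambda>s. \<tau> *\<^sub>R s) ` ((+) (- c) ` N)"
  have "negligible N'" unfolding N'_def
    by (intro negligible_differentiable_image_negligible negligible_translation N) (auto intro!: derivative_intros)
  moreover have "\<exists>v\<in>filippov_set V' (T (z (\<tau> * t + c))).
      ((\<lambda>t. T (z (\<tau> * t + c))) has_vector_derivative v) (at t within I')"
    if t: "t \<in> I'" "t \<notin> N'" for t
  proof -
    have "\<tau> * t + c \<notin> N"
    proof
      assume "\<tau> * t + c \<in> N"
      then have "\<tau> *\<^sub>R (- c + (\<tau> * t + c)) \<in> N'" unfolding N'_def by blast
      then show False using t \<tau> by auto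
    qed
    then obtain v where v: "v \<in> filippov_set V (z (\<tau> * t + c))"
      and zd: "(z has_vector_derivative v) (at (\<tau> * t + c) within I)"
      using der[of "\<tau> * t + c"] I'[OF t(1)] by blast
    have sub: "(\<lambda>t. \<tau> * t + c) ` I' \<subseteq> I" using I' by auto
    have "((\<lambda>t. \<tau> * t + c) has_vector_derivative \<tau>) (at t within I')"
      by (auto intro!: derivative_eq_intros)
    from vector_diff_chain_within[OF this has_vector_derivative_within_subset[OF zd sub]]
    have "((\<lambda>t. z (\<tau> * t + c)) has_vector_derivative \<tau> *\<^sub>R v) (at t within I')"
      by (simp add: o_def)
    from bounded_linear.has_vector_derivative[OF T this]
    have "((\<lambda>t. T (z (\<tau> * t + c))) has_vector_derivative \<tau> *\<^sub>R T v) (at t within I')"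
      by (simp add: linear_cmul[OF bounded_linear.linear[OF T]])
    then show ?thesis using conj[OF v] by blast
  qed
  ultimately show "AE t in lebesgue. t \<in> I' \<longrightarrow> (\<exists>v\<in>filippov_set V' (T (z (\<tau> * t + c))).
      ((\<lambda>t. T (z (\<tau> * t + c))) has_vector_derivative v) (at t within I'))"
    unfolding eventually_ae_filter_negligible by (intro exI[of _ N']) auto
qed

lemma solution_shift:
  assumes sol: "filippov_solution V I z" and "\<And>t. t \<in> I' \<Longrightarrow> t + c \<in> I"
  shows "filippov_solution V I' (\<lambda>t. z (t + c))"
  using solution_transform[OF sol, of 1 "\<lambda>z. z" V I' c] assms(2) by (simp add: bounded_linear_ident)

end

section \<open>Half-return maps of a focus\<close>

text \<open>
  In units of \<open>\<xi>\<close>, an excursion of a focus that sweeps the angle \<open>s\<close> starts at distance \<open>chi \<nu> s / sin s\<close>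
  from the tangency and ends at distance \<open>chi (- \<nu>) s / sin s\<close> on the other side of it. A virtual focus is
  passed in less than a half turn, \<open>s < \<pi>\<close>; an excursion around a focus takes more, \<open>s > \<pi>\<close>, and both
  expressions then change sign.
\<close>

definition chi :: "real \<Rightarrow> real \<Rightarrow> real" where
  "chi \<nu> s = exp (- \<nu> * s) - cos s + \<nu> * sin s"

lemma
  fixes f :: "real \<Rightarrow> real"
  assumes "(f has_real_derivative D) (at x)"
  shows pos_derivI: "0 < D \<Longrightarrow> \<exists>y. (f has_real_derivative y) (at x) \<and> 0 < y"
    and nonneg_derivI: "0 \<le> D \<Longrightarrow> \<exists>y. (f has_real_derivative y) (at x) \<and> 0 \<le> y"
    and nonpos_derivI: "D \<le> 0 \<Longrightarrow> \<exists>y. (f has_real_derivative y) (at x) \<and> y \<le> 0"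
  using assms by blast+

lemma chi_rho: "chi \<nu> s = exp (- \<nu> * s) * \<rho> s \<nu>"
  by (simp add: chi_def \<rho>_def algebra_simps exp_minus)

lemma chi_pos_iff: "chi \<nu> s > 0 \<longleftrightarrow> \<rho> s \<nu> > 0"
  by (simp add: chi_rho zero_less_mult_iff)

lemma DERIV_chi [derivative_intros]:
  "(chi \<nu> has_real_derivative (- \<nu> * chi \<nu> s + (1 + \<nu>\<^sup>2) * sin s)) (at s within S)"
  unfolding chi_def
  by (auto intro!: derivative_eq_intros simp: algebra_simps power2_eq_square)

lemma DERIV_rho: "((\<lambda>s. \<rho> s \<nu>) has_real_derivative ((1 + \<nu>\<^sup>2) * exp (\<nu> * s) * sin s)) (at s within S)"
  unfolding \<rho>_def
  by (auto intro!: derivative_eq_intros simp: algebra_simps power2_eq_square)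

lemma continuous_chi: "continuous_on S (chi \<nu>)"
  unfolding chi_def by (intro continuous_intros)

lemma chi_pi: "chi \<nu> pi = exp (- \<nu> * pi) + 1"
  by (simp add: chi_def)

lemma DERIV_chi_div_sin:
  assumes "sin s \<noteq> 0"
  shows "((\<lambda>s. chi \<nu> s / sin s) has_real_derivative (\<rho> s (- \<nu>) / (sin s)\<^sup>2)) (at s within S)"
proof -
  have "((\<lambda>s. chi \<nu> s / sin s) has_real_derivative
     (((- \<nu> * chi \<nu> s + (1 + \<nu>\<^sup>2) * sin s) * sin s - chi \<nu> s * cos s) / (sin s * sin s))) (at s within S)"
    using assms by (auto intro!: derivative_eq_intros)
  moreover have "(- \<nu> * chi \<nu> s + (1 + \<nu>\<^sup>2) * sin s) * sin s - chi \<nu> s * cos s = \<rho> s (- \<nu>) + ((sin s)\<^sup>2 + (cos s)\<^sup>2 - 1)" (is "?N = _")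
    unfolding chi_def \<rho>_def by (simp add: algebra_simps power2_eq_square)
  then have "?N = \<rho> s (- \<nu>)" by simp
  ultimately show ?thesis by (simp add: power2_eq_square)
qed

text \<open>
  For \<open>n = - \<nu>\<close> this is \<open>cos s + n sin s \<le> 1 + n s < exp (n s)\<close>.
\<close>

lemma rho_pos_of_neg:
  assumes "\<nu> < 0" "s > 0"
  shows "\<rho> s \<nu> > 0"
proof -
  define n where "n = - \<nu>"
  have n: "n * s > 0" using assms by (simp add: n_def mult_neg_pos)
  have "cos s + n * sin s \<le> 1 + n * s"
    using assms sin_x_le_x[of s] by (intro add_mono mult_left_mono) (auto simp: n_def)
  also have "\<dots> < 1 + n * s + (n * s)\<^sup>2 / 2" using n zero_less_power[OF n, of 2] by linarith
  also have "\<dots> \<le> exp (n * s)" using exp_lower_Taylor_quadratic[of "n * s"] n by simp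
  finally have "exp (- (n * s)) * (cos s + n * sin s) < exp (- (n * s)) * exp (n * s)" by simp
  then show ?thesis by (simp add: \<rho>_def n_def exp_minus_inverse mult_exp_exp algebra_simps)
qed

lemma rho_pos:
  assumes "0 < s" "s \<le> pi"
  shows "\<rho> s \<nu> > 0"
proof -
  have "\<rho> 0 \<nu> < \<rho> s \<nu>"
  proof (rule DERIV_pos_imp_increasing_open[OF assms(1)])
    fix x assume "0 < x" "x < s"
    then show "\<exists>y. ((\<lambda>s. \<rho> s \<nu>) has_real_derivative y) (at x) \<and> 0 < y"
      using assms sin_gt_zero[of x] by (intro pos_derivI[OF DERIV_rho]) (simp add: add_pos_nonneg)
  qed (unfold \<rho>_def, intro continuous_intros)
  then show ?thesis by (simp add: \<rho>_def)
qed

lemma chi_div_sin_mono_short: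
  assumes "0 < r" "r < s" "s < pi"
  shows "chi \<nu> r / sin r < chi \<nu> s / sin s"
proof (rule DERIV_pos_imp_increasing[OF assms(2)])
  fix x assume "r \<le> x" "x \<le> s"
  then show "\<exists>y. ((\<lambda>s. chi \<nu> s / sin s) has_real_derivative y) (at x) \<and> 0 < y"
    using assms sin_gt_zero[of x] rho_pos[of x "- \<nu>"]
    by (intro pos_derivI[OF DERIV_chi_div_sin]) auto
qed

lemma sin_neg: "pi < x \<Longrightarrow> x < 2 * pi \<Longrightarrow> sin x < 0"
  using sin_gt_zero[of "x - pi"] by (simp add: sin_diff)

lemma chi_div_sin_mono_long:
  assumes "\<nu> > 0" "pi < r" "r < s" "s < 2 * pi"
  shows "chi \<nu> r / sin r < chi \<nu> s / sin s"
proof (rule DERIV_pos_imp_increasing[OF assms(3)])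
  fix x assume "r \<le> x" "x \<le> s"
  then show "\<exists>y. ((\<lambda>s. chi \<nu> s / sin s) has_real_derivative y) (at x) \<and> 0 < y"
    using assms sin_neg[of x] rho_pos_of_neg[of "- \<nu>" x] 
    by (intro pos_derivI[OF DERIV_chi_div_sin]) auto
qed

text \<open>
  At \<open>s = 0\<close> the function \<open>u sin s - chi \<nu> s\<close> vanishes with slope \<open>u\<close>, and at \<open>\<pi>\<close> it is negative.
\<close>

lemma short_time_exists:
  assumes "u > 0"
  shows "\<exists>s. 0 < s \<and> s < pi \<and> chi \<nu> s = u * sin s"
proof -
  define h where "h s = u * sin s - chi \<nu> s" for s
  have "(h has_real_derivative u) (at 0)"
    unfolding h_def by (auto intro!: derivative_eq_intros simp: chi_def)
  from DERIV_pos_inc_right[OF this assms] obtain d where d: "d > 0" "\<And>h'. 0 < h' \<Longrightarrow> h' < d \<Longrightarrow> h 0 < h h'"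
    by auto
  define r where "r = min (d / 2) 1"
  have r: "0 < r" "r < d" "r < pi" using d pi_gt3 by (auto simp: r_def)
  then have "h r > 0" using d(2)[of r] by (simp add: h_def chi_def)
  moreover have "h pi < 0" using exp_gt_zero[of "- \<nu> * pi"] by (simp add: h_def chi_pi del: exp_gt_zero)
  moreover have "continuous_on {r..pi} h" unfolding h_def by (intro continuous_intros continuous_chi)
  ultimately obtain s where s: "r \<le> s" "s \<le> pi" "h s = 0" using IVT2'[of h pi 0 r] r by auto
  then have "s \<noteq> pi" using \<open>h pi < 0\<close> by auto
  then show ?thesis using s r by (intro exI[of _ s]) (auto simp: h_def)
qed

definition short_time :: "real \<Rightarrow> real \<Rightarrow> real" where
  "short_time \<nu> u = (THE s. 0 < s \<and> s < pi \<and> chi \<nu> s = u * sin s)"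

lemma short_time_unique:
  assumes "0 < s" "s < pi" "chi \<nu> s = u * sin s"
  shows "short_time \<nu> u = s"
  unfolding short_time_def
proof (rule the_equality)
  fix r assume r: "0 < r \<and> r < pi \<and> chi \<nu> r = u * sin r"
  have "sin s > 0" "sin r > 0" using r assms sin_gt_zero by auto
  then have "chi \<nu> s / sin s = u" "chi \<nu> r / sin r = u" using r assms by auto
  then show "r = s" using chi_div_sin_mono_short[of r s \<nu>] chi_div_sin_mono_short[of s r \<nu>] r assms
    by (cases r s rule: linorder_cases) auto
qed (use assms in auto)

lemma short_time:
  assumes "u > 0"
  shows "0 < short_time \<nu> u" "short_time \<nu> u < pi" "chi \<nu> (short_time \<nu> u) = u * sin (short_time \<nu> u)"
  using short_time_exists[OF assms, of \<nu>] short_time_unique by metis+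


lemma short_time_before:
  assumes "u > 0" "0 < s" "s < short_time \<nu> u"
  shows "chi \<nu> s < u * sin s"
proof -
  note st = short_time[OF assms(1), of \<nu>]
  have "sin s > 0" "sin (short_time \<nu> u) > 0" using assms st by (auto intro!: sin_gt_zero)
  then show ?thesis
    using chi_div_sin_mono_short[OF assms(2,3) st(2), of \<nu>] st(3) by (simp add: field_simps)
qed

definition short_map :: "real \<Rightarrow> real \<Rightarrow> real" where
  "short_map \<nu> u = chi (- \<nu>) (short_time \<nu> u) / sin (short_time \<nu> u)"

lemma short_map_pos: "u > 0 \<Longrightarrow> short_map \<nu> u > 0"
  using short_time[of u \<nu>] unfolding short_map_def
  by (intro divide_pos_pos) (auto simp: chi_pos_iff intro!: rho_pos sin_gt_zero)

lemma short_time_mono: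
  assumes "0 < u" "u < v"
  shows "short_time \<nu> u < short_time \<nu> v"
proof (rule ccontr)
  note st = short_time[OF assms(1), of \<nu>]
  have "v > 0" using assms by simp
  note st' = short_time[OF this, of \<nu>]
  have sin: "sin (short_time \<nu> v) > 0" "sin (short_time \<nu> u) > 0" using st st' by (auto intro!: sin_gt_zero)
  assume "\<not> short_time \<nu> u < short_time \<nu> v"
  then consider "short_time \<nu> u = short_time \<nu> v" | "short_time \<nu> v < short_time \<nu> u" by linarith
  then show False
  proof cases
    case 1 then show ?thesis using st st' assms sin by auto
  next
    case 2 
    then show ?thesis using chi_div_sin_mono_short[OF st'(1) 2 st(2), of \<nu>] st st' sin assms by simp
  qed
qed

lemma short_map_mono:
  assumes "0 < u" "u < v"
  shows "short_map \<nu> u < short_map \<nu> v"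
  unfolding short_map_def
  using chi_div_sin_mono_short[OF _ short_time_mono[OF assms]] short_time[of u \<nu>] short_time[of v \<nu>] assms
  by auto

definition chi_ratio :: "real \<Rightarrow> real \<Rightarrow> real" where
  "chi_ratio \<nu> s = chi (- \<nu>) s / chi \<nu> s"

lemma DERIV_chi_ratio:
  assumes "chi \<nu> s \<noteq> 0"
  shows "(chi_ratio \<nu> has_real_derivative
    ((2 * \<nu> * (chi \<nu> s * chi (- \<nu>) s) + (1 + \<nu>\<^sup>2) * sin s * (chi \<nu> s - chi (- \<nu>) s)) / (chi \<nu> s)\<^sup>2)) (at s within S)"
  unfolding chi_ratio_def using assms
  by (auto intro!: derivative_eq_intros simp: algebra_simps power2_eq_square)

lemma chi_ratio_pi: "chi_ratio \<nu> pi = exp (\<nu> * pi)"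
proof -
  have "exp (\<nu> * pi) + 1 = exp (\<nu> * pi) * (exp (- \<nu> * pi) + 1)"
    by (simp add: algebra_simps exp_minus)
  moreover have "exp (- \<nu> * pi) + 1 > 0" by (simp add: add_pos_pos)
  ultimately show ?thesis by (simp add: chi_ratio_def chi_pi)
qed

lemma chi_sinh: "chi \<nu> s = (cosh (\<nu> * s) - cos s) - (sinh (\<nu> * s) - \<nu> * sin s)"
  unfolding chi_def cosh_def sinh_def by (simp add: field_simps)

lemma chi_minus_sinh: "chi (- \<nu>) s = (cosh (\<nu> * s) - cos s) + (sinh (\<nu> * s) - \<nu> * sin s)"
  by (simp add: chi_sinh[of "- \<nu>"])

text \<open>
  The sign condition behind the monotonicity of \<open>chi_ratio\<close> for a stable virtual focus. Both sides vanish at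
  \<open>s = 0\<close>; differentiating twice leaves, up to the positive factor \<open>(1 + n\<^sup>2)\<^sup>2\<close>, the product
  \<open>sinh (n s) sin s\<close>.
\<close>

lemma chi_wronskian_bound:
  assumes n: "n \<ge> 0" and s: "0 \<le> s" "s \<le> pi"
  shows "2 * n - 2 * n * cosh (n * s) * cos s + (n\<^sup>2 - 1) * sinh (n * s) * sin s \<ge> 0"
proof -
  define k where "k x = n * cosh (n * x) * sin x - sinh (n * x) * cos x" for x
  define K where "K x = 2 * n - 2 * n * cosh (n * x) * cos x + (n\<^sup>2 - 1) * sinh (n * x) * sin x" for x
  have k': "(k has_real_derivative ((1 + n\<^sup>2) * sinh (n * x) * sin x)) (at x)" for x
    unfolding k_def by (auto intro!: derivative_eq_intros simp: algebra_simps power2_eq_square)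
  have K': "(K has_real_derivative ((1 + n\<^sup>2) * k x)) (at x)" for x
    unfolding K_def k_def by (auto intro!: derivative_eq_intros simp: algebra_simps power2_eq_square)
  have k: "k x \<ge> 0" if x: "0 \<le> x" "x \<le> pi" for x
  proof -
    have "k 0 \<le> k x"
    proof (rule DERIV_nonneg_imp_nondecreasing[OF x(1)])
      fix y assume "0 \<le> y" "y \<le> x"
      then show "\<exists>d. (k has_real_derivative d) (at y) \<and> 0 \<le> d"
        using x n sin_ge_zero[of y] by (intro nonneg_derivI[OF k']) (auto intro!: mult_nonneg_nonneg)
    qed
    then show ?thesis by (simp add: k_def)
  qed
  have "K 0 \<le> K s"
  proof (rule DERIV_nonneg_imp_nondecreasing[OF s(1)])
    fix y assume "0 \<le> y" "y \<le> s"
    then show "\<exists>d. (K has_real_derivative d) (at y) \<and> 0 \<le> d"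
      using s k[of y] by (intro nonneg_derivI[OF K']) auto
  qed
  then show ?thesis by (simp add: K_def)
qed

text \<open>
  The numerator of the derivative of \<open>chi_ratio\<close>, written with hyperbolic functions, is \<open>- 2\<close> times the
  expression of \<open>chi_wronskian_bound\<close>.
\<close>

lemma chi_ratio_anti:
  assumes \<nu>: "\<nu> < 0" and s: "0 < r" "r \<le> s" "s \<le> pi"
  shows "chi_ratio \<nu> s \<le> chi_ratio \<nu> r"
proof (rule DERIV_nonpos_imp_nonincreasing[OF s(2)])
  fix x assume x: "r \<le> x" "x \<le> s"
  define n where "n = - \<nu>"
  have "chi \<nu> x > 0" using x s by (simp add: chi_pos_iff rho_pos)
  moreover have "2 * \<nu> * (chi \<nu> x * chi (- \<nu>) x) + (1 + \<nu>\<^sup>2) * sin x * (chi \<nu> x - chi (- \<nu>) x) \<le> 0"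
  proof -
    have "2 * \<nu> * (chi \<nu> x * chi (- \<nu>) x) + (1 + \<nu>\<^sup>2) * sin x * (chi \<nu> x - chi (- \<nu>) x)
        = - 2 * (n * ((cosh (n * x) - cos x)\<^sup>2 - (sinh (n * x) - n * sin x)\<^sup>2)
            - (1 + n\<^sup>2) * sin x * (sinh (n * x) - n * sin x))"
      by (simp add: n_def chi_sinh chi_minus_sinh algebra_simps power2_eq_square)
    also have "\<dots> = - 2 * (2 * n - 2 * n * cosh (n * x) * cos x + (n\<^sup>2 - 1) * sinh (n * x) * sin x
        + n * ((cosh (n * x))\<^sup>2 - (sinh (n * x))\<^sup>2 - 1) + n * ((sin x)\<^sup>2 + (cos x)\<^sup>2 - 1))"
      by (simp only: power2_eq_square) algebra
    also have "\<dots> = - 2 * (2 * n - 2 * n * cosh (n * x) * cos x + (n\<^sup>2 - 1) * sinh (n * x) * sin x)"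
      by (simp add: cosh_square_eq)
    finally show ?thesis using chi_wronskian_bound[of n x] \<nu> s x by (simp add: n_def)
  qed
  ultimately show "\<exists>y. (chi_ratio \<nu> has_real_derivative y) (at x) \<and> y \<le> 0"
    by (intro nonpos_derivI[OF DERIV_chi_ratio]) (auto intro: divide_nonpos_nonneg)
qed

lemma short_map_ratio: "u > 0 \<Longrightarrow> short_map \<nu> u = u * chi_ratio \<nu> (short_time \<nu> u)"
  using short_time[of u \<nu>] sin_gt_zero[of "short_time \<nu> u"]
  by (simp add: short_map_def chi_ratio_def)

text \<open>
  A larger distance takes a larger angle, for which the ratio of arrival to departure is smaller.
\<close>

lemma short_map_sublinear:
  assumes "\<nu> < 0" "0 < u" "u \<le> v"
  shows "u * short_map \<nu> v \<le> v * short_map \<nu> u"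
proof (cases "u = v")
  case False
  then have "short_time \<nu> u < short_time \<nu> v" using assms by (intro short_time_mono) auto
  then have "chi_ratio \<nu> (short_time \<nu> v) \<le> chi_ratio \<nu> (short_time \<nu> u)"
    using assms short_time[of u \<nu>] short_time[of v \<nu>] by (intro chi_ratio_anti) auto
  then show ?thesis using assms by (simp add: short_map_ratio mult_left_mono)
qed simp

lemma short_map_ge:
  assumes "\<nu> < 0" "0 < u"
  shows "short_map \<nu> u \<ge> exp (\<nu> * pi) * u"
  using chi_ratio_anti[OF assms(1), of "short_time \<nu> u" pi] short_time[OF assms(2), of \<nu>] assms
  by (simp add: short_map_ratio chi_ratio_pi)

text \<open>
  The half turn \<open>s = \<pi>\<close> is the limit of large excursions. By sublinearity it is enough to compare at one
  point, taken from an angle slightly below \<open>\<pi>\<close>.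
\<close>

lemma short_map_le:
  assumes "\<nu> < 0" "\<theta> > exp (\<nu> * pi)"
  shows "\<exists>u0>0. \<forall>u\<ge>u0. short_map \<nu> u \<le> \<theta> * u"
proof -
  have "chi \<nu> pi \<noteq> 0" by (simp add: chi_pi add_pos_pos less_imp_neq[symmetric])
  then have "isCont (chi_ratio \<nu>) pi" by (intro DERIV_isCont[OF DERIV_chi_ratio])
  then have "\<forall>\<^sub>F s in at pi. chi_ratio \<nu> s < \<theta>"
    using assms(2) by (auto simp: isCont_def order_tendsto_iff chi_ratio_pi)
  then obtain d where d: "d > 0" "\<And>s. s \<noteq> pi \<Longrightarrow> \<bar>s - pi\<bar> < d \<Longrightarrow> chi_ratio \<nu> s < \<theta>"
    by (auto simp: eventually_at dist_real_def)
  define s where "s = pi - min d 1 / 2"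
  have s: "0 < s" "s < pi" "\<bar>s - pi\<bar> < d" "s \<noteq> pi" using d pi_gt3 by (auto simp: s_def)
  define u0 where "u0 = chi \<nu> s / sin s"
  have u0: "u0 > 0" "chi \<nu> s = u0 * sin s"
    using s rho_pos[of s \<nu>] sin_gt_zero[of s] by (auto simp: u0_def chi_pos_iff)
  have "short_map \<nu> u0 \<le> \<theta> * u0"
    using short_time_unique[OF s(1,2) u0(2)] d(2)[OF s(4,3)] u0(1) by (simp add: short_map_ratio)
  then have "short_map \<nu> u \<le> \<theta> * u" if "u \<ge> u0" for u
  proof -
    have "u0 * short_map \<nu> u \<le> u * short_map \<nu> u0" using short_map_sublinear[OF assms(1) u0(1) that] .
    also have "\<dots> \<le> u * (\<theta> * u0)" using \<open>short_map \<nu> u0 \<le> \<theta> * u0\<close> that u0 by (intro mult_left_mono) auto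
    finally show ?thesis using u0(1) by (simp add: algebra_simps)
  qed
  then show ?thesis using u0(1) by blast
qed

definition long_time :: "real \<Rightarrow> real \<Rightarrow> real" where
  "long_time \<nu> v = (THE s. pi < s \<and> s < 2 * pi \<and> chi \<nu> s = - v * sin s)"

text \<open>
  At \<open>\<pi>\<close> the function \<open>chi \<nu> s + v sin s\<close> is positive, at \<open>2 \<pi>\<close> it is \<open>exp (- 2 \<pi> \<nu>) - 1 < 0\<close>.
\<close>

lemma long_time_exists:
  assumes "\<nu> > 0"
  shows "\<exists>s. pi < s \<and> s < 2 * pi \<and> chi \<nu> s = - v * sin s"
proof -
  define h where "h s = chi \<nu> s + v * sin s" for s
  have h: "h pi > 0" "h (2 * pi) < 0" using assms by (auto simp: h_def chi_pi add_pos_pos) (simp add: chi_def)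
  moreover have "continuous_on {pi..2 * pi} h" unfolding h_def by (intro continuous_intros continuous_chi)
  ultimately obtain s where s: "pi \<le> s" "s \<le> 2 * pi" "h s = 0" using IVT2'[of h "2 * pi" 0 pi] by auto
  then have "s \<noteq> pi" "s \<noteq> 2 * pi" using h by auto
  then show ?thesis using s by (intro exI[of _ s]) (auto simp: h_def)
qed

lemma long_time_unique:
  assumes "\<nu> > 0" "pi < s" "s < 2 * pi" "chi \<nu> s = - v * sin s"
  shows "long_time \<nu> v = s"
  unfolding long_time_def
proof (rule the_equality)
  fix r assume r: "pi < r \<and> r < 2 * pi \<and> chi \<nu> r = - v * sin r"
  have "sin s < 0" "sin r < 0" using r assms sin_neg by auto
  then have "chi \<nu> s / sin s = - v" "chi \<nu> r / sin r = - v" using r assms by auto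
  then show "r = s" using chi_div_sin_mono_long[of \<nu> r s] chi_div_sin_mono_long[of \<nu> s r] r assms
    by (cases r s rule: linorder_cases) auto
qed (use assms in auto)

lemma long_time:
  assumes "\<nu> > 0"
  shows "pi < long_time \<nu> v" "long_time \<nu> v < 2 * pi" "chi \<nu> (long_time \<nu> v) = - v * sin (long_time \<nu> v)"
  using long_time_exists[OF assms, of v] long_time_unique[OF assms] by metis+

lemma long_time_before:
  assumes "\<nu> > 0" "v \<ge> 0" "0 < s" "s < long_time \<nu> v"
  shows "chi \<nu> s > - v * sin s"
proof (cases "s \<le> pi")
  case True
  then have "chi \<nu> s > 0" using assms by (simp add: chi_pos_iff rho_pos)
  moreover have "v * sin s \<ge> 0" using True assms by (simp add: sin_ge_zero)
  ultimately show ?thesis by linarith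
next
  case False
  note lt = long_time[OF assms(1), of v]
  have "sin s < 0" "sin (long_time \<nu> v) < 0" using False assms lt by (auto intro!: sin_neg)
  then show ?thesis
    using chi_div_sin_mono_long[OF assms(1) _ assms(4) lt(2)] False lt(3) by (simp add: field_simps)
qed

definition long_map :: "real \<Rightarrow> real \<Rightarrow> real" where
  "long_map \<nu> v = - chi (- \<nu>) (long_time \<nu> v) / sin (long_time \<nu> v)"

lemma long_map_pos: "\<nu> > 0 \<Longrightarrow> long_map \<nu> v > 0"
proof -
  assume \<nu>: "\<nu> > 0"
  have "long_time \<nu> v > 0" using long_time(1)[OF \<nu>, of v] pi_gt_zero by linarith
  then have "chi (- \<nu>) (long_time \<nu> v) > 0" using \<nu> by (simp add: chi_pos_iff rho_pos_of_neg)
  then show ?thesis unfolding long_map_def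
    using sin_neg[of "long_time \<nu> v"] long_time[OF \<nu>, of v] by (simp add: field_simps)
qed

lemma long_time_anti:
  assumes "\<nu> > 0" "u < v"
  shows "long_time \<nu> v < long_time \<nu> u"
proof (rule ccontr)
  note lt = long_time[OF assms(1), of u] and lt' = long_time[OF assms(1), of v]
  have sin: "sin (long_time \<nu> v) < 0" "sin (long_time \<nu> u) < 0" using lt lt' by (auto intro!: sin_neg)
  assume "\<not> long_time \<nu> v < long_time \<nu> u"
  then consider "long_time \<nu> u = long_time \<nu> v" | "long_time \<nu> u < long_time \<nu> v" by linarith
  then show False
  proof cases
    case 1 then show ?thesis using lt lt' assms sin by auto
  next
    case 2 
    then show ?thesis using chi_div_sin_mono_long[OF assms(1) lt(1) 2 lt'(2)] lt lt' sin assms by simp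
  qed
qed

lemma long_map_mono:
  assumes "\<nu> > 0" "0 \<le> u" "u < v"
  shows "long_map \<nu> u < long_map \<nu> v"
proof -
  note lt = long_time[OF assms(1), of u] and lt' = long_time[OF assms(1), of v]
  have "chi (- \<nu>) (long_time \<nu> v) / sin (long_time \<nu> v) < chi (- \<nu>) (long_time \<nu> u) / sin (long_time \<nu> u)"
  proof (rule DERIV_pos_imp_increasing_open[OF long_time_anti[OF assms(1,3)]])
    fix x assume x: "long_time \<nu> v < x" "x < long_time \<nu> u"
    then have "pi < x" "x < 2 * pi" using lt lt' by auto
    then have sin: "sin x < 0" by (rule sin_neg)
    have "x > 0" using \<open>pi < x\<close> pi_gt_zero by linarith
    have "chi \<nu> x > - u * sin x" using long_time_before[OF assms(1,2) \<open>x > 0\<close> x(2)] .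
    moreover have "u * sin x \<le> 0" using sin assms(2) by (intro mult_nonneg_nonpos) auto
    ultimately have "chi \<nu> x > 0" by simp
    then show "\<exists>y. ((\<lambda>s. chi (- \<nu>) s / sin s) has_real_derivative y) (at x) \<and> 0 < y"
      using sin by (intro pos_derivI[OF DERIV_chi_div_sin]) (auto simp: chi_pos_iff)
  next
    have "sin x \<noteq> 0" if "x \<in> {long_time \<nu> v..long_time \<nu> u}" for x
      using sin_neg[of x] that lt lt' by auto
    then show "continuous_on {long_time \<nu> v..long_time \<nu> u} (\<lambda>s. chi (- \<nu>) s / sin s)"
      by (intro continuous_intros continuous_chi) auto
  qed
  then show ?thesis by (simp add: long_map_def)
qed

lemma long_map_ratio: "\<nu> > 0 \<Longrightarrow> v > 0 \<Longrightarrow> long_map \<nu> v = v * chi_ratio \<nu> (long_time \<nu> v)"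
  using long_time[of \<nu> v] sin_neg[of "long_time \<nu> v"]
  by (simp add: long_map_def chi_ratio_def)

lemma chi_pos_before_long_time:
  assumes "\<nu> > 0" "v > 0" "0 < s" "s \<le> long_time \<nu> v" 
  shows "chi \<nu> s > 0"
proof (cases "s \<le> pi")
  case True
  then show ?thesis using assms by (simp add: chi_pos_iff rho_pos)
next
  case False
  note lt = long_time[OF assms(1), of v]
  have sin: "sin s < 0" using False assms lt by (auto intro!: sin_neg)
  have "chi \<nu> s \<ge> - v * sin s"
    using long_time_before[of \<nu> v s] assms lt by (cases "s = long_time \<nu> v") auto
  moreover have "- v * sin s > 0" using sin assms by (simp add: mult_pos_neg)
  ultimately show ?thesis by linarith
qed

text \<open>
  For an unstable focus beyond the half turn both terms in the numerator of the derivative are positive,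
  because \<open>sin s < 0\<close> and \<open>chi \<nu> s < chi (- \<nu>) s\<close>.
\<close>

lemma chi_ratio_strict_mono:
  assumes \<nu>: "\<nu> > 0" and v: "v > 0" and s: "pi \<le> r" "r < s" "s \<le> long_time \<nu> v"
  shows "chi_ratio \<nu> r < chi_ratio \<nu> s"
proof (rule DERIV_pos_imp_increasing_open[OF s(2)])
  have pos: "chi \<nu> x > 0" if "r \<le> x" "x \<le> s" for x
    using that s pi_gt_zero by (intro chi_pos_before_long_time[OF \<nu> v]) linarith+
  { fix x assume x: "r < x" "x < s"
    have "x > 0" using x s pi_gt_zero by linarith
    then have "\<nu> * x > 0" using \<nu> by simp
    have sin: "sin x < 0" using x s long_time[OF \<nu>, of v] by (intro sin_neg) auto
    have A: "chi \<nu> x > 0" using pos x by simp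
    have B: "chi (- \<nu>) x > 0" using \<open>x > 0\<close> \<nu> by (simp add: chi_pos_iff rho_pos_of_neg)
    have "\<nu> * sin x < 0" using sin \<nu> by (simp add: mult_pos_neg)
    moreover have "sinh (\<nu> * x) > 0" using \<open>\<nu> * x > 0\<close> by simp
    ultimately have "chi \<nu> x - chi (- \<nu>) x < 0"
      unfolding chi_sinh[of \<nu>] chi_minus_sinh by linarith
    then have "(1 + \<nu>\<^sup>2) * sin x * (chi \<nu> x - chi (- \<nu>) x) > 0"
      using sin by (intro mult_neg_neg mult_pos_neg) (auto simp: add_pos_nonneg)
    moreover have "2 * \<nu> * (chi \<nu> x * chi (- \<nu>) x) > 0" using A B \<nu> by simp
    ultimately show "\<exists>y. (chi_ratio \<nu> has_real_derivative y) (at x) \<and> 0 < y"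
      using A by (intro pos_derivI[OF DERIV_chi_ratio]) auto }
  show "continuous_on {r..s} (chi_ratio \<nu>)"
    unfolding chi_ratio_def using pos by (intro continuous_intros continuous_chi) force
qed

lemma long_map_sublinear:
  assumes "\<nu> > 0" "0 < u" "u < v"
  shows "u * long_map \<nu> v < v * long_map \<nu> u"
proof -
  have "chi_ratio \<nu> (long_time \<nu> v) < chi_ratio \<nu> (long_time \<nu> u)"
    using long_time[OF assms(1), of v] long_time_anti[OF assms(1,3)]
    by (intro chi_ratio_strict_mono[OF assms(1,2)]) auto
  then show ?thesis using assms by (simp add: long_map_ratio)
qed

lemma long_map_gt:
  assumes "\<nu> > 0" "0 < v"
  shows "long_map \<nu> v > exp (\<nu> * pi) * v"
  using chi_ratio_strict_mono[OF assms, of pi "long_time \<nu> v"] long_time[OF assms(1), of v] assms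
  by (simp add: long_map_ratio chi_ratio_pi)

lemma long_map_le:
  assumes "\<nu> > 0" "\<theta> > exp (\<nu> * pi)"
  shows "\<exists>v0>0. \<forall>v\<ge>v0. long_map \<nu> v \<le> \<theta> * v"
proof -
  have chi_pi_pos: "chi \<nu> pi > 0" by (simp add: chi_pi add_pos_pos)
  then have "isCont (chi_ratio \<nu>) pi" by (intro DERIV_isCont[OF DERIV_chi_ratio]) auto
  then have "\<forall>\<^sub>F s in at pi. chi_ratio \<nu> s < \<theta>"
    using assms(2) by (auto simp: isCont_def order_tendsto_iff chi_ratio_pi)
  moreover have "isCont (chi \<nu>) pi" by (rule DERIV_isCont[OF DERIV_chi])
  then have "\<forall>\<^sub>F s in at pi. chi \<nu> s > 0"
    using chi_pi_pos by (auto simp: isCont_def order_tendsto_iff)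
  ultimately have "\<forall>\<^sub>F s in at pi. chi_ratio \<nu> s < \<theta> \<and> chi \<nu> s > 0" by eventually_elim auto
  then obtain d where d: "d > 0" "\<And>s. s \<noteq> pi \<Longrightarrow> \<bar>s - pi\<bar> < d \<Longrightarrow> chi_ratio \<nu> s < \<theta> \<and> chi \<nu> s > 0"
    by (auto simp: eventually_at dist_real_def)
  define s where "s = pi + min d 1 / 2"
  have s: "pi < s" "s < 2 * pi" "\<bar>s - pi\<bar> < d" "s \<noteq> pi" using d pi_gt3 by (auto simp: s_def)
  define v0 where "v0 = - chi \<nu> s / sin s"
  have v0: "v0 > 0" "chi \<nu> s = - v0 * sin s"
    using s sin_neg[of s] d(2)[OF s(4,3)] by (auto simp: v0_def divide_pos_neg)
  have "long_map \<nu> v0 \<le> \<theta> * v0"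
    using long_time_unique[OF assms(1) s(1,2) v0(2)] d(2)[OF s(4,3)] v0(1) assms by (simp add: long_map_ratio)
  then have "long_map \<nu> v \<le> \<theta> * v" if "v \<ge> v0" for v
  proof -
    have "v0 * long_map \<nu> v \<le> v * long_map \<nu> v0"
      using long_map_sublinear[OF assms(1) v0(1), of v] that by (cases "v = v0") auto
    also have "\<dots> \<le> v * (\<theta> * v0)" using \<open>long_map \<nu> v0 \<le> \<theta> * v0\<close> that v0 by (intro mult_left_mono) auto
    finally show ?thesis using v0(1) by (simp add: algebra_simps)
  qed
  then show ?thesis using v0(1) by blast
qed

section \<open>The normal form: two foci on the left of the switching line\<close>

lemma real2_eq_iff: "(v :: real^2) = w \<longleftrightarrow> v $ 1 = w $ 1 \<and> v $ 2 = w $ 2"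
  by (simp add: vec_eq_iff forall_2)

lemma affine_field_lipschitz:
  fixes G :: "side \<Rightarrow> real^2 \<Rightarrow> real^2"
  assumes G: "\<And>J z. G J z = vector [a1 J * z$1 + a2 J * z$2 + a3 J, b1 J * z$1 + b2 J * z$2 + b3 J]"
  shows "\<exists>K. lipschitz_pws G K"
proof -
  have "\<exists>K. K-lipschitz_on UNIV (G J)" for J
  proof -
    let ?l = "\<lambda>z::real^2. vector [a1 J * z$1 + a2 J * z$2, b1 J * z$1 + b2 J * z$2] :: real^2"
    have "bounded_linear ?l"
      by (intro linear_conv_bounded_linear[THEN iffD1] linearI) (auto simp: real2_eq_iff algebra_simps)
    then obtain K where K: "K > 0" "\<And>d. norm (?l d) \<le> norm d * K" using bounded_linear.pos_bounded by blast
    have diff: "G J z - G J z' = ?l (z - z')" for z z' by (simp add: G real2_eq_iff algebra_simps)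
    have "K-lipschitz_on UNIV (G J)"
    proof (intro lipschitz_onI)
      show "dist (G J x) (G J y) \<le> K * dist x y" for x y
        using K(2)[of "x - y"] unfolding dist_norm diff by (simp only: mult.commute)
    qed (use K in auto)
    then show ?thesis by blast
  qed
  then obtain k where k: "\<And>J. (k J)-lipschitz_on UNIV (G J)" by metis
  have "lipschitz_pws G (max (k L) (k R))"
  proof
    fix J show "(max (k L) (k R))-lipschitz_on UNIV (G J)"
      using k by (rule lipschitz_on_le) (cases J; simp)
  qed
  then show ?thesis by blast
qed

text \<open>
  The normal form with parameter value 1: rotation is clockwise since \<open>a2 > 0\<close>, and the sign of
  \<open>a3 b2 - a2 b3\<close> puts both foci in \<open>x < 0\<close>.
\<close>

locale two_foci =
  fixes a1 a2 a3 b1 b2 b3 lam \<omega> :: "side \<Rightarrow> real"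
  assumes trace: "a1 J + b2 J = 2 * lam J"
    and det: "a1 J * b2 J - a2 J * b1 J = (lam J)\<^sup>2 + (\<omega> J)\<^sup>2"
    and omega_pos: "\<omega> J > 0" and a2_pos: "a2 J > 0"
    and beta_pos: "a3 J * b2 J - a2 J * b3 J > 0"
    and lam_L: "lam L > 0" and lam_R: "lam R < 0"
    and tangency_order: "- a3 R / a2 R \<le> - a3 L / a2 L"
begin

definition V :: pws_field where
  "V J z = vector [a1 J * z $ 1 + a2 J * z $ 2 + a3 J, b1 J * z $ 1 + b2 J * z $ 2 + b3 J]"

definition D :: "side \<Rightarrow> real" where "D J = (lam J)\<^sup>2 + (\<omega> J)\<^sup>2"

definition \<nu> :: "side \<Rightarrow> real" where "\<nu> J = lam J / \<omega> J"

definition focus :: "side \<Rightarrow> real^2" where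
  "focus J = vector [- (a3 J * b2 J - a2 J * b3 J) / D J, (b1 J * a3 J - a1 J * b3 J) / D J]"

text \<open>
  The linear part minus \<open>lam\<close> times the identity. Its square is \<open>- \<omega>\<^sup>2\<close> by Cayley-Hamilton, which gives
  the explicit form of \<open>flow\<close>.
\<close>

definition dev :: "side \<Rightarrow> real^2 \<Rightarrow> real^2" where
  "dev J d = vector [(a1 J - lam J) * d $ 1 + a2 J * d $ 2, b1 J * d $ 1 + (b2 J - lam J) * d $ 2]"

definition flow :: "side \<Rightarrow> real \<Rightarrow> real^2 \<Rightarrow> real^2" where
  "flow J t z = focus J + exp (lam J * t) *\<^sub>R
     (cos (\<omega> J * t) *\<^sub>R (z - focus J) + (sin (\<omega> J * t) / \<omega> J) *\<^sub>R dev J (z - focus J))"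

definition \<xi> :: "side \<Rightarrow> real" where
  "\<xi> J = (a3 J * b2 J - a2 J * b3 J) * \<omega> J / (a2 J * D J)"

text \<open>
  Height of the tangency with the switching line. For \<open>R\<close> the orbit through this point lies in \<open>x < 0\<close>
  nearby, and so does the one for \<open>L\<close>: the latter touches the line from inside its own half-plane.
\<close>

definition tang :: "side \<Rightarrow> real" where "tang J = - a3 J / a2 J"

lemma D_pos: "D J > 0"
  using omega_pos[of J] by (simp add: D_def add_nonneg_pos)

lemma \<xi>_pos: "\<xi> J > 0"
  using omega_pos[of J] a2_pos[of J] beta_pos[of J] D_pos[of J] by (simp add: \<xi>_def)

lemma \<nu>_L: "\<nu> L > 0" and \<nu>_R: "\<nu> R < 0"
  using lam_L lam_R omega_pos by (auto simp: \<nu>_def divide_neg_pos)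

lemma dev_add: "dev J (c + d) = dev J c + dev J d"
  by (simp add: dev_def real2_eq_iff algebra_simps)

lemma dev_scaleR: "dev J (r *\<^sub>R d) = r *\<^sub>R dev J d"
  by (simp add: dev_def real2_eq_iff algebra_simps)

lemma dev_bounded_linear: "bounded_linear (dev J)"
  by (intro linear_conv_bounded_linear[THEN iffD1] linearI dev_add dev_scaleR)

lemma dev_dev: "dev J (dev J d) = - ((\<omega> J)\<^sup>2) *\<^sub>R d"
proof -
  have b2: "b2 J = 2 * lam J - a1 J" using trace[of J] by simp
  have w2: "(\<omega> J)\<^sup>2 = a1 J * (2 * lam J - a1 J) - a2 J * b1 J - (lam J)\<^sup>2" using det[of J] b2 by simp
  show ?thesis unfolding real2_eq_iff dev_def w2 b2
    by (simp add: algebra_simps power2_eq_square)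
qed

lemma V_eq: "V J z = lam J *\<^sub>R (z - focus J) + dev J (z - focus J)"
proof -
  have *: "a1 J * focus J $ 1 + a2 J * focus J $ 2 = - a3 J" "b1 J * focus J $ 1 + b2 J * focus J $ 2 = - b3 J"
  proof -
    have "D J = a1 J * b2 J - a2 J * b1 J" using det[of J] by (simp add: D_def)
    moreover have "D J \<noteq> 0" using D_pos[of J] by simp
    ultimately show "a1 J * focus J $ 1 + a2 J * focus J $ 2 = - a3 J" "b1 J * focus J $ 1 + b2 J * focus J $ 2 = - b3 J"
      by (auto simp: focus_def divide_simps) (auto simp: algebra_simps)
  qed
  show ?thesis unfolding V_def dev_def real2_eq_iff using * by (simp add: algebra_simps)
qed

lemma focus_neg: "focus J $ 1 < 0"
  using beta_pos[of J] D_pos[of J] by (simp add: focus_def divide_neg_pos)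

lemma flow_0 [simp]: "flow J 0 z = z"
  by (simp add: flow_def)

lemma flow_deriv: "((\<lambda>t. flow J t z) has_vector_derivative V J (flow J t z)) (at t within S)"
proof -
  define d where "d = z - focus J"
  let ?d = d and ?c = "cos (\<omega> J * t)" and ?s = "sin (\<omega> J * t)" and ?e = "exp (lam J * t)"
  have 1: "((\<lambda>t. exp (lam J * t) * cos (\<omega> J * t)) has_real_derivative
      ?e * (lam J * ?c - \<omega> J * ?s)) (at t within S)"
    by (auto intro!: derivative_eq_intros simp: algebra_simps)
  have 2: "((\<lambda>t. exp (lam J * t) * (sin (\<omega> J * t) / \<omega> J)) has_real_derivative
      ?e * (lam J * ?s / \<omega> J + ?c)) (at t within S)"
    using omega_pos[of J] by (auto intro!: derivative_eq_intros simp: field_simps)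
  have "((\<lambda>t. focus J + ((exp (lam J * t) * cos (\<omega> J * t)) *\<^sub>R ?d
      + (exp (lam J * t) * (sin (\<omega> J * t) / \<omega> J)) *\<^sub>R dev J ?d)) has_vector_derivative
      0 + ((?e * (lam J * ?c - \<omega> J * ?s)) *\<^sub>R ?d + (?e * (lam J * ?s / \<omega> J + ?c)) *\<^sub>R dev J ?d)) (at t within S)"
    using has_vector_derivative_scaleR[OF 1 has_vector_derivative_const[of ?d]]
      has_vector_derivative_scaleR[OF 2 has_vector_derivative_const[of "dev J ?d"]]
    by (intro has_vector_derivative_add has_vector_derivative_const) auto
  moreover have "V J (flow J t z) = (?e * (lam J * ?c - \<omega> J * ?s)) *\<^sub>R ?d + (?e * (lam J * ?s / \<omega> J + ?c)) *\<^sub>R dev J ?d"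
    using omega_pos[of J]
    by (simp add: V_eq flow_def d_def[symmetric] dev_add dev_scaleR dev_dev algebra_simps power2_eq_square)
  ultimately show ?thesis by (simp add: flow_def d_def scaleR_add_right)
qed

lemma flow_flow: "flow J s (flow J t z) = flow J (s + t) z"
proof -
  have "\<omega> J \<noteq> 0" using omega_pos[of J] by simp
  moreover define d where "d = z - focus J"
  ultimately show ?thesis
    by (simp add: flow_def d_def[symmetric] dev_add dev_scaleR dev_dev distrib_left exp_add cos_add sin_add
        algebra_simps power2_eq_square add_divide_distrib)
qed

lemma flow_continuous: "continuous_on S (\<lambda>t. flow J t z)"
  using flow_deriv has_vector_derivative_continuous continuous_on_eq_continuous_within by metis

text \<open>
  After the time \<open>\<pi> / \<omega>\<close> the position relative to the focus is reversed and scaled. So an orbit of the right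
  field that is in \<open>x > 0\<close> must leave it, and an orbit of the left field cannot stay bounded.
\<close>

lemma flow_half_turn: "flow J (t + pi / \<omega> J) z - focus J = - exp (lam J * pi / \<omega> J) *\<^sub>R (flow J t z - focus J)"
  using omega_pos[of J] by (simp add: flow_def distrib_left exp_add algebra_simps)

sublocale lipschitz_pws V "SOME K. lipschitz_pws V K"
  by (rule someI_ex, rule affine_field_lipschitz) (rule V_def)

lemma flow_lipschitz:
  "\<exists>C>0. \<forall>t\<in>{0..T}. \<forall>p q. norm (flow J t q - flow J t p) \<le> C * norm (q - p)"
proof -
  obtain K where K: "K > 0" "\<And>d. norm (dev J d) \<le> norm d * K"
    using bounded_linear.pos_bounded[OF dev_bounded_linear] by blast
  define C where "C = exp (\<bar>lam J\<bar> * \<bar>T\<bar>) * (1 + K / \<omega> J)"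
  have "norm (flow J t q - flow J t p) \<le> C * norm (q - p)" if t: "t \<in> {0..T}" for t p q
  proof -
    have "flow J t q - flow J t p = exp (lam J * t) *\<^sub>R
        (cos (\<omega> J * t) *\<^sub>R (q - p) + (sin (\<omega> J * t) / \<omega> J) *\<^sub>R dev J (q - p))"
      by (simp add: flow_def linear_diff[OF bounded_linear.linear[OF dev_bounded_linear]] algebra_simps)
    also have "norm \<dots> \<le> exp (lam J * t) * (\<bar>cos (\<omega> J * t)\<bar> * norm (q - p) + \<bar>sin (\<omega> J * t)\<bar> / \<omega> J * norm (dev J (q - p)))"
      using omega_pos[of J] norm_triangle_ineq[of "cos (\<omega> J * t) *\<^sub>R (q - p)" "(sin (\<omega> J * t) / \<omega> J) *\<^sub>R dev J (q - p)"]
      by simp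
    also have "\<dots> \<le> exp (\<bar>lam J\<bar> * \<bar>T\<bar>) * (1 * norm (q - p) + 1 / \<omega> J * (norm (q - p) * K))"
    proof (rule mult_mono)
      have "lam J * t \<le> \<bar>lam J\<bar> * \<bar>t\<bar>" by (metis abs_ge_self abs_mult)
      also have "\<dots> \<le> \<bar>lam J\<bar> * \<bar>T\<bar>" using t by (intro mult_left_mono) auto
      finally show "exp (lam J * t) \<le> exp (\<bar>lam J\<bar> * \<bar>T\<bar>)" by simp
      show "\<bar>cos (\<omega> J * t)\<bar> * norm (q - p) + \<bar>sin (\<omega> J * t)\<bar> / \<omega> J * norm (dev J (q - p))
          \<le> 1 * norm (q - p) + 1 / \<omega> J * (norm (q - p) * K)"
        using omega_pos[of J] K(2)[of "q - p"] by (intro add_mono mult_mono divide_right_mono) auto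
      show "0 \<le> \<bar>cos (\<omega> J * t)\<bar> * norm (q - p) + \<bar>sin (\<omega> J * t)\<bar> / \<omega> J * norm (dev J (q - p))"
        using omega_pos[of J] by simp
    qed simp
    finally show ?thesis by (simp add: C_def algebra_simps)
  qed
  moreover have "C > 0" using K omega_pos[of J] by (simp add: C_def add_pos_nonneg)
  ultimately show ?thesis by blast
qed

lemma V_on_line: "V J (vector [0, y]) $ 1 = a2 J * (y - tang J)"
  using a2_pos[of J] by (simp add: V_def tang_def field_simps)

lemma flow_x:
  "flow J t (vector [0, tang J + u]) $ 1
     = exp (lam J * t) * (a2 J / \<omega> J) * (u * sin (\<omega> J * t) - \<xi> J * chi (\<nu> J) (\<omega> J * t))"
proof -
  define k where "k = (a3 J * b2 J - a2 J * b3 J) / D J"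
  have p1: "focus J $ 1 = - k" by (simp add: focus_def k_def minus_divide_left)
  have nz: "\<omega> J \<noteq> 0" "a2 J \<noteq> 0" "D J \<noteq> 0" using omega_pos[of J] a2_pos[of J] D_pos[of J] by auto
  have p2: "a2 J * (tang J - focus J $ 2) = - a1 J * k"
  proof -
    have "V J (focus J) $ 1 = 0" unfolding V_eq by (simp add: dev_def)
    then have "a1 J * focus J $ 1 + a2 J * focus J $ 2 + a3 J = 0" by (simp add: V_def)
    then show ?thesis using nz p1 by (simp add: tang_def algebra_simps)
  qed
  have xk: "\<xi> J * a2 J = k * \<omega> J" using nz by (simp add: \<xi>_def k_def field_simps)
  have dv: "dev J (vector [0, tang J + u] - focus J) $ 1 = a2 J * u - lam J * k"
    using p1 p2 by (simp add: dev_def algebra_simps)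
  have e: "exp (lam J * t) * exp (- \<nu> J * (\<omega> J * t)) = 1"
    using nz by (simp add: \<nu>_def exp_minus_inverse mult_exp_exp)
  have "flow J t (vector [0, tang J + u]) $ 1
      = - k + exp (lam J * t) * (cos (\<omega> J * t) * k + sin (\<omega> J * t) / \<omega> J * (a2 J * u - lam J * k))"
    by (simp add: flow_def p1 dv)
  also have "\<dots> = exp (lam J * t) * (a2 J / \<omega> J * u * sin (\<omega> J * t)
      - k * (exp (- \<nu> J * (\<omega> J * t)) - cos (\<omega> J * t) + lam J / \<omega> J * sin (\<omega> J * t)))"
    using e nz by (simp add: algebra_simps)
  also have "exp (- \<nu> J * (\<omega> J * t)) - cos (\<omega> J * t) + lam J / \<omega> J * sin (\<omega> J * t) = chi (\<nu> J) (\<omega> J * t)"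
    by (simp add: chi_def \<nu>_def)
  also have "exp (lam J * t) * (a2 J / \<omega> J * u * sin (\<omega> J * t) - k * chi (\<nu> J) (\<omega> J * t))
      = exp (lam J * t) * (a2 J / \<omega> J) * (u * sin (\<omega> J * t) - (\<xi> J * a2 J / (\<omega> J * a2 J) * \<omega> J) * chi (\<nu> J) (\<omega> J * t))"
    using nz xk by (simp add: field_simps)
  finally show ?thesis using nz by simp
qed

text \<open>
  The height at the time of arrival is read off from the horizontal speed there, which is
  \<open>a2\<close> times the distance from the tangency.
\<close>

lemma flow_landing:
  assumes hit: "u * sin (\<omega> J * t) = \<xi> J * chi (\<nu> J) (\<omega> J * t)" and sin: "sin (\<omega> J * t) \<noteq> 0"
  shows "flow J t (vector [0, tang J + u])
    = vector [0, tang J - \<xi> J * chi (- \<nu> J) (\<omega> J * t) / sin (\<omega> J * t)]"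
proof -
  let ?s = "\<omega> J * t" and ?z = "flow J t (vector [0, tang J + u])"
  have nz: "\<omega> J \<noteq> 0" "a2 J \<noteq> 0" using omega_pos[of J] a2_pos[of J] by auto
  have x: "?z $ 1 = 0" using hit by (simp add: flow_x)
  have c: "((\<lambda>t. chi (\<nu> J) (\<omega> J * t)) has_real_derivative ((- \<nu> J * chi (\<nu> J) ?s + (1 + (\<nu> J)\<^sup>2) * sin ?s) * \<omega> J)) (at t)"
    using DERIV_chain2[OF DERIV_chi[of "\<nu> J" ?s UNIV] DERIV_cmult_Id[of "\<omega> J"]] by simp
  have "((\<lambda>t. flow J t (vector [0, tang J + u]) $ 1) has_real_derivative
     lam J * exp (lam J * t) * (a2 J / \<omega> J) * (u * sin ?s - \<xi> J * chi (\<nu> J) ?s)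
     + exp (lam J * t) * (a2 J / \<omega> J) * (u * (cos ?s * \<omega> J) - \<xi> J * ((- \<nu> J * chi (\<nu> J) ?s + (1 + (\<nu> J)\<^sup>2) * sin ?s) * \<omega> J))) (at t)"
  proof -
    have e: "((\<lambda>t. exp (lam J * t) * (a2 J / \<omega> J)) has_real_derivative lam J * exp (lam J * t) * (a2 J / \<omega> J)) (at t)"
      by (auto intro!: derivative_eq_intros simp: nz)
    have s: "((\<lambda>t. sin (\<omega> J * t)) has_real_derivative cos ?s * \<omega> J) (at t)"
      by (auto intro!: derivative_eq_intros)
    show ?thesis unfolding flow_x
      by (rule DERIV_cong[OF DERIV_mult[OF e DERIV_diff[OF DERIV_cmult[OF s] DERIV_cmult[OF c]]]])
        (simp add: algebra_simps)
  qed
  moreover have "((\<lambda>t. flow J t (vector [0, tang J + u]) $ 1) has_real_derivative V J ?z $ 1) (at t)"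
    using bounded_linear.has_vector_derivative[OF bounded_linear_vec_nth[of 1] flow_deriv[of J "vector [0, tang J + u]" t UNIV]]
    by (simp add: has_real_derivative_iff_has_vector_derivative)
  ultimately have "V J ?z $ 1 = exp (lam J * t) * (a2 J / \<omega> J) *
      (u * (cos ?s * \<omega> J) - \<xi> J * ((- \<nu> J * chi (\<nu> J) ?s + (1 + (\<nu> J)\<^sup>2) * sin ?s) * \<omega> J))"
    using hit by (auto dest: DERIV_unique)
  also have "\<dots> = exp (lam J * t) * a2 J * (u * cos ?s - \<xi> J * (- \<nu> J * chi (\<nu> J) ?s + (1 + (\<nu> J)\<^sup>2) * sin ?s))"
    using nz by (simp add: field_simps)
  also have "u * cos ?s - \<xi> J * (- \<nu> J * chi (\<nu> J) ?s + (1 + (\<nu> J)\<^sup>2) * sin ?s)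
      = - \<xi> J / sin ?s * \<rho> ?s (- \<nu> J)"
  proof -
    have "\<rho> ?s (- \<nu> J) = (- \<nu> J * chi (\<nu> J) ?s + (1 + (\<nu> J)\<^sup>2) * sin ?s) * sin ?s - chi (\<nu> J) ?s * cos ?s
       - ((sin ?s)\<^sup>2 + (cos ?s)\<^sup>2 - 1)"
      unfolding chi_def \<rho>_def by (simp add: algebra_simps power2_eq_square)
    then have "\<rho> ?s (- \<nu> J) = (- \<nu> J * chi (\<nu> J) ?s + (1 + (\<nu> J)\<^sup>2) * sin ?s) * sin ?s - chi (\<nu> J) ?s * cos ?s"
      by simp
    moreover have "u = \<xi> J * chi (\<nu> J) ?s / sin ?s" using hit sin by (simp add: field_simps)
    ultimately show ?thesis using sin by (simp only:) (simp add: field_simps)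
  qed
  also have "exp (lam J * t) * a2 J * (- \<xi> J / sin ?s * \<rho> ?s (- \<nu> J)) = - a2 J * (\<xi> J * chi (- \<nu> J) ?s / sin ?s)"
    using nz by (simp add: chi_rho \<nu>_def)
  finally have V1: "V J ?z $ 1 = - a2 J * (\<xi> J * chi (- \<nu> J) ?s / sin ?s)" .
  have "?z = vector [0, ?z $ 2]" using x by (simp add: real2_eq_iff)
  then have "a2 J * (?z $ 2 - tang J) = - a2 J * (\<xi> J * chi (- \<nu> J) ?s / sin ?s)"
    using V1 V_on_line[of J "?z $ 2"] by metis
  then have "a2 J * (?z $ 2 - tang J) = a2 J * (- (\<xi> J * chi (- \<nu> J) ?s / sin ?s))" by simp
  then have "?z $ 2 - tang J = - (\<xi> J * chi (- \<nu> J) ?s / sin ?s)"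
    using nz by (metis mult_left_cancel)
  then show ?thesis using x by (simp add: real2_eq_iff)
qed

subsection \<open>Excursions\<close>

text \<open>
  Duration and arrival distance of an excursion to the right that starts at distance \<open>u\<close> above \<open>tang R\<close>,
  and of an excursion to the left that starts at distance \<open>v\<close> below \<open>tang L\<close>.
\<close>

definition tR :: "real \<Rightarrow> real" where "tR u = short_time (\<nu> R) (u / \<xi> R) / \<omega> R"
definition PR :: "real \<Rightarrow> real" where "PR u = \<xi> R * short_map (\<nu> R) (u / \<xi> R)"
definition tL :: "real \<Rightarrow> real" where "tL v = long_time (\<nu> L) (v / \<xi> L) / \<omega> L"
definition PL :: "real \<Rightarrow> real" where "PL v = \<xi> L * long_map (\<nu> L) (v / \<xi> L)"

lemma tR_angle: "\<omega> R * tR u = short_time (\<nu> R) (u / \<xi> R)"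
  and tL_angle: "\<omega> L * tL v = long_time (\<nu> L) (v / \<xi> L)"
  using omega_pos[of R] omega_pos[of L] by (auto simp: tR_def tL_def)

lemma tR_pos: "u > 0 \<Longrightarrow> tR u > 0"
  using short_time(1)[of "u / \<xi> R" "\<nu> R"] \<xi>_pos[of R] omega_pos[of R] by (simp add: tR_def)

lemma tL_gt: "tL v > pi / \<omega> L"
  using long_time(1)[OF \<nu>_L, of "v / \<xi> L"] omega_pos[of L] by (simp add: tL_def divide_strict_right_mono)

lemma tL_pos: "tL v > 0"
  using tL_gt[of v] omega_pos[of L] by (smt (verit) divide_pos_pos pi_gt_zero)

lemma right_excursion_inside:
  assumes "u > 0" "0 < t" "t < tR u"
  shows "flow R t (vector [0, tang R + u]) $ 1 > 0"
proof -
  have "\<omega> R * t < short_time (\<nu> R) (u / \<xi> R)" "0 < \<omega> R * t"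
    using assms omega_pos[of R] by (auto simp: tR_angle[symmetric])
  from short_time_before[OF _ this(2,1)] assms \<xi>_pos[of R]
  have "\<xi> R * chi (\<nu> R) (\<omega> R * t) < u * sin (\<omega> R * t)" by (simp add: field_simps)
  then show ?thesis using a2_pos[of R] omega_pos[of R] by (simp add: flow_x)
qed

lemma right_excursion_end:
  assumes "u > 0"
  shows "flow R (tR u) (vector [0, tang R + u]) = vector [0, tang R - PR u]"
proof -
  have "u / \<xi> R > 0" using assms \<xi>_pos[of R] by simp
  note st = short_time[OF this, of "\<nu> R"]
  have "sin (\<omega> R * tR u) > 0" using st by (simp add: tR_angle sin_gt_zero)
  moreover have "u * sin (\<omega> R * tR u) = \<xi> R * chi (\<nu> R) (\<omega> R * tR u)"
    using st(3) \<xi>_pos[of R] by (simp add: tR_angle field_simps)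
  ultimately show ?thesis
    using flow_landing[of u R "tR u"] by (simp add: PR_def short_map_def tR_angle)
qed

lemma left_excursion_inside:
  assumes "v \<ge> 0" "0 < t" "t < tL v"
  shows "flow L t (vector [0, tang L - v]) $ 1 < 0"
proof -
  have "\<omega> L * t < long_time (\<nu> L) (v / \<xi> L)" "0 < \<omega> L * t" "v / \<xi> L \<ge> 0"
    using assms omega_pos[of L] \<xi>_pos[of L] by (auto simp: tL_angle[symmetric])
  from long_time_before[OF \<nu>_L this(3,2,1)] \<xi>_pos[of L]
  have "\<xi> L * chi (\<nu> L) (\<omega> L * t) > - v * sin (\<omega> L * t)" by (simp add: field_simps)
  then have "exp (lam L * t) * (a2 L / \<omega> L) * (- v * sin (\<omega> L * t) - \<xi> L * chi (\<nu> L) (\<omega> L * t)) < 0"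
    using a2_pos[of L] omega_pos[of L] by (intro mult_pos_neg) auto
  then show ?thesis using flow_x[of L t "- v"] by simp
qed

lemma left_excursion_end: "flow L (tL v) (vector [0, tang L - v]) = vector [0, tang L + PL v]"
proof -
  note lt = long_time[OF \<nu>_L, of "v / \<xi> L"]
  have "sin (\<omega> L * tL v) < 0" using lt by (simp add: tL_angle sin_neg)
  moreover have "- v * sin (\<omega> L * tL v) = \<xi> L * chi (\<nu> L) (\<omega> L * tL v)"
    using lt(3) \<xi>_pos[of L] by (simp add: tL_angle field_simps)
  ultimately show ?thesis
    using flow_landing[of "- v" L "tL v"] by (simp add: PL_def long_map_def tL_angle)
qed

text \<open>
  Backwards in time the left orbit through the tangency spirals into the focus without reaching the line
  again.
\<close>

lemma grazing_past:
  assumes "t < 0"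
  shows "flow L t (vector [0, tang L]) $ 1 < 0"
proof -
  have "chi (\<nu> L) (\<omega> L * t) = chi (- \<nu> L) (- (\<omega> L * t))" by (simp add: chi_def)
  moreover have "- (\<omega> L * t) > 0" using assms omega_pos[of L] by (simp add: mult_pos_neg)
  ultimately have "chi (\<nu> L) (\<omega> L * t) > 0" using \<nu>_L by (simp add: chi_pos_iff rho_pos_of_neg)
  then show ?thesis using flow_x[of L t 0] a2_pos[of L] omega_pos[of L] \<xi>_pos[of L] by simp
qed

lemma PR_pos: "u > 0 \<Longrightarrow> PR u > 0" and PL_pos: "PL v > 0"
  using \<xi>_pos[of R] \<xi>_pos[of L] short_map_pos[of "u / \<xi> R" "\<nu> R"] long_map_pos[OF \<nu>_L, of "v / \<xi> L"]
  by (auto simp: PR_def PL_def)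

lemma PR_mono: "0 < u \<Longrightarrow> u < u' \<Longrightarrow> PR u < PR u'"
  and PL_mono: "0 \<le> v \<Longrightarrow> v < v' \<Longrightarrow> PL v < PL v'"
  using \<xi>_pos[of R] \<xi>_pos[of L] \<nu>_L
  by (auto simp: PR_def PL_def intro!: short_map_mono long_map_mono divide_strict_right_mono)

lemma PR_sublinear:
  assumes "0 < u" "u \<le> u'" shows "u * PR u' \<le> u' * PR u"
  using short_map_sublinear[OF \<nu>_R, of "u / \<xi> R" "u' / \<xi> R"] assms \<xi>_pos[of R]
  by (simp add: PR_def divide_right_mono field_simps)

lemma PL_sublinear:
  assumes "0 < v" "v < v'" shows "v * PL v' < v' * PL v"
  using long_map_sublinear[OF \<nu>_L, of "v / \<xi> L" "v' / \<xi> L"] assms \<xi>_pos[of L]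
  by (simp add: PL_def divide_strict_right_mono field_simps)

lemma PR_ge: "0 < u \<Longrightarrow> PR u \<ge> exp (\<nu> R * pi) * u"
  using short_map_ge[OF \<nu>_R, of "u / \<xi> R"] \<xi>_pos[of R] by (simp add: PR_def field_simps)

lemma PL_gt: "0 < v \<Longrightarrow> PL v > exp (\<nu> L * pi) * v"
  using long_map_gt[OF \<nu>_L, of "v / \<xi> L"] \<xi>_pos[of L] by (simp add: PL_def field_simps)

lemma PR_le:
  assumes "\<theta> > exp (\<nu> R * pi)" shows "\<exists>u0>0. \<forall>u\<ge>u0. PR u \<le> \<theta> * u"
proof -
  obtain u0 where "u0 > 0" and *: "\<And>u. u \<ge> u0 \<Longrightarrow> short_map (\<nu> R) u \<le> \<theta> * u"
    using short_map_le[OF \<nu>_R assms] by blast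
  moreover have "PR u \<le> \<theta> * u" if "u \<ge> \<xi> R * u0" for u
  proof -
    have "short_map (\<nu> R) (u / \<xi> R) \<le> \<theta> * (u / \<xi> R)"
      using that \<xi>_pos[of R] by (intro *) (simp add: field_simps)
    then show ?thesis using \<xi>_pos[of R] by (simp add: PR_def field_simps)
  qed
  ultimately show ?thesis using \<xi>_pos[of R] by (intro exI[of _ "\<xi> R * u0"]) auto
qed

lemma PL_le:
  assumes "\<theta> > exp (\<nu> L * pi)" shows "\<exists>v0>0. \<forall>v\<ge>v0. PL v \<le> \<theta> * v"
proof -
  obtain v0 where "v0 > 0" and *: "\<And>v. v \<ge> v0 \<Longrightarrow> long_map (\<nu> L) v \<le> \<theta> * v"
    using long_map_le[OF \<nu>_L assms] by blast
  moreover have "PL v \<le> \<theta> * v" if "v \<ge> \<xi> L * v0" for v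
  proof -
    have "long_map (\<nu> L) (v / \<xi> L) \<le> \<theta> * (v / \<xi> L)"
      using that \<xi>_pos[of L] by (intro *) (simp add: field_simps)
    then show ?thesis using \<xi>_pos[of L] by (simp add: PL_def field_simps)
  qed
  ultimately show ?thesis using \<xi>_pos[of L] by (intro exI[of _ "\<xi> L * v0"]) auto
qed

subsection \<open>The return map\<close>

text \<open>
  Length of the repelling segment between the two tangencies.
\<close>

definition w :: real where "w = tang L - tang R"

lemma w_nonneg: "w \<ge> 0"
  using tangency_order by (simp add: w_def tang_def)

text \<open>
  The return map in terms of the distance \<open>u\<close> below \<open>tang R\<close>: the left excursion starts at distance
  \<open>u + w\<close> below \<open>tang L\<close>, and it arrives at distance \<open>w + PL (u + w)\<close> above \<open>tang R\<close>.
\<close>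

definition ret :: "real \<Rightarrow> real" where "ret u = PR (w + PL (u + w))"

lemma ret_pos: "ret u > 0"
  using w_nonneg PL_pos by (simp add: ret_def PR_pos add_nonneg_pos)

lemma ret_mono:
  assumes "- w \<le> u" "u < u'" shows "ret u < ret u'"
  unfolding ret_def using assms w_nonneg PL_pos[of "u + w"]
  by (intro PR_mono add_strict_left_mono PL_mono) auto

text \<open>
  For a factor \<open>c > 1\<close>, \<open>c u + w \<le> c (u + w)\<close> because \<open>w \<ge> 0\<close>. So the shifts by \<open>w\<close> preserve the
  sublinearity of the two half maps.
\<close>

lemma ret_sublinear:
  assumes "0 < u" "u < u'" shows "u * ret u' < u' * ret u"
proof -
  define c where "c = u' / u"
  have c: "c > 1" "u' = c * u" using assms by (auto simp: c_def)
  have cw: "c * w \<ge> w" using w_nonneg c mult_right_mono[of 1 c w] by simp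
  have "PL (u' + w) < c * PL (u + w)"
  proof -
    have "(u + w) * PL (c * (u + w)) < c * (u + w) * PL (u + w)"
      using assms w_nonneg c by (intro PL_sublinear) auto
    then have "PL (c * (u + w)) < c * PL (u + w)"
      using assms w_nonneg by (metis add_pos_nonneg mult.assoc mult.left_commute mult_less_cancel_left_pos)
    moreover have "PL (u' + w) \<le> PL (c * (u + w))"
      using PL_mono[of "u' + w" "c * (u + w)"] cw c assms w_nonneg
      by (cases "u' + w = c * (u + w)") (auto simp: algebra_simps)
    ultimately show ?thesis by linarith
  qed
  then have "w + PL (u' + w) < c * (w + PL (u + w))" using cw by (simp add: distrib_left)
  then have "ret u' < PR (c * (w + PL (u + w)))"
    unfolding ret_def using w_nonneg PL_pos[of "u' + w"] by (intro PR_mono) auto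
  also have "\<dots> \<le> c * ret u"
  proof -
    define x where "x = w + PL (u + w)"
    have x: "x > 0" using w_nonneg PL_pos[of "u + w"] by (simp add: x_def)
    have "x * PR (c * x) \<le> (c * x) * PR x" using x c by (intro PR_sublinear) auto
    then have "x * PR (c * x) \<le> x * (c * PR x)" by (simp add: algebra_simps)
    then show ?thesis using x by (simp add: ret_def x_def)
  qed
  finally show ?thesis using c assms by (simp add: algebra_simps)
qed

text \<open>
  Each half map lies above the line through the origin to which it is asymptotically parallel.
\<close>

lemma ret_gt_expanding:
  assumes "\<nu> L + \<nu> R \<ge> 0" "u > 0" shows "ret u > u"
proof -
  define x where "x = w + PL (u + w)"
  have "exp (\<nu> L * pi) * u \<le> exp (\<nu> L * pi) * (u + w)" using w_nonneg by simp
  also have "\<dots> < PL (u + w)" using assms w_nonneg by (intro PL_gt) auto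
  finally have x: "exp (\<nu> L * pi) * u < x" using w_nonneg by (simp add: x_def)
  have "x > 0" using w_nonneg PL_pos[of "u + w"] by (simp add: x_def)
  have "u \<le> exp ((\<nu> L + \<nu> R) * pi) * u" using assms by simp
  also have "\<dots> = exp (\<nu> R * pi) * (exp (\<nu> L * pi) * u)" by (simp add: algebra_simps exp_add)
  also have "\<dots> < exp (\<nu> R * pi) * x" using x by simp
  also have "\<dots> \<le> ret u" using PR_ge[OF \<open>x > 0\<close>] by (simp add: ret_def x_def)
  finally show ?thesis .
qed

lemma ret_lt_far:
  assumes "\<nu> L + \<nu> R < 0" shows "\<exists>u>0. ret u < u"
proof -
  define \<epsilon> where "\<epsilon> = - (\<nu> L + \<nu> R) * pi / 4"
  have \<epsilon>: "\<epsilon> > 0" using assms by (simp add: \<epsilon>_def)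
  define \<theta>R \<theta>L where "\<theta>R = exp (\<nu> R * pi + \<epsilon>)" and "\<theta>L = exp (\<nu> L * pi + \<epsilon>)"
  have th: "\<theta>R > exp (\<nu> R * pi)" "\<theta>L > exp (\<nu> L * pi)" "\<theta>R > 0" "\<theta>L > 0" using \<epsilon> by (auto simp: \<theta>R_def \<theta>L_def)
  have "\<theta>R * \<theta>L = exp (- 2 * \<epsilon>)"
    by (simp add: \<theta>R_def \<theta>L_def mult_exp_exp \<epsilon>_def algebra_simps)
  then have lt1: "\<theta>R * \<theta>L < 1" using \<epsilon> by simp
  obtain u0 where u0: "u0 > 0" "\<And>u. u \<ge> u0 \<Longrightarrow> PR u \<le> \<theta>R * u" using PR_le[OF th(1)] by blast
  obtain v0 where v0: "v0 > 0" "\<And>v. v \<ge> v0 \<Longrightarrow> PL v \<le> \<theta>L * v" using PL_le[OF th(2)] by blast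
  define c where "c = \<theta>R * (w + \<theta>L * w)"
  have "c \<ge> 0" using w_nonneg th by (simp add: c_def)
  define u where "u = max (max u0 v0) (c / (1 - \<theta>R * \<theta>L) + 1)"
  have u: "u \<ge> u0" "u \<ge> v0" "u > c / (1 - \<theta>R * \<theta>L)" "u > 0" using u0(1) by (auto simp: u_def)
  have "PL (u + w) > exp (\<nu> L * pi) * (u + w)" using u w_nonneg by (intro PL_gt) auto
  moreover have "exp (\<nu> L * pi) * (u + w) \<ge> 1 * (u + w)"
    using u w_nonneg \<nu>_L by (intro mult_right_mono) auto
  ultimately have "PL (u + w) > u + w" by simp
  then have "w + PL (u + w) \<ge> u0" using u w_nonneg by linarith
  then have "ret u \<le> \<theta>R * (w + PL (u + w))" unfolding ret_def by (rule u0(2))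
  also have "\<dots> \<le> \<theta>R * (w + \<theta>L * (u + w))"
    using v0(2)[of "u + w"] u w_nonneg th by (intro mult_left_mono add_left_mono) auto
  also have "\<dots> = c + \<theta>R * \<theta>L * u" by (simp add: c_def algebra_simps)
  also have "\<dots> < u" using u(3) lt1 by (simp add: field_simps)
  finally show ?thesis using u by blast
qed

text \<open>
  The fixed point is the supremum of all \<open>u\<close> with \<open>u \<le> ret u\<close>. Sublinearity makes this set an interval
  starting at 0, and monotonicity of \<open>ret\<close> gives equality at its end.
\<close>

lemma ret_fixed_point:
  assumes "\<nu> L + \<nu> R < 0"
  shows "\<exists>x>0. ret x = x \<and> (\<forall>u>0. (u < x \<longrightarrow> ret u > u) \<and> (u > x \<longrightarrow> ret u < u))"
proof -
  define S where "S = {u. u > 0 \<and> ret u \<ge> u}"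
  obtain b where b: "b > 0" "ret b < b" using ret_lt_far[OF assms] by blast
  have down: "ret u > u" if "u > 0" "u < v" "v \<in> S" for u v
  proof -
    have "v * u \<le> ret v * u" using that by (simp add: S_def)
    also have "\<dots> < v * ret u" using ret_sublinear[of u v] that by (simp add: mult.commute)
    finally show ?thesis using that by simp
  qed
  have bd: "u \<le> b" if "u \<in> S" for u
    using down[of b u] b that by force
  have "ret 0 > 0" by (rule ret_pos)
  have ne: "ret 0 / 2 \<in> S"
    using ret_mono[of 0 "ret 0 / 2"] w_nonneg \<open>ret 0 > 0\<close> by (simp add: S_def)
  have bdd: "bdd_above S" using bd by (rule bdd_aboveI)
  define x where "x = Sup S"
  have x: "x > 0" using cSup_upper[OF ne bdd] \<open>ret 0 > 0\<close> by (simp add: x_def)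
  have below: "ret u > u" if "u > 0" "u < x" for u
    using less_cSupE[of u S] that ne down by (metis empty_iff x_def)
  have above: "ret u < u" if "u > x" for u
    using cSup_upper[of u S] bdd that x by (force simp: S_def x_def)
  have "ret x \<ge> x"
  proof (rule ccontr)
    assume "\<not> ret x \<ge> x"
    then obtain u where u: "ret x < u" "u < x" using dense[of "ret x" x] by (auto simp: not_le)
    then have "u > 0" using ret_pos[of x] by linarith
    then have "ret u < ret x" using u w_nonneg by (intro ret_mono) auto
    then show False using below[OF \<open>u > 0\<close> u(2)] u by simp
  qed
  moreover have "ret x \<le> x"
  proof (rule ccontr)
    assume "\<not> ret x \<le> x"
    then obtain u where u: "x < u" "u < ret x" using dense[of x "ret x"] by (auto simp: not_le)
    have "ret x < ret u" using u x w_nonneg by (intro ret_mono) auto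
    then show False using above[OF u(1)] u by simp
  qed
  ultimately show ?thesis using x below above by (intro exI[of _ x]) auto
qed

text \<open>
  The iterates are monotone and stay on their side of \<open>x\<close>. A limit \<open>l\<close> other than \<open>x\<close> is excluded by
  sublinearity.
\<close>

lemma ret_iterates_converge:
  assumes x: "x > 0" "ret x = x" and below: "\<And>u. 0 < u \<Longrightarrow> u < x \<Longrightarrow> ret u > u"
    and above: "\<And>u. x < u \<Longrightarrow> ret u < u" and u: "u > 0"
  shows "(\<lambda>n. (ret ^^ n) u) \<longlonglongrightarrow> x" "\<bar>(ret ^^ n) u - x\<bar> \<le> \<bar>u - x\<bar>" "(ret ^^ n) u > 0"
proof -
  let ?u = "\<lambda>n. (ret ^^ n) u"
  have pos: "?u n > 0" for n using u ret_pos by (cases n) auto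
  have ge: "ret v \<ge> x" if "v \<ge> x" for v
    using ret_mono[of x v] that x w_nonneg by (cases "v = x") auto
  have le: "ret v \<le> x" if "0 < v" "v \<le> x" for v
    using ret_mono[of v x] that x w_nonneg by (cases "v = x") auto
  have *: "?u \<longlonglongrightarrow> x \<and> \<bar>?u n - x\<bar> \<le> \<bar>u - x\<bar>"
  proof (cases "u \<le> x")
    case True
    have lex: "?u n \<le> x" for n by (induction n) (use True le pos in auto)
    have up: "?u n \<le> ?u (Suc n)" for n
      using below[OF pos[of n]] lex[of n] x by (cases "?u n = x") (auto simp: less_le)
    then have inc: "incseq ?u" by (rule incseq_SucI)
    have "u \<le> ?u n" for n using incseqD[OF inc, of 0 n] by simp
    from this[of n] have "\<bar>?u n - x\<bar> \<le> \<bar>u - x\<bar>" using lex[of n] True by simp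
    moreover obtain l where l: "?u \<longlonglongrightarrow> l" "\<And>i. ?u i \<le> l" using incseq_convergent[OF inc, of x] lex by auto
    have "l \<le> x" using l lex by (intro LIMSEQ_le_const2[OF l(1)]) auto
    have l0: "l > 0" using l(2)[of 0] u by simp
    have "l = x"
    proof (rule ccontr)
      assume "l \<noteq> x"
      then have gt: "ret l > l" using \<open>l \<le> x\<close> l0 by (intro below) auto
      have "?u n * ret l \<le> l * ?u (Suc n)" for n
        using ret_sublinear[of "?u n" l] pos[of n] l(2)[of n] by (cases "?u n = l") auto
      then have "l * ret l \<le> l * l"
        by (intro LIMSEQ_le[OF tendsto_mult_right[OF l(1)] tendsto_mult_left[OF LIMSEQ_Suc[OF l(1)]]] exI[of _ 0] allI impI)
      then show False using gt l0 by simp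
    qed
    ultimately show ?thesis using l by simp
  next
    case False
    have gex: "?u n \<ge> x" for n by (induction n) (use False ge in auto)
    have dn: "?u (Suc n) \<le> ?u n" for n
      using above[of "?u n"] gex[of n] x by (cases "?u n = x") (auto simp: less_le)
    then have dec: "decseq ?u" by (rule decseq_SucI)
    have "u \<ge> ?u n" for n using decseqD[OF dec, of 0 n] by simp
    from this[of n] have "\<bar>?u n - x\<bar> \<le> \<bar>u - x\<bar>" using gex[of n] False by simp
    moreover obtain l where l: "?u \<longlonglongrightarrow> l" "\<And>i. l \<le> ?u i" using decseq_convergent[OF dec, of x] gex by auto
    have "l \<ge> x" using l gex by (intro LIMSEQ_le_const[OF l(1)]) auto
    have "l = x"
    proof (rule ccontr)
      assume "l \<noteq> x"
      then have lt: "ret l < l" using \<open>l \<ge> x\<close> by (intro above) auto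
      have l0: "l > 0" using \<open>l \<ge> x\<close> x by simp
      have "l * ?u (Suc n) \<le> ?u n * ret l" for n
        using ret_sublinear[of l "?u n"] l0 l(2)[of n] by (cases "?u n = l") auto
      then have "l * l \<le> l * ret l"
        by (intro LIMSEQ_le[OF tendsto_mult_left[OF LIMSEQ_Suc[OF l(1)]] tendsto_mult_right[OF l(1)]] exI[of _ 0] allI impI)
      then show False using lt l0 by simp
    qed
    ultimately show ?thesis using l by simp
  qed
  from * show "?u \<longlonglongrightarrow> x" "\<bar>?u n - x\<bar> \<le> \<bar>u - x\<bar>" by auto
  show "?u n > 0" by (rule pos)
qed

end

context two_foci
begin

section \<open>Solutions through the Poincare section\<close>

definition down_pt :: "real \<Rightarrow> real^2" where "down_pt u = vector [0, tang R - u]"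
definition up_pt :: "real \<Rightarrow> real^2" where "up_pt v = vector [0, tang L + v]"

lemma down_pt_nth [simp]: "down_pt u $ 1 = 0" "down_pt u $ 2 = tang R - u" by (simp_all add: down_pt_def)
lemma up_pt_nth [simp]: "up_pt v $ 1 = 0" "up_pt v $ 2 = tang L + v" by (simp_all add: up_pt_def)

lemma down_pt_left: "down_pt u = vector [0, tang L - (u + w)]"
  by (simp add: down_pt_def w_def)

lemma up_pt_right: "up_pt v = vector [0, tang R + (w + v)]"
  by (simp add: up_pt_def w_def)

lemma V_down_pt: "u > 0 \<Longrightarrow> V J (down_pt u) $ 1 < 0"
  using a2_pos[of J] w_nonneg by (cases J) (auto simp: down_pt_def V_on_line w_def mult_pos_neg)

lemma V_up_pt: "v > 0 \<Longrightarrow> V J (up_pt v) $ 1 > 0"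
  using a2_pos[of J] w_nonneg by (cases J) (auto simp: up_pt_def V_on_line w_def)

lemma flow_left_inside: "u \<ge> - w \<Longrightarrow> 0 < t \<Longrightarrow> t < tL (u + w) \<Longrightarrow> flow L t (down_pt u) $ 1 < 0"
  unfolding down_pt_left by (rule left_excursion_inside) auto

lemma flow_left_end: "flow L (tL (u + w)) (down_pt u) = up_pt (PL (u + w))"
  unfolding down_pt_left up_pt_def by (rule left_excursion_end)

lemma flow_right_inside: "v > 0 \<Longrightarrow> 0 < t \<Longrightarrow> t < tR (w + v) \<Longrightarrow> flow R t (up_pt v) $ 1 > 0"
  unfolding up_pt_right using w_nonneg by (intro right_excursion_inside) auto

lemma flow_right_end: "v > 0 \<Longrightarrow> flow R (tR (w + v)) (up_pt v) = down_pt (PR (w + v))"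
  unfolding up_pt_right down_pt_def using w_nonneg by (intro right_excursion_end) auto

lemma left_leg:
  assumes sol: "filippov_solution V I z" and I: "{t0..t0 + tL (u + w)} \<subseteq> I"
    and z: "z t0 = down_pt u" and u: "u > 0" and t: "t \<in> {0..tL (u + w)}"
  shows "z (t0 + t) = flow L t (down_pt u)"
proof (rule solution_follows[OF sol I, where J = L and \<psi> = "\<lambda>t. flow L t (down_pt u)"])
  show "side_sgn L * z t0 $ 1 > 0 \<or> z t0 $ 1 = 0 \<and> (\<forall>K. side_sgn L * V K (z t0) $ 1 > 0)"
    using V_down_pt[OF u] z by simp
qed (use z t u w_nonneg flow_left_inside in \<open>auto intro!: flow_deriv\<close>)

lemma right_leg:
  assumes sol: "filippov_solution V I z" and I: "{t0..t0 + tR (w + v)} \<subseteq> I"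
    and z: "z t0 = up_pt v" and v: "v > 0" and t: "t \<in> {0..tR (w + v)}"
  shows "z (t0 + t) = flow R t (up_pt v)"
proof (rule solution_follows[OF sol I, where J = R and \<psi> = "\<lambda>t. flow R t (up_pt v)"])
  show "side_sgn R * z t0 $ 1 > 0 \<or> z t0 $ 1 = 0 \<and> (\<forall>K. side_sgn R * V K (z t0) $ 1 > 0)"
    using V_up_pt[OF v] z by simp
qed (use z t v flow_right_inside in \<open>auto intro!: flow_deriv\<close>)

text \<open>
  One full turn starting at \<open>down_pt u\<close>. For \<open>u = - w\<close> this is the point of tangency of the left field, and
  the formula makes sense for all negative times as well.
\<close>

definition turn :: "real \<Rightarrow> real \<Rightarrow> real^2" where
  "turn u t = (if t \<le> tL (u + w) then flow L t (down_pt u)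
     else flow R (t - tL (u + w)) (up_pt (PL (u + w))))"

definition turn_time :: "real \<Rightarrow> real" where
  "turn_time u = tL (u + w) + tR (w + PL (u + w))"

lemma turn_time_gt: "turn_time u > pi / \<omega> L"
  using tL_gt[of "u + w"] tR_pos[of "w + PL (u + w)"] PL_pos[of "u + w"] w_nonneg
  by (simp add: turn_time_def)

lemma turn_time_pos: "turn_time u > 0"
  using turn_time_gt[of u] omega_pos[of L] by (smt (verit) divide_pos_pos pi_gt_zero)

lemma turn_0 [simp]: "turn u 0 = down_pt u"
  using tL_pos[of "u + w"] by (simp add: turn_def)

lemma turn_end: "turn u (turn_time u) = down_pt (ret u)"
  using tR_pos[of "w + PL (u + w)"] PL_pos[of "u + w"] w_nonneg
  by (simp add: turn_def turn_time_def flow_right_end ret_def)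

lemma one_turn:
  assumes sol: "filippov_solution V I z" and I: "{t0..t0 + turn_time u} \<subseteq> I"
    and z: "z t0 = down_pt u" and u: "u > 0" and t: "t \<in> {0..turn_time u}"
  shows "z (t0 + t) = turn u t"
proof (cases "t \<le> tL (u + w)")
  case True
  have "tR (w + PL (u + w)) > 0" using PL_pos[of "u + w"] w_nonneg by (intro tR_pos) auto
  then have "{t0..t0 + tL (u + w)} \<subseteq> I" using I by (auto simp: turn_time_def)
  from left_leg[OF sol this z u] True t show ?thesis by (simp add: turn_def)
next
  case False
  have "tR (w + PL (u + w)) > 0" using PL_pos[of "u + w"] w_nonneg by (intro tR_pos) auto
  then have I1: "{t0..t0 + tL (u + w)} \<subseteq> I"
    and I2: "{t0 + tL (u + w)..t0 + tL (u + w) + tR (w + PL (u + w))} \<subseteq> I"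
    using I tL_pos[of "u + w"] by (auto simp: turn_time_def subset_iff)
  have "z (t0 + tL (u + w)) = up_pt (PL (u + w))"
    using left_leg[OF sol I1 z u, of "tL (u + w)"] tL_pos[of "u + w"] by (simp add: flow_left_end)
  from right_leg[OF sol I2 this PL_pos, of "t - tL (u + w)"] False t
  show ?thesis by (simp add: turn_def turn_time_def)
qed

text \<open>
  The Poincare section: both fields point into \<open>x < 0\<close> here.
\<close>

definition section_L :: "(real^2) set" where "section_L = {p. p $ 1 = 0 \<and> p $ 2 < tang R}"

lemma section_L_iff: "p \<in> section_L \<longleftrightarrow> (\<exists>u>0. p = down_pt u)"
proof
  assume "p \<in> section_L"
  then show "\<exists>u>0. p = down_pt u"
    by (intro exI[of _ "tang R - p $ 2"]) (auto simp: section_L_def real2_eq_iff)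
qed (auto simp: section_L_def)

lemma turn_inside:
  assumes "u > 0" "0 < t" "t < turn_time u"
  shows "turn u t \<notin> section_L"
proof -
  consider "t < tL (u + w)" | "t = tL (u + w)" | "t > tL (u + w)" by linarith
  then show ?thesis
  proof cases
    case 1 then show ?thesis
      using flow_left_inside[of u t] assms w_nonneg by (simp add: turn_def section_L_def)
  next
    case 2 then show ?thesis
      using PL_pos[of "u + w"] w_nonneg[unfolded w_def] by (simp add: turn_def section_L_def flow_left_end)
  next
    case 3 then show ?thesis
      using flow_right_inside[OF PL_pos, of "t - tL (u + w)" "u + w"] assms
      by (simp add: turn_def section_L_def turn_time_def)
  qed
qed

definition cross_time :: "real \<Rightarrow> nat \<Rightarrow> real" where
  "cross_time u n = (\<Sum>k<n. turn_time ((ret ^^ k) u))"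

lemma cross_time_0 [simp]: "cross_time u 0 = 0" by (simp add: cross_time_def)
lemma cross_time_Suc: "cross_time u (Suc n) = cross_time u n + turn_time ((ret ^^ n) u)"
  by (simp add: cross_time_def)

lemma cross_time_mono: "m \<le> n \<Longrightarrow> cross_time u m \<le> cross_time u n"
  unfolding cross_time_def by (intro sum_mono2) (auto simp: turn_time_pos less_imp_le)

text \<open>
  Each left excursion lasts longer than a half turn, so crossing times cannot accumulate.
\<close>

lemma cross_time_ge: "cross_time u n \<ge> real n * (pi / \<omega> L)"
proof (induction n)
  case (Suc n)
  then show ?case using turn_time_gt[of "(ret ^^ n) u"]
    by (simp only: cross_time_Suc of_nat_Suc distrib_right)
qed simp

lemma cross_time_cover:
  assumes "t \<ge> 0"
  obtains n where "cross_time u n \<le> t" "t < cross_time u (Suc n)"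
proof -
  have "pi / \<omega> L > 0" using omega_pos by simp
  then obtain N where N: "t < real N * (pi / \<omega> L)" using reals_Archimedean3 by blast
  then have ex: "t < cross_time u N" using cross_time_ge[of N u] by linarith
  define m where "m = (LEAST n. t < cross_time u n)"
  have m: "t < cross_time u m" unfolding m_def by (rule LeastI[of _ N]) (rule ex)
  have "m \<noteq> 0" using m assms by (intro notI) simp
  then obtain n where n: "m = Suc n" using not0_implies_Suc by blast
  have "\<not> t < cross_time u n" using not_less_Least[of n "\<lambda>n. t < cross_time u n"] n by (simp add: m_def)
  then show ?thesis using that[of n] m n by simp
qed

lemma ret_pow_pos: "u > 0 \<Longrightarrow> (ret ^^ n) u > 0"
  using ret_pos by (cases n) auto

lemma solution_turns:
  assumes sol: "filippov_solution V {0..} z" and z: "z 0 = down_pt u" and u: "u > 0"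
  shows "z (cross_time u n) = down_pt ((ret ^^ n) u)"
    and "t \<in> {0..turn_time ((ret ^^ n) u)} \<Longrightarrow> z (cross_time u n + t) = turn ((ret ^^ n) u) t"
proof -
  have sub: "{cross_time u n..cross_time u n + s} \<subseteq> {0..}" for n s
    using cross_time_mono[of 0 n u] by auto
  have *: "z (cross_time u n) = down_pt ((ret ^^ n) u)" for n
  proof (induction n)
    case (Suc n)
    show ?case
      using one_turn[OF sol sub Suc.IH ret_pow_pos[OF u], of "turn_time ((ret ^^ n) u)"]
        turn_time_pos[of "(ret ^^ n) u"] by (simp add: cross_time_Suc turn_end)
  qed (use z in simp)
  then show "z (cross_time u n) = down_pt ((ret ^^ n) u)" .
  show "t \<in> {0..turn_time ((ret ^^ n) u)} \<Longrightarrow> z (cross_time u n + t) = turn ((ret ^^ n) u) t"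
    using one_turn[OF sol sub * ret_pow_pos[OF u]] by blast
qed

lemma section_L_only_at_cross_times:
  assumes sol: "filippov_solution V {0..} z" and z: "z 0 = down_pt u" and u: "u > 0"
    and t: "t \<ge> 0" "z t \<in> section_L"
  shows "\<exists>n. t = cross_time u n"
proof -
  obtain n where n: "cross_time u n \<le> t" "t < cross_time u (Suc n)" using cross_time_cover[OF t(1)] .
  have "z t = turn ((ret ^^ n) u) (t - cross_time u n)"
    using solution_turns(2)[OF sol z u, of "t - cross_time u n" n] n by (simp add: cross_time_Suc)
  then have "turn ((ret ^^ n) u) (t - cross_time u n) \<in> section_L" using t(2) by simp
  then have "\<not> 0 < t - cross_time u n"
    using turn_inside[OF ret_pow_pos[OF u], of "t - cross_time u n" n] n(2) by (force simp: cross_time_Suc)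
  then show ?thesis using n(1) by (intro exI[of _ n]) linarith
qed

lemma periodic_return:
  assumes sol: "filippov_solution V UNIV z" and T: "T > 0" "\<And>t. z (t + T) = z t"
    and z: "z 0 = down_pt u" and u: "u > 0"
  shows "\<exists>n>0. (ret ^^ n) u = u \<and> T = cross_time u n"
proof -
  have sol': "filippov_solution V {0..} z" using solution_shift[OF sol, of "{0..}" 0] by simp
  have zT: "z T = down_pt u" using T(2)[of 0] z by simp
  then have "z T \<in> section_L" using u by (auto simp: section_L_iff)
  then obtain n where n: "T = cross_time u n"
    using section_L_only_at_cross_times[OF sol' z u, of T] T(1) by auto
  then have "n > 0" using T by (cases n) auto
  moreover have "down_pt ((ret ^^ n) u) = down_pt u"
    using solution_turns(1)[OF sol' z u, of n] n zT by simp
  then have "(ret ^^ n) u = u" by (simp add: down_pt_def real2_eq_iff)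
  ultimately show ?thesis using n by blast
qed

section \<open>Every periodic orbit crosses the switching line\<close>

text \<open>
  The right focus is virtual, so an orbit in \<open>x > 0\<close> reaches the line within a half turn. It arrives strictly
  below the tangency, since the orbits through points of the line at or above \<open>tang R\<close> come from \<open>x < 0\<close>.
\<close>

lemma lands_from_right:
  assumes sol: "filippov_solution V I z" and I: "{t0..} \<subseteq> I" and x: "z t0 $ 1 > 0"
  shows "\<exists>t\<ge>t0. z t \<in> section_L"
proof -
  define f where "f s = flow R s (z t0) $ 1" for s
  have w0: "pi / \<omega> R > 0" using omega_pos by simp
  have cont: "continuous_on S f" for S unfolding f_def by (intro continuous_intros flow_continuous)
  have "f (pi / \<omega> R) - focus R $ 1 = - exp (lam R * pi / \<omega> R) * (z t0 $ 1 - focus R $ 1)"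
    using flow_half_turn[of R 0 "z t0"] by (simp add: f_def real2_eq_iff)
  also have "\<dots> < 0" using x focus_neg[of R] by (simp add: mult_neg_pos)
  finally have "f (pi / \<omega> R) \<le> 0" using focus_neg[of R] by simp
  moreover have "f 0 > 0" using x by (simp add: f_def)
  ultimately obtain \<tau> where \<tau>: "0 < \<tau>" "\<tau> \<le> pi / \<omega> R" "f \<tau> = 0" "\<And>s. 0 \<le> s \<Longrightarrow> s < \<tau> \<Longrightarrow> f s > 0"
    using first_nonpos[OF cont _ w0] by blast
  have "z (t0 + \<tau>) = flow R \<tau> (z t0)"
  proof (rule solution_follows[OF sol, where J = R and \<psi> = "\<lambda>s. flow R s (z t0)" and \<tau> = \<tau>])
    show "{t0..t0 + \<tau>} \<subseteq> I" using I by auto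
  qed (use \<tau> x in \<open>auto intro!: flow_deriv simp: f_def\<close>)
  define y where "y = flow R \<tau> (z t0) $ 2"
  have zy: "flow R \<tau> (z t0) = vector [0, y]" using \<tau>(3) by (simp add: f_def y_def real2_eq_iff)
  have "y < tang R"
  proof (rule ccontr)
    assume "\<not> y < tang R"
    define u where "u = y - tang R"
    have u: "u \<ge> 0" "y = tang R + u" using \<open>\<not> y < tang R\<close> by (auto simp: u_def)
    define s where "s = \<tau> / 2"
    have s: "0 < s" "s < \<tau>" using \<tau> by (auto simp: s_def)
    then have "s < pi / \<omega> R" using \<tau>(2) by linarith
    then have ang: "0 < \<omega> R * s" "\<omega> R * s < pi" using s omega_pos[of R] by (auto simp: field_simps)
    have "flow R (\<tau> - s) (z t0) = flow R (- s) (vector [0, y])"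
      using flow_flow[of R "- s" \<tau> "z t0"] zy by simp
    moreover have "flow R (- s) (vector [0, y]) $ 1 < 0"
    proof -
      have "chi (\<nu> R) (- (\<omega> R * s)) = chi (- \<nu> R) (\<omega> R * s)" by (simp add: chi_def)
      then have "chi (\<nu> R) (\<omega> R * - s) > 0" using ang by (simp add: chi_pos_iff rho_pos)
      then have "u * sin (\<omega> R * - s) - \<xi> R * chi (\<nu> R) (\<omega> R * - s) < 0"
        using u ang sin_gt_zero[of "\<omega> R * s"] \<xi>_pos[of R]
        by (smt (verit) mult_nonneg_nonneg mult_pos_pos sin_minus mult_minus_right)
      then show ?thesis unfolding u(2) flow_x using a2_pos[of R] omega_pos[of R] by (intro mult_pos_neg) auto
    qed
    ultimately show False using \<tau>(4)[of "\<tau> - s"] s by (simp add: f_def)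
  qed
  then have "z (t0 + \<tau>) \<in> section_L"
    using \<open>z (t0 + \<tau>) = flow R \<tau> (z t0)\<close> zy by (simp add: section_L_def)
  then show ?thesis using \<tau>(1) by (intro exI[of _ "t0 + \<tau>"]) auto
qed

text \<open>
  After \<open>n\<close> half turns the horizontal deviation from the focus is multiplied by \<open>(- E) ^ n\<close> with \<open>E > 1\<close>; if
  it is bounded above along the orbit it has to vanish at all times.
\<close>

lemma focus_spirals_out:
  assumes "\<And>s. s \<ge> 0 \<Longrightarrow> flow L s p $ 1 < 0"
  shows "p = focus L"
proof -
  define E where "E = exp (lam L * pi / \<omega> L)"
  have E: "E > 1" using lam_L omega_pos[of L] by (simp add: E_def)
  define h where "h s = flow L s p $ 1 - focus L $ 1" for s
  have step: "h (s + pi / \<omega> L) = - E * h s" for s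
    using flow_half_turn[of L s p] by (simp add: h_def E_def real2_eq_iff)
  have turns: "h (s + real n * (pi / \<omega> L)) = (- E) ^ n * h s" for s n
  proof (induction n)
    case (Suc n)
    have "h (s + real (Suc n) * (pi / \<omega> L)) = h ((s + real n * (pi / \<omega> L)) + pi / \<omega> L)"
      by (simp only: of_nat_Suc distrib_right mult_1 add.commute add.left_commute)
    then show ?case using step Suc by simp
  qed simp
  have bound: "h s < - focus L $ 1" if "s \<ge> 0" for s using assms[OF that] by (simp add: h_def)
  have wp: "pi / \<omega> L > 0" using omega_pos by simp
  have zero: "h s = 0" if s: "s \<ge> 0" for s
  proof (rule ccontr)
    assume "h s \<noteq> 0"
    obtain n where n: "- focus L $ 1 / \<bar>h s\<bar> < E ^ n" using real_arch_pow[OF E] by blast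
    have big: "E ^ n \<le> E ^ m" if "m \<ge> n" for m using that E by (intro power_increasing) auto
    have "(- E) ^ m * h s < - focus L $ 1" for m
      using bound[of "s + real m * (pi / \<omega> L)", OF add_nonneg_nonneg[OF s mult_nonneg_nonneg]] turns[of s m] wp
      by (metis less_imp_le of_nat_0_le_iff)
    from this[of "2 * n"] this[of "Suc (2 * n)"]
    have "E ^ (2 * n) * h s < - focus L $ 1" "- (E ^ Suc (2 * n) * h s) < - focus L $ 1"
      by (simp_all add: power_minus_odd del: power_Suc)
    moreover have "- focus L $ 1 < E ^ n * \<bar>h s\<bar>" using n \<open>h s \<noteq> 0\<close> by (simp add: field_simps)
    moreover have "E ^ n * \<bar>h s\<bar> \<le> E ^ (2 * n) * \<bar>h s\<bar>" "E ^ n * \<bar>h s\<bar> \<le> E ^ Suc (2 * n) * \<bar>h s\<bar>"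
      using big[of "2 * n"] big[of "Suc (2 * n)"] by (auto intro: mult_right_mono simp del: power_Suc)
    ultimately show False
    proof (cases "h s > 0")
      case True
      then have "\<bar>h s\<bar> = h s" by simp
      then show False using \<open>E ^ (2 * n) * h s < - focus L $ 1\<close> \<open>- focus L $ 1 < E ^ n * \<bar>h s\<bar>\<close>
          \<open>E ^ n * \<bar>h s\<bar> \<le> E ^ (2 * n) * \<bar>h s\<bar>\<close> by linarith
    next
      case False
      then have "\<bar>h s\<bar> = - h s" by simp
      then show False using \<open>- (E ^ Suc (2 * n) * h s) < - focus L $ 1\<close> \<open>- focus L $ 1 < E ^ n * \<bar>h s\<bar>\<close>
          \<open>E ^ n * \<bar>h s\<bar> \<le> E ^ Suc (2 * n) * \<bar>h s\<bar>\<close> by (simp only: mult_minus_right)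
    qed
  qed
  have "h 0 = 0" "h (pi / (2 * \<omega> L)) = 0" using zero omega_pos[of L] by auto
  moreover have "\<omega> L * (pi / (2 * \<omega> L)) = pi / 2" using omega_pos[of L] by simp
  ultimately have "(p - focus L) $ 1 = 0" "dev L (p - focus L) $ 1 = 0"
    using omega_pos[of L] by (auto simp: h_def flow_def)
  then show ?thesis using a2_pos[of L] by (auto simp: dev_def real2_eq_iff)
qed

lemma lands_from_left:
  assumes sol: "filippov_solution V I z" and I: "{t0..} \<subseteq> I" and x: "z t0 $ 1 < 0"
    and ne: "z t0 \<noteq> focus L"
  shows "\<exists>\<tau>>0. \<exists>v\<ge>0. z (t0 + \<tau>) = up_pt v \<and> z (t0 + \<tau>) = flow L \<tau> (z t0)"
proof -
  define f where "f s = - flow L s (z t0) $ 1" for s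
  have cont: "continuous_on S f" for S unfolding f_def by (intro continuous_intros flow_continuous)
  have f0: "f 0 > 0" using x by (simp add: f_def)
  obtain b where b: "b \<ge> 0" "f b \<le> 0" using focus_spirals_out[of "z t0"] ne by (force simp: f_def not_less)
  then have "b > 0" using f0 by (cases "b = 0") auto
  then obtain \<tau> where \<tau>: "0 < \<tau>" "\<tau> \<le> b" "f \<tau> = 0" "\<And>s. 0 \<le> s \<Longrightarrow> s < \<tau> \<Longrightarrow> f s > 0"
    using first_nonpos[OF cont f0 _ b(2)] by blast
  have follow: "z (t0 + \<tau>) = flow L \<tau> (z t0)"
  proof (rule solution_follows[OF sol, where J = L and \<psi> = "\<lambda>s. flow L s (z t0)" and \<tau> = \<tau>])
    show "{t0..t0 + \<tau>} \<subseteq> I" using I by auto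
  qed (use \<tau> x in \<open>auto intro!: flow_deriv simp: f_def\<close>)
  define y where "y = flow L \<tau> (z t0) $ 2"
  have zy: "flow L \<tau> (z t0) = vector [0, y]" using \<tau>(3) by (simp add: f_def y_def real2_eq_iff)
  have "y \<ge> tang L"
  proof (rule ccontr)
    assume "\<not> y \<ge> tang L"
    define v where "v = tang L - y"
    have v: "v > 0" "y = tang L + - v" using \<open>\<not> y \<ge> tang L\<close> by (auto simp: v_def)
    have v\<xi>: "v / \<xi> L > 0" using v \<xi>_pos[of L] by simp
    define x where "x = short_time (- \<nu> L) (v / \<xi> L) / \<omega> L"
    define s where "s = min \<tau> x / 2"
    have "short_time (- \<nu> L) (v / \<xi> L) / \<omega> L > 0" using short_time(1)[OF v\<xi>] omega_pos[of L] by simp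
    then have s: "0 < s" "s < \<tau>" "s < short_time (- \<nu> L) (v / \<xi> L) / \<omega> L"
      using \<tau>(1) unfolding s_def x_def[symmetric] by auto
    then have ang: "0 < \<omega> L * s" "\<omega> L * s < short_time (- \<nu> L) (v / \<xi> L)"
      using omega_pos[of L] by (auto simp: field_simps)
    have "flow L (\<tau> - s) (z t0) = flow L (- s) (vector [0, y])"
      using flow_flow[of L "- s" \<tau> "z t0"] zy by simp
    moreover have "flow L (- s) (vector [0, y]) $ 1 > 0"
    proof -
      have "chi (\<nu> L) (- (\<omega> L * s)) = chi (- \<nu> L) (\<omega> L * s)" by (simp add: chi_def)
      then have "\<xi> L * chi (\<nu> L) (\<omega> L * - s) < v * sin (\<omega> L * s)"
        using short_time_before[OF v\<xi> ang] \<xi>_pos[of L] by (simp add: field_simps)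
      then show ?thesis unfolding v(2) flow_x using a2_pos[of L] omega_pos[of L] by (intro mult_pos_pos) auto
    qed
    ultimately show False using \<tau>(4)[of "\<tau> - s"] s by (simp add: f_def)
  qed
  then have "z (t0 + \<tau>) = up_pt (y - tang L)" "y - tang L \<ge> 0"
    using follow zy by (auto simp: up_pt_def)
  then show ?thesis using \<tau>(1) follow by blast
qed

end

lemma filippov_set_neg: "v \<in> filippov_set V p \<Longrightarrow> - v \<in> filippov_set (\<lambda>J p. - V J p) p"
  by (auto simp: filippov_set_def in_segment split: if_splits)

lemma periodic_nat_multiple:
  fixes z :: "real \<Rightarrow> 'a"
  assumes "\<And>t. z (t + T) = z t"
  shows "z (t + real n * T) = z t"
proof (induction n)
  case (Suc n)
  then show ?case using assms[of "t + real n * T"] by (simp add: algebra_simps)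
qed simp

context two_foci
begin

text \<open>
  Forward uniqueness for the field with reversed time: no sliding solution can have left the line and
  arrived at a point whose backward orbit stays in \<open>x < 0\<close>.
\<close>

lemma solution_past_left:
  assumes sol: "filippov_solution V UNIV z" and x: "z t $ 1 < 0" 
    and past: "\<And>r. r > 0 \<Longrightarrow> flow L (- r) (z t) $ 1 < 0" and s: "s \<le> t"
  shows "z s $ 1 < 0"
proof -
  interpret rev: lipschitz_pws "\<lambda>J p. - V J p" "SOME K. lipschitz_pws V K"
    by standard (intro lipschitz_on_minus lip)
  have revsol: "filippov_solution (\<lambda>J p. - V J p) UNIV (\<lambda>r. z (- r + t))"
    using solution_transform[OF sol, of "-1" "\<lambda>z. z" "\<lambda>J p. - V J p" UNIV t]
    by (simp add: filippov_set_neg bounded_linear_ident)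
  have "z s = flow L (- (t - s)) (z t)"
  proof -
    have "((\<lambda>r. flow L (- r) (z t)) has_vector_derivative - V L (flow L (- r) (z t))) (at r within S)" for r S
    proof -
      have "(uminus has_vector_derivative -1) (at r within S)"
        by (auto intro!: derivative_eq_intros)
      from vector_diff_chain_within[OF this flow_deriv] show ?thesis by (simp add: o_def)
    qed
    then show ?thesis
      using rev.solution_follows[OF revsol, of 0 "t - s" "\<lambda>r. flow L (- r) (z t)" L "t - s"]
        x past s by simp
  qed
  then show ?thesis using past[of "t - s"] x s by (cases "s = t") auto
qed

text \<open>
  On the repelling segment the velocity is the unique convex combination tangent to the line, which is a
  continuous function \<open>h\<close> of the height. The height then solves \<open>y' = h(y)\<close>. Along it the primitive \<open>H\<close> of
  \<open>h\<close> has derivative \<open>h(y)\<^sup>2 \<ge> 0\<close>, and periodicity forces \<open>h(y) = 0\<close>.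
\<close>

lemma periodic_on_line_const:
  assumes sol: "filippov_solution V UNIV z" and T: "T > 0" "\<And>t. z (t + T) = z t"
    and line: "\<And>t. z t $ 1 = 0" and between: "\<And>t. tang R \<le> z t $ 2 \<and> z t $ 2 \<le> tang L" and wpos: "w > 0"
  shows "z t $ 2 = z 0 $ 2"
proof -
  define y where "y s = z s $ 2" for s
  define fL fR gL gR where "fL q = V L (vector [0, q]) $ 1" and "fR q = V R (vector [0, q]) $ 1"
    and "gL q = V L (vector [0, q]) $ 2" and "gR q = V R (vector [0, q]) $ 2" for q
  define h where "h q = (fL q * gR q - fR q * gL q) / (fL q - fR q)" for q
  have zy: "z s = vector [0, y s]" for s using line by (simp add: y_def real2_eq_iff)
  have f: "fL q = a2 L * (q - tang L)" "fR q = a2 R * (q - tang R)" for q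
    by (simp_all add: fL_def fR_def V_on_line)
  have neg: "fL q - fR q < 0" if "tang R \<le> q" "q \<le> tang L" for q
  proof -
    have "fL q \<le> 0" "fR q \<ge> 0" using that a2_pos[of L] a2_pos[of R] by (auto simp: f mult_nonneg_nonpos)
    moreover have "fL q \<noteq> 0 \<or> fR q \<noteq> 0"
      using that wpos a2_pos[of L] a2_pos[of R] by (auto simp: f w_def)
    ultimately show ?thesis by linarith
  qed
  have conth: "continuous_on {tang R..tang L} h"
    unfolding h_def
    by (intro continuous_intros) (use neg in \<open>force simp: fL_def fR_def gL_def gR_def V_def intro!: continuous_intros\<close>)+
  have conty: "continuous_on {a..b} y" for a b
    unfolding y_def using solution_continuous[OF sol, of a b] by (intro continuous_intros) auto
  have "AE t in lebesgue. t \<in> {a..b} \<longrightarrow> (z has_vector_derivative vector [0, h (y t)]) (at t within {a..b})" for a b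
  proof -
    have "AE t in lebesgue. t \<in> UNIV \<longrightarrow> (\<exists>v\<in>filippov_set V (z t). (z has_vector_derivative v) (at t))"
      using sol unfolding filippov_solution_def by blast
    then show ?thesis
    proof eventually_elim
      case (elim t)
      then obtain v where v: "v \<in> filippov_set V (z t)" "(z has_vector_derivative v) (at t)" by auto
      have "((\<lambda>t. z t $ 1) has_vector_derivative v $ 1) (at t)"
        using bounded_linear.has_vector_derivative[OF bounded_linear_vec_nth[of 1] v(2)] by simp
      then have v1: "v $ 1 = 0"
        using line by (simp add: has_vector_derivative_const vector_derivative_unique_at[OF _ has_vector_derivative_const])
      obtain \<theta> where th: "v = (1 - \<theta>) *\<^sub>R V L (z t) + \<theta> *\<^sub>R V R (z t)"
        using v(1) line[of t] by (auto simp: filippov_set_def in_segment)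
      have 0: "(1 - \<theta>) * fL (y t) + \<theta> * fR (y t) = 0" using v1 th zy[of t] by (simp add: fL_def fR_def)
      have 2: "v $ 2 = (1 - \<theta>) * gL (y t) + \<theta> * gR (y t)" using th zy[of t] by (simp add: gL_def gR_def)
      have "(fL (y t) - fR (y t)) * v $ 2 = fL (y t) * gR (y t) - fR (y t) * gL (y t)
          + ((1 - \<theta>) * fL (y t) + \<theta> * fR (y t)) * (gL (y t) - gR (y t))"
        unfolding 2 by (simp add: algebra_simps)
      then have "(fL (y t) - fR (y t)) * v $ 2 = fL (y t) * gR (y t) - fR (y t) * gL (y t)"
        unfolding 0 by simp
      moreover have "fL (y t) - fR (y t) \<noteq> 0" using neg[of "y t"] between[of t] by (simp add: y_def)
      ultimately have "v $ 2 = h (y t)" unfolding h_def by (simp add: nonzero_eq_divide_eq mult.commute)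
      then have "v = vector [0, h (y t)]" using v1 by (simp add: real2_eq_iff)
      then show ?case using v(2) has_vector_derivative_at_within by blast
    qed
  qed
  moreover have "continuous_on {a..b} (\<lambda>t. vector [0, h (y t)] :: real^2)" for a b
  proof -
    have "continuous_on {a..b} (\<lambda>t. h (y t))"
      using between by (intro continuous_on_compose2[OF conth conty]) (auto simp: y_def)
    then have "continuous_on {a..b} (\<lambda>t. h (y t) *\<^sub>R axis 2 1 :: real^2)" by (intro continuous_intros)
    moreover have "(\<lambda>t. h (y t) *\<^sub>R axis 2 1 :: real^2) = (\<lambda>t. vector [0, h (y t)] :: real^2)"
      by (auto simp: real2_eq_iff axis_def fun_eq_iff)
    ultimately show ?thesis by (rule back_subst[of "continuous_on {a..b}"])
  qed
  ultimately have "(z has_vector_derivative vector [0, h (y t)]) (at t within {t - 1..t + 1})" for t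
    using sol by (intro absolutely_continuous_C1[of "t - 1" "t + 1" z]) (auto simp: filippov_solution_def)
  moreover have "at t within {t - 1..t + 1} = at t" for t :: real by (rule at_within_interior) auto
  ultimately have zd: "(z has_vector_derivative vector [0, h (y t)]) (at t)" for t by simp
  have y': "(y has_real_derivative h (y t)) (at t)" for t
    using bounded_linear.has_vector_derivative[OF bounded_linear_vec_nth[of 2] zd[of t]]
    by (simp add: y_def[abs_def] has_real_derivative_iff_has_vector_derivative)
  define H where "H q = integral {tang R..q} h" for q
  have H': "((\<lambda>t. H (y t)) has_real_derivative (h (y t))\<^sup>2) (at t)" for t
  proof -
    have "(H has_vector_derivative h (y t)) (at (y t) within {tang R..tang L})"
      unfolding H_def using integral_has_vector_derivative[OF conth] between[of t] by (simp add: y_def)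
    then have "(H has_vector_derivative h (y t)) (at (y t) within range y)"
      by (rule has_vector_derivative_within_subset) (use between in \<open>auto simp: y_def\<close>)
    moreover have "(y has_vector_derivative h (y t)) (at t within UNIV)"
      using y' by (simp add: has_real_derivative_iff_has_vector_derivative)
    ultimately show ?thesis
      using vector_diff_chain_within[of y "h (y t)" t UNIV H "h (y t)"]
      by (simp add: has_real_derivative_iff_has_vector_derivative o_def power2_eq_square)
  qed
  have mono: "H (y a) \<le> H (y b)" if "a \<le> b" for a b
    using that by (rule DERIV_nonneg_imp_nondecreasing) (use H' in force)
  have Hconst: "H (y s) = H (y t)" for s t
  proof -
    have le: "H (y s) \<le> H (y t)" for s t
    proof -
      obtain n where "(s - t) / T < real n" using reals_Archimedean2 by blast
      then have "s \<le> t + real n * T" using T(1) by (simp add: field_simps)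
      from mono[OF this] show ?thesis
        using periodic_nat_multiple[of z T t n] T(2) by (simp add: y_def)
    qed
    show ?thesis using le[of s t] le[of t s] by simp
  qed
  have "h (y t) = 0" for t
  proof -
    have "((\<lambda>t. H (y 0)) has_real_derivative 0) (at t)" by simp
    moreover have "(\<lambda>t. H (y 0)) = (\<lambda>t. H (y t))" by (rule ext) (rule Hconst)
    ultimately have "((\<lambda>t. H (y t)) has_real_derivative 0) (at t)"
      by (rule back_subst[of "\<lambda>f. (f has_real_derivative 0) (at t)"])
    from DERIV_unique[OF this H'[of t]] show ?thesis by simp
  qed
  then have "(y has_real_derivative 0) (at t)" for t using y'[of t] by simp
  then have "y t = y 0" using DERIV_isconst_all by blast
  then show ?thesis by (simp add: y_def)
qed

text \<open>
  A periodic solution that avoids the section never visits \<open>x > 0\<close>, because it would land on the section.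
  If it visits \<open>x < 0\<close>, it is not the focus, and it lands on the line: not above \<open>tang L\<close>, where it would
  cross to the right, and not at \<open>tang L\<close>, where its whole past would lie in \<open>x < 0\<close>. So it stays on
  the line between the tangencies, and there it is constant.
\<close>

lemma periodic_solution_crosses:
  assumes sol: "filippov_solution V UNIV z" and T: "T > 0" "\<And>t. z (t + T) = z t"
    and nonconst: "z t' \<noteq> z 0"
  shows "\<exists>t. z t \<in> section_L"
proof (rule ccontr)
  assume no: "\<not> (\<exists>t. z t \<in> section_L)"
  have right: "z t $ 1 \<le> 0" for t
    using lands_from_right[OF sol, of t] no by (force simp: not_less)
  have not_top: "z t \<noteq> up_pt v" if "v > 0" for t v
  proof
    assume z: "z t = up_pt v"
    have pos: "tR (w + v) > 0" using that w_nonneg by (intro tR_pos) auto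
    have "z (t + tR (w + v) / 2) $ 1 > 0"
      using right_leg[OF sol _ z that, of "tR (w + v) / 2"] flow_right_inside[OF that, of "tR (w + v) / 2"] pos by simp
    then show False using right[of "t + tR (w + v) / 2"] by simp
  qed
  have per: "z (t + real n * T) = z t" for t n by (rule periodic_nat_multiple) (rule T(2))
  have left: "z t $ 1 = 0" for t
  proof (rule ccontr)
    assume "z t $ 1 \<noteq> 0"
    then have neg: "z t $ 1 < 0" using right[of t] by simp
    show False
    proof (cases "z t = focus L")
      case True
      have fix_focus: "flow L s (focus L) = focus L" for s
        by (simp add: flow_def dev_def real2_eq_iff)
      have stay: "z (t + s) = focus L" if "s \<ge> 0" for s
        using solution_follows[OF sol, of t s "\<lambda>s. flow L s (z t)" L s] neg that True focus_neg[of L]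
        by (auto simp: fix_focus intro!: flow_deriv[of L "focus L", unfolded fix_focus])
      have "z r = focus L" for r
      proof -
        obtain n where "(t - r) / T < real n" using reals_Archimedean2 by blast
        then have "r + real n * T - t \<ge> 0" using T(1) by (simp add: field_simps)
        from stay[OF this] show ?thesis using per[of r n] by simp
      qed
      then show False using nonconst by simp
    next
      case False
      obtain \<tau> v where \<tau>: "\<tau> > 0" "v \<ge> 0" "z (t + \<tau>) = up_pt v" "z (t + \<tau>) = flow L \<tau> (z t)"
        using lands_from_left[OF sol _ neg False] by auto
      have "v = 0" using not_top[of v] \<tau> by force
      then have graze: "flow L \<tau> (z t) = vector [0, tang L]" using \<tau> by (simp add: up_pt_def)
      have past: "flow L (- r) (z t) $ 1 < 0" if "r > 0" for r
      proof -
        have "flow L (- r) (z t) = flow L (- r - \<tau>) (flow L \<tau> (z t))" by (simp add: flow_flow)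
        then show ?thesis using graze grazing_past[of "- r - \<tau>"] that \<tau>(1) by simp
      qed
      obtain n where "\<tau> / T < real n" using reals_Archimedean2 by blast
      then have "t + \<tau> - real n * T \<le> t" using T(1) by (simp add: field_simps)
      then have "z (t + \<tau> - real n * T) $ 1 < 0" using solution_past_left[OF sol neg past] by blast
      then show False using per[of "t + \<tau> - real n * T" n] \<tau>(3) by (metis diff_add_cancel less_irrefl up_pt_nth(1))
    qed
  qed
  have between: "tang R \<le> z t $ 2 \<and> z t $ 2 \<le> tang L" for t
  proof
    show "tang R \<le> z t $ 2" using no left[of t] by (force simp: section_L_def)
    show "z t $ 2 \<le> tang L"
      using not_top[of "z t $ 2 - tang L" t] left[of t] by (force simp: real2_eq_iff)
  qed
  have "z t' $ 2 = z 0 $ 2"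
  proof (cases "w > 0")
    case True
    then show ?thesis by (rule periodic_on_line_const[OF sol T left between])
  next
    case False
    then have "tang L = tang R" using w_nonneg by (simp add: w_def)
    then show ?thesis using between[of t'] between[of 0] by simp
  qed
  then show False using nonconst left by (simp add: real2_eq_iff)
qed

end

section \<open>The limit cycle\<close>


definition periodic_ext :: "real \<Rightarrow> (real \<Rightarrow> 'a) \<Rightarrow> real \<Rightarrow> 'a" where
  "periodic_ext T f t = f (t - T * of_int \<lfloor>t / T\<rfloor>)"

lemma periodic_ext_periodic: "T > 0 \<Longrightarrow> periodic_ext T f (t + T) = periodic_ext T f t"
  by (simp add: periodic_ext_def add_divide_distrib algebra_simps)

lemma periodic_ext_eq:
  assumes T: "T > 0" and f: "f 0 = f T" and t: "of_int n * T \<le> t" "t \<le> (of_int n + 1) * T"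
  shows "periodic_ext T f t = f (t - of_int n * T)"
proof (cases "t = (of_int n + 1) * T")
  case True
  then have "t / T = of_int (n + 1)" using T by simp
  then have fl: "\<lfloor>t / T\<rfloor> = n + 1" by (simp only: floor_of_int)
  show ?thesis unfolding periodic_ext_def fl using True f by (simp add: algebra_simps)
next
  case False
  then have "of_int n \<le> t / T" "t / T < of_int n + 1" using t T by (auto simp: field_simps)
  then have "\<lfloor>t / T\<rfloor> = n" by (simp add: floor_eq_iff)
  then show ?thesis by (simp add: periodic_ext_def mult.commute)
qed

lemma periodic_ext_range:
  assumes T: "T > 0" and f: "f 0 = f T"
  shows "range (periodic_ext T f) = f ` {0..T}"
proof
  show "range (periodic_ext T f) \<subseteq> f ` {0..T}"
  proof clarify
    fix t
    define n where "n = \<lfloor>t / T\<rfloor>"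
    have "of_int n \<le> t / T" "t / T < of_int n + 1" unfolding n_def by linarith+
    then have "t - T * of_int n \<in> {0..T}" using T by (auto simp: field_simps)
    then have "t - T * of_int \<lfloor>t / T\<rfloor> \<in> {0..T}" by (simp only: n_def)
    then show "periodic_ext T f t \<in> f ` {0..T}" by (simp add: periodic_ext_def)
  qed
  show "f ` {0..T} \<subseteq> range (periodic_ext T f)"
  proof clarify
    fix t assume "t \<in> {0..T}"
    then show "f t \<in> range (periodic_ext T f)"
      using periodic_ext_eq[OF T, of f 0 t] f by (metis UNIV_I atLeastAtMost_iff diff_zero image_eqI mult_1 add_0 mult_zero_left of_int_0)
  qed
qed

lemma isCont_periodic_ext:
  fixes f :: "real \<Rightarrow> 'a::topological_space"
  assumes T: "T > 0" and f: "f 0 = f T" and cont: "continuous_on {0..T} f"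
  shows "isCont (periodic_ext T f) t"
proof -
  define n where "n = \<lfloor>t / T\<rfloor>"
  have piece: "continuous_on {of_int m * T..(of_int m + 1) * T} (periodic_ext T f)" for m
  proof -
    have "continuous_on {of_int m * T..(of_int m + 1) * T} (\<lambda>t. f (t - of_int m * T))"
      by (rule continuous_on_compose2[OF cont]) (auto intro!: continuous_intros simp: algebra_simps)
    then show ?thesis
      by (rule continuous_on_cong[THEN iffD1, OF refl, rotated]) (simp add: periodic_ext_eq[of T f m, OF T f])
  qed
  have "continuous_on ({of_int (n - 1) * T..(of_int (n - 1) + 1) * T} \<union> {of_int n * T..(of_int n + 1) * T}) (periodic_ext T f)"
    by (intro continuous_on_closed_Un piece) auto
  then have c: "continuous_on {of_int (n - 1) * T<..<(of_int n + 1) * T} (periodic_ext T f)"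
    by (rule continuous_on_subset) (auto simp: algebra_simps)
  have "of_int n \<le> t / T" "t / T < of_int n + 1" unfolding n_def by linarith+
  then have "of_int n * T \<le> t" "t < (of_int n + 1) * T" using T by (auto simp: field_simps)
  then have "t \<in> {of_int (n - 1) * T<..<(of_int n + 1) * T}" using T by (auto simp: algebra_simps)
  with c show ?thesis by (meson continuous_on_eq_continuous_at open_greaterThanLessThan)
qed

lemma range_shift: "range (\<lambda>s::real. z (s + t)) = range z"
proof -
  have "z s \<in> range (\<lambda>s. z (s + t))" for s by (rule image_eqI[of _ _ "s - t"]) auto
  then show ?thesis by auto
qed

lemma finite_int_translates:
  fixes T c a b :: real
  assumes "T > 0"
  shows "finite (range (\<lambda>n::int. of_int n * T + c) \<inter> {a..b})"
proof (rule finite_subset)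
  show "range (\<lambda>n::int. of_int n * T + c) \<inter> {a..b} \<subseteq> (\<lambda>n::int. of_int n * T + c) ` {\<lfloor>(a - c) / T\<rfloor>..\<lceil>(b - c) / T\<rceil>}"
  proof clarify
    fix n :: int assume "of_int n * T + c \<in> {a..b}"
    then have "(a - c) / T \<le> of_int n" "of_int n \<le> (b - c) / T" using assms by (auto simp: field_simps)
    then have "n \<in> {\<lfloor>(a - c) / T\<rfloor>..\<lceil>(b - c) / T\<rceil>}" by (simp add: floor_le_iff le_ceiling_iff)
    then show "of_int n * T + c \<in> (\<lambda>n::int. of_int n * T + c) ` {\<lfloor>(a - c) / T\<rfloor>..\<lceil>(b - c) / T\<rceil>}" by blast
  qed
qed simp

context two_foci
begin

lemma turn_continuous: "continuous_on S (turn u)"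
proof -
  have "continuous_on UNIV (turn u)"
    unfolding turn_def[abs_def]
  proof (rule continuous_on_cases_le)
    show "continuous_on {t \<in> UNIV. tL (u + w) \<le> t} (\<lambda>t. flow R (t - tL (u + w)) (up_pt (PL (u + w))))"
      by (rule continuous_on_compose2[OF flow_continuous[of UNIV]]) (auto intro!: continuous_intros)
  qed (auto intro!: continuous_intros flow_continuous simp: flow_left_end)
  then show ?thesis by (rule continuous_on_subset) simp
qed

text \<open>
  The case \<open>t < 0\<close> is that of the orbit that touches the line at \<open>tang L\<close>.
\<close>

lemma turn_deriv:
  assumes u: "u \<ge> - w" and t: "t < turn_time u" "t \<noteq> tL (u + w)" and pos: "0 < t \<or> t < 0 \<and> u = - w"
  shows "\<exists>v\<in>filippov_set V (turn u t). (turn u has_vector_derivative v) (at t within S)"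
proof (cases "t < tL (u + w)")
  case True
  have ev: "\<forall>\<^sub>F s in nhds t. turn u s = flow L s (down_pt u)"
    using eventually_nhds_in_open[of "{..<tL (u + w)}" t] True
    by (auto simp: turn_def elim: eventually_mono)
  have tt: "turn u t = flow L t (down_pt u)" using True by (simp add: turn_def)
  have "flow L t (down_pt u) $ 1 < 0"
  proof (cases "t > 0")
    case False
    then have "t < 0" "down_pt u = vector [0, tang L]" using pos by (auto simp: down_pt_def w_def)
    then show ?thesis using grazing_past by simp
  qed (use u True flow_left_inside in auto)
  then have "filippov_set V (turn u t) = {V L (turn u t)}"
    using filippov_set_side[of L "turn u t" V] tt by simp
  moreover have "(turn u has_vector_derivative V L (turn u t)) (at t)"
    using has_vector_derivative_cong_ev[where f = "turn u" and g = "\<lambda>s. flow L s (down_pt u)" and x = t and S = UNIV]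
      ev flow_deriv[of L "down_pt u" t UNIV] tt by simp
  ultimately show ?thesis by (auto intro: has_vector_derivative_at_within)
next
  case False
  then have gt: "t > tL (u + w)" using t by simp
  let ?g = "\<lambda>s. flow R (s - tL (u + w)) (up_pt (PL (u + w)))"
  have ev: "\<forall>\<^sub>F s in nhds t. turn u s = ?g s"
    using eventually_nhds_in_open[of "{tL (u + w)<..}" t] gt
    by (auto simp: turn_def elim: eventually_mono)
  have tt: "turn u t = ?g t" using gt by (simp add: turn_def)
  have "turn u t $ 1 > 0" unfolding tt
    using gt t by (intro flow_right_inside PL_pos) (auto simp: turn_time_def)
  then have "filippov_set V (turn u t) = {V R (turn u t)}"
    using filippov_set_side[of R "turn u t" V] by simp
  moreover have "((\<lambda>s. s - tL (u + w)) has_vector_derivative 1) (at t within UNIV)"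
    by (auto intro!: derivative_eq_intros)
  from vector_diff_chain_within[OF this flow_deriv]
  have "(?g has_vector_derivative V R (?g t)) (at t)" by (simp add: o_def)
  then have "(turn u has_vector_derivative V R (turn u t)) (at t)"
    using has_vector_derivative_cong_ev[where f = "turn u" and g = ?g and x = t and S = UNIV] ev tt by simp
  ultimately show ?thesis by (auto intro: has_vector_derivative_at_within)
qed

definition cycle_sol :: "real \<Rightarrow> real \<Rightarrow> real^2" where
  "cycle_sol x = periodic_ext (turn_time x) (turn x)"

definition cycle :: "real \<Rightarrow> (real^2) set" where
  "cycle x = turn x ` {0..turn_time x}"

context
  fixes x assumes x: "x > 0" "ret x = x"
begin

lemma turn_closed: "turn x 0 = turn x (turn_time x)"
  using x by (simp add: turn_end)

lemma cycle_sol_range: "range (cycle_sol x) = cycle x"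
  unfolding cycle_sol_def cycle_def by (rule periodic_ext_range[OF turn_time_pos turn_closed])

lemma cycle_sol_periodic: "cycle_sol x (t + turn_time x) = cycle_sol x t"
  unfolding cycle_sol_def by (rule periodic_ext_periodic[OF turn_time_pos])

lemma cycle_sol_eq: "0 \<le> t \<Longrightarrow> t \<le> turn_time x \<Longrightarrow> cycle_sol x t = turn x t"
  unfolding cycle_sol_def using periodic_ext_eq[OF turn_time_pos turn_closed, of 0 t] by simp

lemma cycle_sol_solution: "filippov_solution V UNIV (cycle_sol x)"
proof (rule filippov_solutionI)
  let ?T = "turn_time x"
  define S where "S = range (\<lambda>n::int. of_int n * ?T + 0) \<union> range (\<lambda>n::int. of_int n * ?T + tL (x + w))"
  show "continuous_on {a..b} (cycle_sol x)" for a b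
    unfolding cycle_sol_def using isCont_periodic_ext[OF turn_time_pos turn_closed turn_continuous]
    by (simp add: continuous_at_imp_continuous_on)
  show "finite (S \<inter> {a..b})" for a b
    unfolding S_def Int_Un_distrib2 using finite_int_translates[OF turn_time_pos] by blast
  show "countable S" unfolding S_def by simp
  fix t assume t: "t \<in> UNIV - S"
  define n where "n = \<lfloor>t / ?T\<rfloor>"
  have "of_int n \<le> t / ?T" "t / ?T < of_int n + 1" unfolding n_def by linarith+
  then have n: "of_int n * ?T \<le> t" "t < (of_int n + 1) * ?T" using turn_time_pos[of x] by (auto simp: field_simps)
  have "t \<noteq> of_int n * ?T + 0" "t \<noteq> of_int n * ?T + tL (x + w)" using t unfolding S_def by blast+
  then have s: "0 < t - of_int n * ?T" "t - of_int n * ?T < ?T" "t - of_int n * ?T \<noteq> tL (x + w)"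
    using n by (auto simp: algebra_simps)
  have eq: "cycle_sol x r = turn x (r - of_int n * ?T)" if "r \<in> {of_int n * ?T<..<(of_int n + 1) * ?T}" for r
    unfolding cycle_sol_def using that by (intro periodic_ext_eq[OF turn_time_pos turn_closed]) auto
  have tin: "t \<in> {of_int n * ?T<..<(of_int n + 1) * ?T}" using s by (auto simp: algebra_simps)
  have ev: "\<forall>\<^sub>F r in nhds t. cycle_sol x r = turn x (r - of_int n * ?T)"
    by (rule eventually_mono[OF eventually_nhds_in_open[OF open_greaterThanLessThan tin] eq])
  obtain v where v: "v \<in> filippov_set V (turn x (t - of_int n * ?T))"
      "(turn x has_vector_derivative v) (at (t - of_int n * ?T) within UNIV)"
    using turn_deriv[of x "t - of_int n * ?T" UNIV] s x w_nonneg by auto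
  have "((\<lambda>r. r - of_int n * ?T) has_vector_derivative 1) (at t within UNIV)"
    by (auto intro!: derivative_eq_intros)
  from vector_diff_chain_within[OF this has_vector_derivative_at_within[OF v(2)]]
  have "((\<lambda>r. turn x (r - of_int n * ?T)) has_vector_derivative v) (at t)" by (simp add: o_def)
  then have "(cycle_sol x has_vector_derivative v) (at t)"
    using has_vector_derivative_cong_ev[where f = "cycle_sol x" and g = "\<lambda>r. turn x (r - of_int n * ?T)" and x = t and S = UNIV]
      ev eq[OF tin] by simp
  then show "\<exists>v\<in>filippov_set V (cycle_sol x t). (cycle_sol x has_vector_derivative v) (at t within UNIV)"
    using v(1) eq[OF tin] by auto
qed

lemma cycle_periodic_orbit: "periodic_orbit V (cycle x)"
proof -
  have "tL (x + w) < turn_time x"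
    using tR_pos[of "w + PL (x + w)"] PL_pos[of "x + w"] w_nonneg by (simp add: turn_time_def)
  then have "cycle_sol x (tL (x + w)) = up_pt (PL (x + w))" "cycle_sol x 0 = down_pt x"
    using tL_pos[of "x + w"] turn_time_pos[of x] by (auto simp: cycle_sol_eq turn_def flow_left_end)
  moreover have "up_pt (PL (x + w)) $ 2 > down_pt x $ 2"
    using PL_pos[of "x + w"] x w_nonneg[unfolded w_def] by simp
  ultimately have "cycle_sol x 0 $ 2 < cycle_sol x (tL (x + w)) $ 2" by (simp only:)
  then have "cycle_sol x (tL (x + w)) \<noteq> cycle_sol x 0" by (metis less_irrefl)
  then show ?thesis
    unfolding periodic_orbit_def
    using turn_time_pos[of x] cycle_sol_solution cycle_sol_periodic cycle_sol_range by blast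
qed

text \<open>
  The solution is periodic, so its range is covered by times \<open>t \<ge> 0\<close>, where it consists of copies of the
  same turn.
\<close>

lemma periodic_through_fixed_point:
  assumes sol: "filippov_solution V UNIV z" and T: "T > 0" "\<And>t. z (t + T) = z t" and z: "z 0 = down_pt x"
  shows "range z = cycle x"
proof
  have sol': "filippov_solution V {0..} z" using solution_shift[OF sol, of "{0..}" 0] by simp
  have pow: "(ret ^^ n) x = x" for n by (induction n) (use x in auto)
  show "range z \<subseteq> cycle x"
  proof clarify
    fix t
    obtain n where "- t / T < real n" using reals_Archimedean2 by blast
    then have "t + real n * T \<ge> 0" using T(1) by (simp add: field_simps)
    then obtain k where k: "cross_time x k \<le> t + real n * T" "t + real n * T < cross_time x (Suc k)"
      using cross_time_cover by blast
    have "z (t + real n * T) = turn x (t + real n * T - cross_time x k)"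
      using solution_turns(2)[OF sol' z x(1), of "t + real n * T - cross_time x k" k] k
      by (simp add: cross_time_Suc pow)
    moreover have "z (t + real n * T) = z t" by (rule periodic_nat_multiple) (rule T(2))
    ultimately show "z t \<in> cycle x" using k by (auto simp: cycle_def cross_time_Suc pow)
  qed
  show "cycle x \<subseteq> range z"
  proof (clarsimp simp: cycle_def)
    fix t assume "0 \<le> t" "t \<le> turn_time x"
    then have "turn x t = z t" using solution_turns(2)[OF sol' z x(1), of t 0] by simp
    then show "turn x t \<in> range z" by simp
  qed
qed

end

lemma ret_no_cycle_expanding:
  assumes "\<nu> L + \<nu> R \<ge> 0" "u > 0" "n > 0"
  shows "(ret ^^ n) u > u"
  using assms(3)
proof (induction n)
  case (Suc n)
  have "(ret ^^ n) u \<ge> u" using Suc by (cases "n = 0") auto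
  then show ?case using ret_gt_expanding[OF assms(1) ret_pow_pos[OF assms(2)], of n] by simp
qed simp

lemma no_periodic_orbit_expanding:
  assumes "\<nu> L + \<nu> R \<ge> 0"
  shows "\<not> periodic_orbit V \<Gamma>"
proof
  assume "periodic_orbit V \<Gamma>"
  then obtain z T t' where z: "0 < T" "filippov_solution V UNIV z" "\<And>t. z (t + T) = z t" "z t' \<noteq> z 0"
    unfolding periodic_orbit_def by blast
  obtain t where "z t \<in> section_L" using periodic_solution_crosses[OF z(2,1,3,4)] by blast
  then obtain u where u: "u > 0" "z (0 + t) = down_pt u" by (auto simp: section_L_iff)
  have sh: "filippov_solution V UNIV (\<lambda>s. z (s + t))" by (rule solution_shift[OF z(2)]) simp
  have per: "z (s + T + t) = z (s + t)" for s using z(3)[of "s + t"] by (simp add: algebra_simps)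
  from periodic_return[OF sh z(1) per u(2,1)] obtain n where "n > 0" "(ret ^^ n) u = u" by blast
  then show False using ret_no_cycle_expanding[OF assms u(1), of n] by simp
qed

end

locale contracting_foci = two_foci +
  assumes contracting: "\<nu> L + \<nu> R < 0"
begin

text \<open>
  The fixed point of \<open>ret\<close>, characterised together with the position of the graph relative to the diagonal.
\<close>

definition u_fix :: real where
  "u_fix = (SOME x. x > 0 \<and> ret x = x \<and> (\<forall>u>0. (u < x \<longrightarrow> ret u > u) \<and> (u > x \<longrightarrow> ret u < u)))"

lemma u_fix: "u_fix > 0" "ret u_fix = u_fix" "0 < u \<Longrightarrow> u < u_fix \<Longrightarrow> ret u > u" "u_fix < u \<Longrightarrow> ret u < u"
proof -
  have *: "u_fix > 0 \<and> ret u_fix = u_fix \<and> (\<forall>u>0. (u < u_fix \<longrightarrow> ret u > u) \<and> (u > u_fix \<longrightarrow> ret u < u))"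
    unfolding u_fix_def by (rule someI_ex) (use ret_fixed_point[OF contracting] in blast)
  then show "u_fix > 0" "ret u_fix = u_fix" "0 < u \<Longrightarrow> u < u_fix \<Longrightarrow> ret u > u" by auto
  show "u_fix < u \<Longrightarrow> ret u < u" using * by force
qed

lemma ret_iterates:
  assumes "u > 0"
  shows "(\<lambda>n. (ret ^^ n) u) \<longlonglongrightarrow> u_fix" "\<bar>(ret ^^ n) u - u_fix\<bar> \<le> \<bar>u - u_fix\<bar>"
  using u_fix assms by (auto intro!: ret_iterates_converge)

text \<open>
  The iterates along multiples of the period are constant, while all iterates converge to \<open>u_fix\<close>.
\<close>

lemma ret_periodic_point:
  assumes "u > 0" "n > 0" "(ret ^^ n) u = u"
  shows "u = u_fix"
proof -
  have "(ret ^^ (k * n)) u = u" for k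
    by (induction k) (use assms(3) in \<open>auto simp: funpow_add\<close>)
  moreover have "strict_mono (\<lambda>k. k * n)" using assms(2) by (auto simp: strict_mono_def)
  then have "(\<lambda>k. (ret ^^ (k * n)) u) \<longlonglongrightarrow> u_fix"
    using LIMSEQ_subseq_LIMSEQ[OF ret_iterates(1)[OF assms(1)]] by (simp add: o_def)
  ultimately show ?thesis by (simp add: LIMSEQ_const_iff)
qed

lemma periodic_orbit_unique:
  assumes "periodic_orbit V \<Gamma>"
  shows "\<Gamma> = cycle u_fix"
proof -
  obtain z T t' where z: "0 < T" "filippov_solution V UNIV z" "\<And>t. z (t + T) = z t" "z t' \<noteq> z 0"
    and G: "\<Gamma> = range z"
    using assms unfolding periodic_orbit_def by blast
  obtain t where "z t \<in> section_L" using periodic_solution_crosses[OF z(2,1,3,4)] by blast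
  then obtain u where u: "u > 0" "z (0 + t) = down_pt u" by (auto simp: section_L_iff)
  have sh: "filippov_solution V UNIV (\<lambda>s. z (s + t))" by (rule solution_shift[OF z(2)]) simp
  have per: "z (s + T + t) = z (s + t)" for s using z(3)[of "s + t"] by (simp add: algebra_simps)
  from periodic_return[OF sh z(1) per u(2,1)] obtain n where "n > 0" "(ret ^^ n) u = u" by blast
  then have "u = u_fix" using ret_periodic_point u(1) by blast
  then have "range (\<lambda>s. z (s + t)) = cycle u_fix"
    using periodic_through_fixed_point[OF u_fix(1,2) sh z(1) per] u(2) by simp
  then show ?thesis using G range_shift[of z t] by simp
qed

definition cycle_yL :: real where "cycle_yL = tang R - u_fix"
definition cycle_yR :: real where "cycle_yR = tang L + PL (u_fix + w)"
definition cycle_tL :: real where "cycle_tL = tL (u_fix + w)"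
definition cycle_tR :: real where "cycle_tR = tR (w + PL (u_fix + w))"

lemma cycle_tL_pos: "cycle_tL > 0" and cycle_tR_pos: "cycle_tR > 0"
  using tL_pos[of "u_fix + w"] PL_pos[of "u_fix + w"] w_nonneg
  by (auto simp: cycle_tL_def cycle_tR_def intro!: tR_pos)

lemma turn_time_fix: "turn_time u_fix = cycle_tL + cycle_tR"
  by (simp add: turn_time_def cycle_tL_def cycle_tR_def)

lemma turn_fix_left: "0 < t \<Longrightarrow> t < cycle_tL \<Longrightarrow> turn u_fix t $ 1 < 0"
  using flow_left_inside[of u_fix t] u_fix(1) w_nonneg by (simp add: turn_def cycle_tL_def)

lemma turn_fix_right: "cycle_tL < t \<Longrightarrow> t < cycle_tL + cycle_tR \<Longrightarrow> turn u_fix t $ 1 > 0"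
  using flow_right_inside[OF PL_pos, of "t - tL (u_fix + w)" "u_fix + w"] by (simp add: turn_def cycle_tL_def cycle_tR_def)

lemma turn_fix_top: "turn u_fix cycle_tL = vector [0, cycle_yR]"
  by (simp add: turn_def cycle_tL_def flow_left_end cycle_yR_def up_pt_def)

lemma cycle_two_zone: "two_zone_cycle V (cycle u_fix) cycle_yL cycle_yR cycle_tL cycle_tR"
  unfolding two_zone_cycle_def
proof (intro conjI exI[of _ "\<lambda>t. cycle_sol u_fix (t + cycle_tL)"] allI impI cycle_tL_pos cycle_tR_pos)
  let ?z = "\<lambda>t. cycle_sol u_fix (t + cycle_tL)"
  note uf12 = u_fix(1,2)
  show "filippov_solution V UNIV ?z"
    by (rule solution_shift[OF cycle_sol_solution[OF uf12]]) simp
  show "range ?z = cycle u_fix"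
    using cycle_sol_range[OF uf12] range_shift[of "cycle_sol u_fix" cycle_tL] by simp
  show "?z (t + (cycle_tR + cycle_tL)) = ?z t" for t
    using cycle_sol_periodic[OF uf12, of "t + cycle_tL"] by (simp add: turn_time_fix algebra_simps)
  show z0: "?z 0 = vector [0, cycle_yR]"
    using cycle_tL_pos cycle_tR_pos by (simp add: cycle_sol_eq[OF uf12] turn_time_fix turn_fix_top)
  have top: "vector [0, cycle_yR] = up_pt (PL (u_fix + w))" by (simp add: up_pt_def cycle_yR_def)
  show "V J (?z 0) $ 1 > 0" for J unfolding z0 top by (rule V_up_pt[OF PL_pos])
  show "?z t $ 1 > 0" if "0 < t \<and> t < cycle_tR" for t
    using that cycle_tL_pos by (simp add: cycle_sol_eq[OF uf12] turn_time_fix turn_fix_right)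
  have z1: "?z cycle_tR = down_pt u_fix"
    using cycle_tL_pos cycle_tR_pos turn_end[of u_fix]
    by (simp add: cycle_sol_eq[OF uf12] turn_time_fix u_fix(2) add.commute)
  then show "?z cycle_tR = vector [0, cycle_yL]" by (simp add: down_pt_def cycle_yL_def)
  show "V J (?z cycle_tR) $ 1 < 0" for J unfolding z1 by (rule V_down_pt[OF u_fix(1)])
  show "?z t $ 1 < 0" if t: "cycle_tR < t \<and> t < cycle_tR + cycle_tL" for t
  proof -
    have "?z t = cycle_sol u_fix ((t - cycle_tR) + turn_time u_fix)" by (simp add: turn_time_fix algebra_simps)
    also have "\<dots> = cycle_sol u_fix (t - cycle_tR)" by (rule cycle_sol_periodic[OF uf12])
    also have "\<dots> = turn u_fix (t - cycle_tR)"
      using t cycle_tR_pos cycle_tL_pos by (intro cycle_sol_eq[OF uf12]) (auto simp: turn_time_fix)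
    finally show ?thesis using t turn_fix_left[of "t - cycle_tR"] by simp
  qed
qed

text \<open>
  The arrival point of the right excursion lies in the section and is periodic under \<open>ret\<close>, which fixes it.
  The two durations are then the times at which the turn of \<open>u_fix\<close> meets the line.
\<close>

lemma two_zone_unique:
  assumes "two_zone_cycle V \<Gamma> yL yR sL sR"
  shows "yL = cycle_yL \<and> yR = cycle_yR \<and> sL = cycle_tL \<and> sR = cycle_tR"
proof -
  obtain z where s: "0 < sL" "0 < sR" and sol: "filippov_solution V UNIV z"
    and per: "\<And>t. z (t + (sR + sL)) = z t" and z0: "z 0 = vector [0, yR]"
    and right: "\<And>t. 0 < t \<Longrightarrow> t < sR \<Longrightarrow> z t $ 1 > 0"
    and zR: "z sR = vector [0, yL]" "\<And>J. V J (z sR) $ 1 < 0"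
    and left: "\<And>t. sR < t \<Longrightarrow> t < sR + sL \<Longrightarrow> z t $ 1 < 0"
    using assms unfolding two_zone_cycle_def by blast
  define y where "y t = z (t + sR)" for t
  have soly: "filippov_solution V UNIV y" unfolding y_def by (rule solution_shift[OF sol]) simp
  have pery: "y (t + (sR + sL)) = y t" for t
    using per[of "t + sR"] by (simp add: y_def algebra_simps)
  define u where "u = tang R - yL"
  have "a2 R * (yL - tang R) < 0" using zR(2)[of R] unfolding zR(1) V_on_line .
  then have u: "u > 0" using a2_pos[of R] by (simp add: u_def mult_less_0_iff)
  have y0: "y 0 = down_pt u" using zR(1) by (simp add: y_def down_pt_def u_def)
  obtain n where "n > 0" "(ret ^^ n) u = u" using periodic_return[OF soly _ pery y0 u] s by auto
  then have uf: "u = u_fix" using ret_periodic_point u by blast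
  have y: "y t = turn u_fix t" if "0 \<le> t" "t \<le> cycle_tL + cycle_tR" for t
    using one_turn[OF soly _ y0 u, of t] that by (simp add: uf turn_time_fix)
  have ysL: "y sL = vector [0, yR]" using per[of 0] z0 by (simp add: y_def add.commute)
  have sL: "sL = cycle_tL"
  proof (cases sL cycle_tL rule: linorder_cases)
    case less
    then have "y sL $ 1 < 0" using turn_fix_left[of sL] y[of sL] s cycle_tR_pos by simp
    then show ?thesis using ysL by simp
  next
    case greater
    then have "y cycle_tL $ 1 < 0" using left[of "cycle_tL + sR"] cycle_tL_pos by (simp add: y_def)
    then show ?thesis using y[of cycle_tL] turn_fix_top cycle_tL_pos cycle_tR_pos by simp
  qed
  have "vector [0, yR] = (vector [0, cycle_yR] :: real^2)"
    using ysL y[of cycle_tL] turn_fix_top cycle_tL_pos cycle_tR_pos sL by simp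
  then have yR: "yR = cycle_yR" by (simp add: real2_eq_iff)
  have ys: "y (t + sL) = z t" for t using per[of t] by (simp add: y_def algebra_simps)
  have sR: "sR = cycle_tR"
  proof (cases sR cycle_tR rule: linorder_cases)
    case less
    then have "y (sR + sL) $ 1 > 0" using turn_fix_right[of "sR + sL"] y[of "sR + sL"] s sL by simp
    then show ?thesis using ys[of sR] zR(1) by simp
  next
    case greater
    then have "y (cycle_tR + sL) $ 1 > 0" using right[of cycle_tR] ys[of cycle_tR] cycle_tR_pos by simp
    moreover have "y (cycle_tR + sL) = down_pt u_fix"
      using y[of "cycle_tR + sL"] cycle_tL_pos cycle_tR_pos sL turn_end[of u_fix] by (simp add: turn_time_fix u_fix(2) add.commute)
    ultimately show ?thesis by simp
  qed
  show ?thesis using sL sR yR uf by (simp add: cycle_yL_def u_def)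
qed

lemma cycle_equations:
  "cycle_yR - tang R = \<xi> R * exp (- lam R * cycle_tR) * \<rho> (\<omega> R * cycle_tR) (lam R / \<omega> R) / sin (\<omega> R * cycle_tR)"
  "cycle_yL - tang R = - \<xi> R * exp (lam R * cycle_tR) * \<rho> (\<omega> R * cycle_tR) (- (lam R / \<omega> R)) / sin (\<omega> R * cycle_tR)"
  "cycle_yL - tang L = \<xi> L * exp (- lam L * cycle_tL) * \<rho> (\<omega> L * cycle_tL) (lam L / \<omega> L) / sin (\<omega> L * cycle_tL)"
  "cycle_yR - tang L = - \<xi> L * exp (lam L * cycle_tL) * \<rho> (\<omega> L * cycle_tL) (- (lam L / \<omega> L)) / sin (\<omega> L * cycle_tL)"
proof -
  define u where "u = w + PL (u_fix + w)"
  have u: "u / \<xi> R > 0" using PL_pos[of "u_fix + w"] w_nonneg \<xi>_pos[of R] by (simp add: u_def)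
  note st = short_time[OF u, of "\<nu> R"]
  have aR: "short_time (\<nu> R) (u / \<xi> R) = \<omega> R * cycle_tR" by (simp add: cycle_tR_def u_def tR_angle)
  have aL: "long_time (\<nu> L) ((u_fix + w) / \<xi> L) = \<omega> L * cycle_tL" by (simp add: cycle_tL_def tL_angle)
  note lt = long_time[OF \<nu>_L, of "(u_fix + w) / \<xi> L"]
  have sR: "sin (\<omega> R * cycle_tR) > 0" using st by (simp add: aR[symmetric] sin_gt_zero)
  have sL: "sin (\<omega> L * cycle_tL) < 0" using lt by (simp add: aL[symmetric] sin_neg)
  have e: "exp (\<nu> J * (\<omega> J * t)) = exp (lam J * t)" "exp (- (\<nu> J * (\<omega> J * t))) = exp (- (lam J * t))" for J t
    using omega_pos[of J] by (simp_all add: \<nu>_def)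
  have "u = \<xi> R * chi (\<nu> R) (\<omega> R * cycle_tR) / sin (\<omega> R * cycle_tR)"
    using st(3) sR \<xi>_pos[of R] by (simp add: aR field_simps)
  then show "cycle_yR - tang R = \<xi> R * exp (- lam R * cycle_tR) * \<rho> (\<omega> R * cycle_tR) (lam R / \<omega> R) / sin (\<omega> R * cycle_tR)"
    by (simp add: chi_rho e u_def w_def cycle_yR_def \<nu>_def[symmetric])
  have "u_fix = PR u" using u_fix(2) by (simp add: ret_def u_def)
  then have "u_fix = \<xi> R * (chi (- \<nu> R) (\<omega> R * cycle_tR) / sin (\<omega> R * cycle_tR))"
    by (simp add: PR_def short_map_def aR)
  then show "cycle_yL - tang R = - \<xi> R * exp (lam R * cycle_tR) * \<rho> (\<omega> R * cycle_tR) (- (lam R / \<omega> R)) / sin (\<omega> R * cycle_tR)"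
    by (simp add: chi_rho e cycle_yL_def \<nu>_def[symmetric])
  have "chi (\<nu> L) (\<omega> L * cycle_tL) = - ((u_fix + w) / \<xi> L) * sin (\<omega> L * cycle_tL)"
    using lt(3) unfolding aL .
  then have "- (u_fix + w) = \<xi> L * chi (\<nu> L) (\<omega> L * cycle_tL) / sin (\<omega> L * cycle_tL)"
    using sL \<xi>_pos[of L] by (simp add: field_simps)
  then show "cycle_yL - tang L = \<xi> L * exp (- lam L * cycle_tL) * \<rho> (\<omega> L * cycle_tL) (lam L / \<omega> L) / sin (\<omega> L * cycle_tL)"
    by (simp add: chi_rho e cycle_yL_def w_def \<nu>_def[symmetric])
  have "PL (u_fix + w) = \<xi> L * (- chi (- \<nu> L) (\<omega> L * cycle_tL) / sin (\<omega> L * cycle_tL))"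
    by (simp add: PL_def long_map_def aL)
  then show "cycle_yR - tang L = - \<xi> L * exp (lam L * cycle_tL) * \<rho> (\<omega> L * cycle_tL) (- (lam L / \<omega> L)) / sin (\<omega> L * cycle_tL)"
    by (simp add: chi_rho e cycle_yR_def \<nu>_def[symmetric])
qed

end

section \<open>Stability of the limit cycle\<close>

text \<open>
  The set where \<open>P\<close> holds locally is an open neighbourhood of \<open>S\<close>, at positive distance from its
  complement.
\<close>

lemma compact_uniform_neighbourhood:
  fixes S :: "'a::heine_borel set"
  assumes S: "compact S" "S \<noteq> {}" and P: "\<And>p. p \<in> S \<Longrightarrow> \<forall>\<^sub>F q in nhds p. P q"
  shows "\<exists>\<delta>>0. \<forall>q. infdist q S < \<delta> \<longrightarrow> P q"
proof -
  define U where "U = interior {q. P q}"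
  have "S \<subseteq> U"
  proof
    fix p assume "p \<in> S"
    then obtain T where "open T" "p \<in> T" "\<forall>q\<in>T. P q" using P unfolding eventually_nhds by blast
    then show "p \<in> U" unfolding U_def by (intro interiorI[of T]) auto
  qed
  then have disj: "S \<inter> - U = {}" by blast
  have cl: "closed (- U)" unfolding U_def by (intro closed_Compl open_interior)
  obtain d where d: "d > 0" "\<forall>x\<in>S. \<forall>y\<in>- U. d \<le> dist x y"
    using separate_compact_closed[OF S(1) cl disj] by (elim exE conjE)
  have "P q" if qd: "infdist q S < d" for q
  proof -
    obtain x where "x \<in> S" "dist q x < d"
      using qd infdist_attains_inf[OF compact_imp_closed[OF S(1)] S(2), of q] by metis
    then have "q \<in> U" using d(2) by (force simp: dist_commute)
    then show ?thesis using interior_subset by (auto simp: U_def)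
  qed
  then show ?thesis using d(1) by blast
qed

context two_foci
begin

text \<open>
  An orbit arc of one field that starts and ends transversally on the line and lies on its own side in
  between; the limit cycle consists of two such arcs.
\<close>

definition side_piece :: "side \<Rightarrow> real^2 \<Rightarrow> real \<Rightarrow> bool" where
  "side_piece J p0 r \<longleftrightarrow> 0 < r \<and>
     p0 $ 1 = 0 \<and> (\<forall>K. side_sgn J * V K p0 $ 1 > 0) \<and>
     (\<forall>t. 0 < t \<and> t < r \<longrightarrow> side_sgn J * flow J t p0 $ 1 > 0) \<and>
     flow J r p0 $ 1 = 0 \<and> (\<forall>K. side_sgn J * V K (flow J r p0) $ 1 < 0)"

text \<open>
  The solution stays near the arc until it meets the switching line near the end of the arc.
\<close>

definition tracks :: "side \<Rightarrow> real^2 \<Rightarrow> real \<Rightarrow> real \<Rightarrow> real^2 \<Rightarrow> bool" where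
  "tracks J p0 r \<epsilon> q \<longleftrightarrow> (\<forall>z. filippov_solution V {0..} z \<and> z 0 = q \<longrightarrow>
     (\<exists>\<tau>\<ge>0. z \<tau> $ 1 = 0 \<and> dist (z \<tau>) (flow J r p0) < \<epsilon> \<and>
        (\<forall>t\<in>{0..\<tau>}. infdist (z t) ((\<lambda>t. flow J t p0) ` {0..r}) < \<epsilon>)))"

lemma side_flow_deriv:
  "((\<lambda>t. side_sgn J * flow J t q $ 1) has_real_derivative side_sgn J * V J (flow J t q) $ 1) (at t)"
proof -
  have "((\<lambda>t. flow J t q $ 1) has_real_derivative V J (flow J t q) $ 1) (at t)"
    using bounded_linear.has_vector_derivative[OF bounded_linear_vec_nth[of 1] flow_deriv[of J q t UNIV]]
    by (simp add: has_real_derivative_iff_has_vector_derivative)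
  then show ?thesis by (rule DERIV_cmult)
qed

lemma side_flow_cont: "continuous_on S (\<lambda>t. side_sgn J * flow J t q $ 1)"
  by (intro continuous_intros flow_continuous)

lemma piece_exit:
  assumes piece: "side_piece J p0 r" and \<epsilon>: "\<epsilon> > 0" and b: "b > 0"
  obtains h where "0 < h" "h < b" "side_sgn J * flow J (r + h) p0 $ 1 < 0"
    "\<And>t. r - h \<le> t \<Longrightarrow> t \<le> r + h \<Longrightarrow> dist (flow J t p0) (flow J r p0) < \<epsilon>"
proof -
  let ?f = "\<lambda>t. side_sgn J * flow J t p0 $ 1"
  have f: "?f r = 0" "side_sgn J * V J (flow J r p0) $ 1 < 0" using piece by (auto simp: side_piece_def)
  obtain d1 where d1: "d1 > 0" "\<And>h. 0 < h \<Longrightarrow> h < d1 \<Longrightarrow> ?f (r + h) < 0"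
    using DERIV_neg_dec_right[OF side_flow_deriv f(2)] f(1) by auto
  have "isCont (\<lambda>t. flow J t p0) r"
    using flow_continuous[of UNIV J p0] by (simp add: continuous_on_eq_continuous_at)
  then obtain d2 where d2: "d2 > 0" "\<And>t. \<bar>t - r\<bar> < d2 \<Longrightarrow> dist (flow J t p0) (flow J r p0) < \<epsilon>"
    using \<epsilon> unfolding continuous_at_eps_delta dist_real_def by blast
  define h where "h = min (min d1 d2) b / 2"
  have h: "0 < h" "h < d1" "h < d2" "h < b" using d1(1) d2(1) b by (auto simp: h_def)
  show ?thesis
    by (rule that[of h]) (use h d1 d2 in \<open>auto simp: abs_less_iff\<close>)
qed

text \<open>
  Just after its end the arc, continued by the flow, is on the other side of the line, and between the times
  \<open>s + h1\<close> and \<open>r - h\<close> it keeps a positive distance from the line. Nearby orbits inherit both properties, so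
  they first meet the line within time \<open>h\<close> of the end. The parameter \<open>h1\<close> covers the start, where the arc is
  arbitrarily close to the line.
\<close>

lemma tracks_from_inside:
  assumes piece: "side_piece J p0 r" and \<epsilon>: "\<epsilon> > 0" and s: "0 \<le> s" "0 \<le> h1" "0 < s + h1" "s + h1 < r"
    and enter: "\<forall>\<^sub>F q in nhds (flow J s p0). side_sgn J * q $ 1 \<ge> 0 \<longrightarrow>
      (side_sgn J * q $ 1 > 0 \<or> q $ 1 = 0 \<and> (\<forall>K. side_sgn J * V K q $ 1 > 0)) \<and>
      (\<forall>t. 0 < t \<and> t \<le> h1 \<longrightarrow> side_sgn J * flow J t q $ 1 > 0)"
  shows "\<forall>\<^sub>F q in nhds (flow J s p0). side_sgn J * q $ 1 \<ge> 0 \<longrightarrow> tracks J p0 r \<epsilon> q"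
proof -
  let ?\<sigma> = "side_sgn J" and ?p = "flow J s p0"
  let ?W = "(\<lambda>t. flow J t p0) ` {0..r}"
  obtain h where h: "0 < h" "h < r - (s + h1)" "?\<sigma> * flow J (r + h) p0 $ 1 < 0"
    and near: "\<And>t. r - h \<le> t \<Longrightarrow> t \<le> r + h \<Longrightarrow> dist (flow J t p0) (flow J r p0) < \<epsilon> / 2"
    using piece_exit[OF piece, of "\<epsilon> / 2" "r - (s + h1)"] \<epsilon> s by auto
  obtain t0 where t0: "t0 \<in> {s + h1..r - h}" "\<And>t. t \<in> {s + h1..r - h} \<Longrightarrow> ?\<sigma> * flow J t0 p0 $ 1 \<le> ?\<sigma> * flow J t p0 $ 1"
    using continuous_attains_inf[OF compact_Icc _ side_flow_cont, of "s + h1" "r - h" J p0] h by auto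
  define m where "m = ?\<sigma> * flow J t0 p0 $ 1"
  have m: "m > 0" using piece t0(1) s h(1) unfolding m_def side_piece_def by auto
  obtain C where C: "C > 0" "\<And>t p q. t \<in> {0..r + h - s} \<Longrightarrow> norm (flow J t q - flow J t p) \<le> C * norm (q - p)"
    using flow_lipschitz[where T = "r + h - s" and J = J] by blast
  define \<eta> where "\<eta> = min (min m (\<epsilon> / 2)) (- (?\<sigma> * flow J (r + h) p0 $ 1))"
  have \<eta>: "\<eta> > 0" using m \<epsilon> h(3) by (simp add: \<eta>_def)
  have "\<forall>\<^sub>F q in nhds ?p. dist q ?p < \<eta> / C"
    using \<eta> C(1) by (auto simp: eventually_nhds_metric intro!: exI[of _ "\<eta> / C"])
  with enter show ?thesis
  proof eventually_elim
    case (elim q)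
    have close: "norm (flow J t q - flow J (s + t) p0) < \<eta>" if "t \<in> {0..r + h - s}" for t
    proof -
      have "norm (flow J t q - flow J t ?p) \<le> C * norm (q - ?p)" by (rule C(2)[OF that])
      also have "\<dots> < \<eta>" using elim(2) C(1) by (simp add: dist_norm field_simps)
      finally show ?thesis by (simp add: flow_flow add.commute)
    qed
    let ?f = "\<lambda>t. ?\<sigma> * flow J t q $ 1"
    have closef: "\<bar>?f t - ?\<sigma> * flow J (s + t) p0 $ 1\<bar> < \<eta>" if "t \<in> {0..r + h - s}" for t
    proof -
      have "\<bar>?f t - ?\<sigma> * flow J (s + t) p0 $ 1\<bar> = \<bar>(flow J t q - flow J (s + t) p0) $ 1\<bar>"
        using side_sgn_cases[of J] by auto
      also have "\<dots> \<le> norm (flow J t q - flow J (s + t) p0)" by (rule component_le_norm_cart)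
      finally show ?thesis using close[OF that] by simp
    qed
    show ?case unfolding tracks_def
    proof (intro impI allI)
      assume q: "?\<sigma> * q $ 1 \<ge> 0"
      fix z assume z: "filippov_solution V {0..} z \<and> z 0 = q"
      have start: "?\<sigma> * q $ 1 > 0 \<or> q $ 1 = 0 \<and> (\<forall>K. ?\<sigma> * V K q $ 1 > 0)"
        and ent: "\<And>t. 0 < t \<Longrightarrow> t \<le> h1 \<Longrightarrow> ?f t > 0" using elim(1) q by auto
      have mid: "?f t > 0" if "h1 \<le> t" "t \<le> r - h - s" for t
        using closef[of t] t0(2)[of "s + t"] that h s by (auto simp: \<eta>_def m_def)
      define b where "b = r + h - s - h1"
      have b: "b > 0" "?f (h1 + b) < 0"
        using closef[of "r + h - s"] h s by (auto simp: b_def \<eta>_def)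
      have "continuous_on {0..b} (\<lambda>t. ?f (h1 + t))"
        by (rule continuous_on_compose2[OF side_flow_cont[of UNIV]]) (auto intro!: continuous_intros)
      then obtain t1 where t1: "0 < t1" "t1 \<le> b" "?f (h1 + t1) = 0" "\<And>t. 0 \<le> t \<Longrightarrow> t < t1 \<Longrightarrow> ?f (h1 + t) > 0"
        using first_nonpos[of b "\<lambda>t. ?f (h1 + t)"] mid[of h1] h b by auto
      define \<tau> where "\<tau> = h1 + t1"
      have f\<tau>: "?f \<tau> = 0" using t1 by (simp add: \<tau>_def)
      have pos: "?f t > 0" if "0 < t" "t < \<tau>" for t
        using ent[of t] t1(4)[of "t - h1"] that by (cases "t \<le> h1") (auto simp: \<tau>_def)
      have \<tau>: "\<tau> > 0" "\<tau> \<le> r + h - s" using t1 s by (auto simp: \<tau>_def b_def)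
      have late: "\<tau> \<ge> r - h - s" using mid[of \<tau>] f\<tau> t1 by (force simp: \<tau>_def)
      have follow: "z t = flow J t q" if "t \<in> {0..\<tau>}" for t
      proof -
        have "z (0 + t) = flow J t q"
          by (rule solution_follows[of "{0..}" z 0 \<tau> "\<lambda>t. flow J t q" J])
            (use z start pos that in \<open>auto intro!: flow_deriv\<close>)
        then show ?thesis by simp
      qed
      have dW: "infdist (flow J (s + t) p0) ?W < \<epsilon> / 2" if "t \<in> {0..\<tau>}" for t
      proof (cases "s + t \<le> r")
        case True
        then have "flow J (s + t) p0 \<in> ?W" using that s by auto
        then show ?thesis using \<epsilon> by simp
      next
        case False
        have "flow J r p0 \<in> ?W" using piece by (auto simp: side_piece_def)
        then have "infdist (flow J (s + t) p0) ?W \<le> dist (flow J (s + t) p0) (flow J r p0)" by (rule infdist_le)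
        also have "\<dots> < \<epsilon> / 2" using False that \<tau> h(1) by (intro near) auto
        finally show ?thesis .
      qed
      show "\<exists>\<tau>\<ge>0. z \<tau> $ 1 = 0 \<and> dist (z \<tau>) (flow J r p0) < \<epsilon> \<and> (\<forall>t\<in>{0..\<tau>}. infdist (z t) ?W < \<epsilon>)"
      proof (intro exI[of _ \<tau>] conjI ballI)
        show "z \<tau> $ 1 = 0" using follow[of \<tau>] \<tau> f\<tau> side_sgn_cases[of J] by auto
        have "dist (flow J \<tau> q) (flow J (s + \<tau>) p0) < \<epsilon> / 2"
          using close[of \<tau>] \<tau> by (simp add: dist_norm \<eta>_def)
        moreover have "dist (flow J (s + \<tau>) p0) (flow J r p0) < \<epsilon> / 2" using late \<tau> by (intro near) auto
        ultimately show "dist (z \<tau>) (flow J r p0) < \<epsilon>"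
          using follow[of \<tau>] \<tau> dist_triangle[of "flow J \<tau> q" "flow J r p0" "flow J (s + \<tau>) p0"] by simp
        fix t assume t: "t \<in> {0..\<tau>}"
        have "infdist (z t) ?W \<le> infdist (flow J (s + t) p0) ?W + dist (z t) (flow J (s + t) p0)"
          by (rule infdist_triangle)
        also have "dist (z t) (flow J (s + t) p0) < \<epsilon> / 2"
          using close[of t] follow[OF t] t \<tau> by (simp add: dist_norm \<eta>_def)
        finally show "infdist (z t) ?W < \<epsilon>" using dW[OF t] by linarith
      qed (use \<tau> in auto)
    qed
  qed
qed

text \<open>
  Near the start the horizontal speed is bounded away from 0, so orbits starting on the line or on the
  correct side move away from it during a short initial time.
\<close>

lemma tracks_from_start:
  assumes piece: "side_piece J p0 r" and \<epsilon>: "\<epsilon> > 0"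
  shows "\<forall>\<^sub>F q in nhds p0. side_sgn J * q $ 1 \<ge> 0 \<longrightarrow> tracks J p0 r \<epsilon> q"
proof -
  let ?\<sigma> = "side_sgn J"
  define e where "e = ?\<sigma> *\<^sub>R (axis 1 1 :: real^2)"
  have e: "e \<bullet> v = ?\<sigma> * v $ 1" for v by (simp add: e_def inner_axis')
  have "e \<bullet> V K p0 > 0" for K using piece by (simp add: e side_piece_def)
  then have "\<forall>\<^sub>F q in nhds p0. \<forall>K. ?\<sigma> * V K q $ 1 > 0"
    using field_near[of 0 e L p0] field_near[of 0 e R p0] unfolding forall_side e by (simp add: eventually_conj)
  then obtain d where d: "d > 0" "\<And>q K. dist q p0 < d \<Longrightarrow> ?\<sigma> * V K q $ 1 > 0"
    by (auto simp: eventually_nhds_metric)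
  have r: "r > 0" using piece by (simp add: side_piece_def)
  have "isCont (\<lambda>t. flow J t p0) 0"
    using flow_continuous[of UNIV J p0] by (simp add: continuous_on_eq_continuous_at)
  then obtain d2 where d2: "d2 > 0" "\<And>t. \<bar>t\<bar> < d2 \<Longrightarrow> dist (flow J t p0) p0 < d / 2"
    using half_gt_zero[OF d(1)] unfolding continuous_at_eps_delta dist_real_def by fastforce
  define h1 where "h1 = min d2 r / 2"
  have h1: "0 < h1" "h1 < d2" "h1 < r" using d2(1) r by (auto simp: h1_def)
  obtain C where C: "C > 0" "\<And>t p q. t \<in> {0..h1} \<Longrightarrow> norm (flow J t q - flow J t p) \<le> C * norm (q - p)"
    using flow_lipschitz[where T = h1 and J = J] by blast
  have "\<forall>\<^sub>F q in nhds p0. dist q p0 < min d (d / 2 / C)"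
    using d(1) C(1) by (auto simp: eventually_nhds_metric intro!: exI[of _ "min d (d / 2 / C)"])
  then have "\<forall>\<^sub>F q in nhds p0. ?\<sigma> * q $ 1 \<ge> 0 \<longrightarrow>
      (?\<sigma> * q $ 1 > 0 \<or> q $ 1 = 0 \<and> (\<forall>K. ?\<sigma> * V K q $ 1 > 0)) \<and>
      (\<forall>t. 0 < t \<and> t \<le> h1 \<longrightarrow> ?\<sigma> * flow J t q $ 1 > 0)"
  proof (rule eventually_mono)
    fix q assume q: "dist q p0 < min d (d / 2 / C)"
    have inball: "dist (flow J t q) p0 < d" if "t \<in> {0..h1}" for t
    proof -
      have "dist (flow J t q) (flow J t p0) \<le> C * dist q p0" using C(2)[OF that] by (simp add: dist_norm)
      also have "\<dots> < d / 2" using q C(1) by (simp add: field_simps)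
      finally show ?thesis using d2(2)[of t] that h1 dist_triangle[of "flow J t q" p0 "flow J t p0"] by auto
    qed
    show "?\<sigma> * q $ 1 \<ge> 0 \<longrightarrow> (?\<sigma> * q $ 1 > 0 \<or> q $ 1 = 0 \<and> (\<forall>K. ?\<sigma> * V K q $ 1 > 0)) \<and>
      (\<forall>t. 0 < t \<and> t \<le> h1 \<longrightarrow> ?\<sigma> * flow J t q $ 1 > 0)"
    proof (intro impI conjI allI)
      assume q0: "?\<sigma> * q $ 1 \<ge> 0"
      show "?\<sigma> * q $ 1 > 0 \<or> q $ 1 = 0 \<and> (\<forall>K. ?\<sigma> * V K q $ 1 > 0)"
        using q0 d(2)[of q] q side_sgn_cases[of J] by auto
      fix t assume t: "0 < t \<and> t \<le> h1"
      have "?\<sigma> * flow J 0 q $ 1 < ?\<sigma> * flow J t q $ 1"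
      proof (rule DERIV_pos_imp_increasing[of 0 t "\<lambda>t. ?\<sigma> * flow J t q $ 1"])
        fix x assume "0 \<le> x" "x \<le> t"
        then show "\<exists>y. ((\<lambda>t. ?\<sigma> * flow J t q $ 1) has_real_derivative y) (at x) \<and> 0 < y"
          using t by (intro pos_derivI[OF side_flow_deriv] d(2) inball) auto
      qed (use t in auto)
      then show "?\<sigma> * flow J t q $ 1 > 0" using q0 by simp
    qed
  qed
  then show ?thesis
    using tracks_from_inside[OF piece \<epsilon>, of 0 h1] h1 by simp
qed

text \<open>
  Either the solution is on the line already, or it meets the line within the short time that the continued
  arc needs to be on the other side.
\<close>

lemma tracks_from_end:
  assumes piece: "side_piece J p0 r" and \<epsilon>: "\<epsilon> > 0"
  shows "\<forall>\<^sub>F q in nhds (flow J r p0). side_sgn J * q $ 1 \<ge> 0 \<longrightarrow> tracks J p0 r \<epsilon> q"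
proof -
  let ?\<sigma> = "side_sgn J" and ?p = "flow J r p0"
  let ?W = "(\<lambda>t. flow J t p0) ` {0..r}"
  have r: "r > 0" and pW: "?p \<in> ?W" using piece by (auto simp: side_piece_def)
  obtain h where h: "0 < h" "?\<sigma> * flow J (r + h) p0 $ 1 < 0"
    and near: "\<And>t. r - h \<le> t \<Longrightarrow> t \<le> r + h \<Longrightarrow> dist (flow J t p0) (flow J r p0) < \<epsilon> / 2"
    by (rule piece_exit[OF piece half_gt_zero[OF \<epsilon>] zero_less_one]) blast
  obtain C where C: "C > 0" "\<And>t p q. t \<in> {0..h} \<Longrightarrow> norm (flow J t q - flow J t p) \<le> C * norm (q - p)"
    using flow_lipschitz[where T = h and J = J] by blast
  define \<eta> where "\<eta> = min (\<epsilon> / 2) (- (?\<sigma> * flow J (r + h) p0 $ 1))"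
  have \<eta>: "\<eta> > 0" using \<epsilon> h(2) by (simp add: \<eta>_def)
  have "\<forall>\<^sub>F q in nhds ?p. dist q ?p < min \<epsilon> (\<eta> / C)"
    using \<eta> C(1) \<epsilon> by (auto simp: eventually_nhds_metric intro!: exI[of _ "min \<epsilon> (\<eta> / C)"])
  then show ?thesis
  proof (rule eventually_mono)
    fix q assume q: "dist q ?p < min \<epsilon> (\<eta> / C)"
    have close: "norm (flow J t q - flow J (r + t) p0) < \<eta>" if "t \<in> {0..h}" for t
    proof -
      have "norm (flow J t q - flow J t ?p) \<le> C * norm (q - ?p)" by (rule C(2)[OF that])
      also have "\<dots> < \<eta>" using q C(1) by (simp add: dist_norm field_simps)
      finally show ?thesis by (simp add: flow_flow add.commute)
    qed
    let ?f = "\<lambda>t. ?\<sigma> * flow J t q $ 1"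
    show "?\<sigma> * q $ 1 \<ge> 0 \<longrightarrow> tracks J p0 r \<epsilon> q"
      unfolding tracks_def
    proof (intro impI allI)
      assume q0: "?\<sigma> * q $ 1 \<ge> 0"
      fix z assume z: "filippov_solution V {0..} z \<and> z 0 = q"
      show "\<exists>\<tau>\<ge>0. z \<tau> $ 1 = 0 \<and> dist (z \<tau>) ?p < \<epsilon> \<and> (\<forall>t\<in>{0..\<tau>}. infdist (z t) ?W < \<epsilon>)"
      proof (cases "q $ 1 = 0")
        case True
        have "infdist q ?W \<le> dist q ?p" using pW by (rule infdist_le)
        then show ?thesis using True z q by (intro exI[of _ 0]) auto
      next
        case False
        then have f0: "?f 0 > 0" using q0 side_sgn_cases[of J] by (auto simp: less_le)
        have "?f h - ?\<sigma> * flow J (r + h) p0 $ 1 \<le> \<bar>(flow J h q - flow J (r + h) p0) $ 1\<bar>"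
          using side_sgn_cases[of J] by auto
        also have "\<dots> \<le> norm (flow J h q - flow J (r + h) p0)" by (rule component_le_norm_cart)
        also have "\<dots> < \<eta>" using close[of h] h by simp
        finally have "?f h \<le> 0" by (simp add: \<eta>_def)
        then obtain \<tau> where \<tau>: "0 < \<tau>" "\<tau> \<le> h" "?f \<tau> = 0" "\<And>t. 0 \<le> t \<Longrightarrow> t < \<tau> \<Longrightarrow> ?f t > 0"
          using first_nonpos[OF side_flow_cont f0 h(1)] by blast
        have follow: "z t = flow J t q" if "t \<in> {0..\<tau>}" for t
        proof -
          have "z (0 + t) = flow J t q"
            by (rule solution_follows[of "{0..}" z 0 \<tau> "\<lambda>t. flow J t q" J])
              (use z f0 \<tau> that in \<open>auto intro!: flow_deriv\<close>)
          then show ?thesis by simp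
        qed
        have d: "dist (z t) ?p < \<epsilon>" if "t \<in> {0..\<tau>}" for t
        proof -
          have "dist (z t) (flow J (r + t) p0) < \<epsilon> / 2"
            using close[of t] follow[OF that] that \<tau>(2) by (simp add: dist_norm \<eta>_def)
          moreover have "dist (flow J (r + t) p0) ?p < \<epsilon> / 2" using that \<tau>(2) h by (intro near) auto
          ultimately show ?thesis using dist_triangle[of "z t" ?p "flow J (r + t) p0"] by linarith
        qed
        have "infdist (z t) ?W < \<epsilon>" if "t \<in> {0..\<tau>}" for t
          using infdist_le[OF pW, of "z t"] d[OF that] by linarith
        moreover have "z \<tau> $ 1 = 0" using follow[of \<tau>] \<tau> side_sgn_cases[of J] by auto
        ultimately show ?thesis using \<tau>(1) d[of \<tau>] by (intro exI[of _ \<tau>]) auto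
      qed
    qed
  qed
qed

lemma tracks_near_piece:
  assumes piece: "side_piece J p0 r" and \<epsilon>: "\<epsilon> > 0" and p: "p \<in> (\<lambda>t. flow J t p0) ` {0..r}"
  shows "\<forall>\<^sub>F q in nhds p. side_sgn J * q $ 1 \<ge> 0 \<longrightarrow> tracks J p0 r \<epsilon> q"
proof -
  obtain s where s: "0 \<le> s" "s \<le> r" "p = flow J s p0" using p by auto
  consider "s = 0" | "s = r" | "0 < s" "s < r" using s by linarith
  then show ?thesis
  proof cases
    case 1 then show ?thesis using tracks_from_start[OF piece \<epsilon>] s by simp
  next
    case 2 then show ?thesis using tracks_from_end[OF piece \<epsilon>] s by simp
  next
    case 3
    have "open {q :: real^2. side_sgn J * q $ 1 > 0}" by (intro open_Collect_less continuous_intros)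
    moreover have "flow J s p0 \<in> {q. side_sgn J * q $ 1 > 0}" using piece 3 by (simp add: side_piece_def)
    ultimately have "\<forall>\<^sub>F q in nhds (flow J s p0). side_sgn J * q $ 1 > 0"
      using eventually_nhds_in_open by fastforce
    then have "\<forall>\<^sub>F q in nhds (flow J s p0). side_sgn J * q $ 1 \<ge> 0 \<longrightarrow>
      (side_sgn J * q $ 1 > 0 \<or> q $ 1 = 0 \<and> (\<forall>K. side_sgn J * V K q $ 1 > 0)) \<and>
      (\<forall>t. 0 < t \<and> t \<le> 0 \<longrightarrow> side_sgn J * flow J t q $ 1 > 0)"
      by (rule eventually_mono) auto
    from tracks_from_inside[OF piece \<epsilon> _ _ _ _ this] show ?thesis using 3 s by simp
  qed
qed

end

context lipschitz_pws
begin

text \<open>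
  Lipschitz bounds on both parts give one on the union, and a single point is negligible.
\<close>

lemma solution_concat:
  assumes s1: "filippov_solution V I1 z1" and s2: "filippov_solution V I2 z2"
    and I1: "I1 \<subseteq> {..c}" "\<And>a. a \<in> I1 \<Longrightarrow> {a..c} \<subseteq> I1" and I2: "I2 \<subseteq> {c..}" "\<And>b. b \<in> I2 \<Longrightarrow> {c..b} \<subseteq> I2"
    and c: "c \<in> I1" "c \<in> I2" "z1 c = z2 c"
  shows "filippov_solution V (I1 \<union> I2) (\<lambda>t. if t \<le> c then z1 t else z2 t)" (is "filippov_solution V ?I ?z")
  unfolding filippov_solution_def
proof (intro conjI allI impI)
  fix a b assume ab: "{a..b} \<subseteq> ?I"
  show "absolutely_continuous_on {a..b} ?z"
  proof (cases "a \<le> b")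
    case True
    then have "a \<in> ?I" "b \<in> ?I" using ab by auto
    have "{min a c..c} \<subseteq> I1"
      using I1(2)[of a] I2(1) \<open>a \<in> ?I\<close> c(1) by (cases "a \<le> c") (auto simp: min_def)
    then obtain C1 where C1: "C1-lipschitz_on {min a c..c} z1" using solution_lipschitz[OF s1] by blast
    have "{c..max b c} \<subseteq> I2"
      using I2(2)[of b] I1(1) \<open>b \<in> ?I\<close> c(2) by (cases "b \<ge> c") (auto simp: max_def)
    then obtain C2 where C2: "C2-lipschitz_on {c..max b c} z2" using solution_lipschitz[OF s2] by blast
    have "(max C1 C2)-lipschitz_on {min a c..max b c} ?z"
      by (rule lipschitz_on_concat_max[OF C1 C2 c(3)])
    then have "(max C1 C2)-lipschitz_on {a..b} ?z" by (rule lipschitz_on_subset) auto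
    then show ?thesis by (rule lipschitz_on_imp_absolutely_continuous_on)
  next
    case False
    then have "0-lipschitz_on {a..b} ?z" by auto
    then show ?thesis by (rule lipschitz_on_imp_absolutely_continuous_on)
  qed
next
  obtain N1 where N1: "negligible N1" and d1: "\<And>t. t \<in> I1 - N1 \<Longrightarrow>
      \<exists>v\<in>filippov_set V (z1 t). (z1 has_vector_derivative v) (at t within I1)"
    using s1 unfolding filippov_solution_def eventually_ae_filter_negligible by blast
  obtain N2 where N2: "negligible N2" and d2: "\<And>t. t \<in> I2 - N2 \<Longrightarrow>
      \<exists>v\<in>filippov_set V (z2 t). (z2 has_vector_derivative v) (at t within I2)"
    using s2 unfolding filippov_solution_def eventually_ae_filter_negligible by blast
  have "\<exists>v\<in>filippov_set V (?z t). (?z has_vector_derivative v) (at t within ?I)"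
    if t: "t \<in> ?I" "t \<notin> insert c (N1 \<union> N2)" for t
  proof (cases "t < c")
    case True
    then have "t \<in> I1" using t I2(1) by auto
    then obtain v where v: "v \<in> filippov_set V (z1 t)" "(z1 has_vector_derivative v) (at t within I1)"
      using d1 t by blast
    have "at t within I1 = at t within ?I"
      by (rule at_within_nhd[of t "{..<c}"]) (use True I2 in auto)
    moreover have "\<forall>\<^sub>F s in nhds t. z1 s = ?z s"
      using eventually_nhds_in_open[of "{..<c}" t] True by (auto elim: eventually_mono)
    ultimately have "(?z has_vector_derivative v) (at t within ?I)"
      using v(2) has_vector_derivative_cong_ev[where f = z1 and g = ?z and x = t and S = ?I] True
      by (simp add: eventually_mono)
    then show ?thesis using v(1) True by auto
  next
    case False
    then have gt: "c < t" using t by auto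
    then have "t \<in> I2" using t I1(1) by auto
    then obtain v where v: "v \<in> filippov_set V (z2 t)" "(z2 has_vector_derivative v) (at t within I2)"
      using d2 t by blast
    have "at t within I2 = at t within ?I"
      by (rule at_within_nhd[of t "{c<..}"]) (use gt I1 in auto)
    moreover have "\<forall>\<^sub>F s in nhds t. z2 s = ?z s"
      using eventually_nhds_in_open[of "{c<..}" t] gt by (auto elim: eventually_mono)
    ultimately have "(?z has_vector_derivative v) (at t within ?I)"
      using v(2) has_vector_derivative_cong_ev[where f = z2 and g = ?z and x = t and S = ?I] gt
      by (simp add: eventually_mono)
    then show ?thesis using v(1) gt by auto
  qed
  moreover have "negligible (insert c (N1 \<union> N2))" using N1 N2 by simp
  ultimately show "AE t in lebesgue. t \<in> ?I \<longrightarrow> (\<exists>v\<in>filippov_set V (?z t). (?z has_vector_derivative v) (at t within ?I))"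
    unfolding eventually_ae_filter_negligible by blast
qed

end

context two_foci
begin

lemma turn_solution:
  assumes u: "u > 0 \<and> I = {0..turn_time u} \<or> u = - w \<and> I = {..turn_time u}"
  shows "filippov_solution V I (turn u)"
proof (rule filippov_solutionI[of I "turn u" "{0, tL (u + w), turn_time u}"])
  fix t assume t: "t \<in> I - {0, tL (u + w), turn_time u}"
  then show "\<exists>v\<in>filippov_set V (turn u t). (turn u has_vector_derivative v) (at t within I)"
    using u w_nonneg by (intro turn_deriv) (auto simp: less_le)
qed (auto intro: turn_continuous)

end

context contracting_foci
begin

definition v_fix :: real where "v_fix = PL (u_fix + w)"

lemma v_fix_pos: "v_fix > 0" by (simp add: v_fix_def PL_pos)

lemma left_piece: "side_piece L (down_pt u_fix) cycle_tL"
  unfolding side_piece_def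
  using cycle_tL_pos V_down_pt[OF u_fix(1)] flow_left_inside[of u_fix] u_fix(1) w_nonneg flow_left_end[of u_fix] V_up_pt[OF v_fix_pos]
  by (auto simp: cycle_tL_def v_fix_def)

lemma right_piece: "side_piece R (up_pt v_fix) cycle_tR"
  unfolding side_piece_def
  using cycle_tR_pos V_up_pt[OF v_fix_pos] flow_right_inside[OF v_fix_pos] flow_right_end[OF v_fix_pos] V_down_pt[OF u_fix(1)] u_fix(2)
  by (auto simp: cycle_tR_def v_fix_def ret_def)

abbreviation "WL \<equiv> (\<lambda>t. flow L t (down_pt u_fix)) ` {0..cycle_tL}"
abbreviation "WR \<equiv> (\<lambda>t. flow R t (up_pt v_fix)) ` {0..cycle_tR}"

lemma flow_cycle_tL: "flow L cycle_tL (down_pt u_fix) = up_pt v_fix"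
  by (simp add: cycle_tL_def v_fix_def flow_left_end)

lemma flow_cycle_tR: "flow R cycle_tR (up_pt v_fix) = down_pt u_fix"
  using flow_right_end[OF v_fix_pos] u_fix(2) by (simp add: cycle_tR_def v_fix_def ret_def)

lemma cycle_pieces: "cycle u_fix = WL \<union> WR"
proof
  show "cycle u_fix \<subseteq> WL \<union> WR"
    unfolding cycle_def turn_time_fix
  proof clarify
    fix t assume t: "t \<in> {0..cycle_tL + cycle_tR}" "turn u_fix t \<notin> WR"
    show "turn u_fix t \<in> WL"
    proof (cases "t \<le> cycle_tL")
      case True then show ?thesis using t(1) by (auto simp: turn_def cycle_tL_def)
    next
      case False
      then have "turn u_fix t = flow R (t - cycle_tL) (up_pt v_fix)" by (simp add: turn_def cycle_tL_def v_fix_def)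
      then have "turn u_fix t \<in> WR" using t(1) False by auto
      then show ?thesis using t(2) by simp
    qed
  qed
  have "flow L t (down_pt u_fix) \<in> cycle u_fix" if "t \<in> {0..cycle_tL}" for t
    unfolding cycle_def turn_time_fix using that cycle_tR_pos
    by (intro image_eqI[of _ _ t]) (auto simp: turn_def cycle_tL_def)
  moreover have "flow R t (up_pt v_fix) \<in> cycle u_fix" if "t \<in> {0..cycle_tR}" for t
    unfolding cycle_def turn_time_fix using that cycle_tL_pos flow_cycle_tL
    by (intro image_eqI[of _ _ "t + cycle_tL"]) (auto simp: turn_def cycle_tL_def v_fix_def flow_left_end)
  ultimately show "WL \<union> WR \<subseteq> cycle u_fix" by auto
qed

lemma corners: "down_pt u_fix \<in> WL" "down_pt u_fix \<in> WR" "up_pt v_fix \<in> WL" "up_pt v_fix \<in> WR"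
proof -
  show "down_pt u_fix \<in> WL" using cycle_tL_pos by (intro image_eqI[of _ _ 0]) auto
  show "up_pt v_fix \<in> WR" using cycle_tR_pos by (intro image_eqI[of _ _ 0]) auto
  show "up_pt v_fix \<in> WL" using cycle_tL_pos flow_cycle_tL by (intro image_eqI[of _ _ cycle_tL]) auto
  show "down_pt u_fix \<in> WR" using cycle_tR_pos flow_cycle_tR by (intro image_eqI[of _ _ cycle_tR]) auto
qed

lemma cycle_on_line: "p \<in> cycle u_fix \<Longrightarrow> p $ 1 = 0 \<Longrightarrow> p = down_pt u_fix \<or> p = up_pt v_fix"
  unfolding cycle_pieces
proof (elim UnE imageE)
  fix t assume t: "p $ 1 = 0" "p = flow L t (down_pt u_fix)" "t \<in> {0..cycle_tL}"
  have "t = 0 \<or> t = cycle_tL"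
  proof (rule ccontr)
    assume "\<not> (t = 0 \<or> t = cycle_tL)"
    then have "0 < t" "t < cycle_tL" using t(3) by auto
    then have "side_sgn L * flow L t (down_pt u_fix) $ 1 > 0" using left_piece by (simp add: side_piece_def)
    then show False using t(1,2) by simp
  qed
  then show ?thesis using t flow_cycle_tL by auto
next
  fix t assume t: "p $ 1 = 0" "p = flow R t (up_pt v_fix)" "t \<in> {0..cycle_tR}"
  have "t = 0 \<or> t = cycle_tR"
  proof (rule ccontr)
    assume "\<not> (t = 0 \<or> t = cycle_tR)"
    then have "0 < t" "t < cycle_tR" using t(3) by auto
    then have "side_sgn R * flow R t (up_pt v_fix) $ 1 > 0" using right_piece by (simp add: side_piece_def)
    then show False using t(1,2) by simp
  qed
  then show ?thesis using t flow_cycle_tR by auto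
qed

lemma WL_left: "p \<in> WL \<Longrightarrow> p $ 1 \<le> 0"
proof -
  assume "p \<in> WL"
  then obtain t where t: "0 \<le> t" "t \<le> cycle_tL" "p = flow L t (down_pt u_fix)" by auto
  then consider "t = 0" | "t = cycle_tL" | "0 < t" "t < cycle_tL" by linarith
  then show ?thesis
  proof cases
    case 3
    then show ?thesis using left_piece t(3) by (simp add: side_piece_def less_imp_le)
  qed (use t(3) flow_cycle_tL in auto)
qed

lemma WR_right: "p \<in> WR \<Longrightarrow> p $ 1 \<ge> 0"
proof -
  assume "p \<in> WR"
  then obtain t where t: "0 \<le> t" "t \<le> cycle_tR" "p = flow R t (up_pt v_fix)" by auto
  then consider "t = 0" | "t = cycle_tR" | "0 < t" "t < cycle_tR" by linarith
  then show ?thesis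
  proof cases
    case 3
    then show ?thesis using right_piece t(3) by (simp add: side_piece_def less_imp_le)
  qed (use t(3) flow_cycle_tR in auto)
qed

lemma cycle_compact: "compact (cycle u_fix)" and cycle_nonempty: "cycle u_fix \<noteq> {}"
  unfolding cycle_def using turn_time_pos[of u_fix]
  by (auto intro!: compact_continuous_image turn_continuous)

text \<open>
  Staying \<open>\<epsilon>\<close>-close to the cycle until the line is met at a distance less than \<open>\<eta>\<close> from the fixed point.
\<close>

definition returns :: "real \<Rightarrow> real \<Rightarrow> real^2 \<Rightarrow> bool" where
  "returns \<epsilon> \<eta> q \<longleftrightarrow> (\<forall>z. filippov_solution V {0..} z \<and> z 0 = q \<longrightarrow>
     (\<exists>\<tau>\<ge>0. z \<tau> $ 1 = 0 \<and> dist (z \<tau>) (down_pt u_fix) < \<eta> \<and> (\<forall>t\<in>{0..\<tau>}. infdist (z t) (cycle u_fix) < \<epsilon>)))"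

lemma returnsD:
  assumes "returns \<epsilon> \<eta> (z 0)" "filippov_solution V {0..} z"
  obtains \<tau> where "\<tau> \<ge> 0" "z \<tau> $ 1 = 0" "dist (z \<tau>) (down_pt u_fix) < \<eta>"
    "\<And>t. t \<in> {0..\<tau>} \<Longrightarrow> infdist (z t) (cycle u_fix) < \<epsilon>"
  using assms unfolding returns_def by blast

lemma infdist_mono_cycle: "infdist p WL < \<epsilon> \<Longrightarrow> infdist p (cycle u_fix) < \<epsilon>"
  "infdist p WR < \<epsilon> \<Longrightarrow> infdist p (cycle u_fix) < \<epsilon>"
proof -
  have "WL \<noteq> {}" "WR \<noteq> {}" using corners by blast+
  then have "infdist p (cycle u_fix) \<le> infdist p WL" "infdist p (cycle u_fix) \<le> infdist p WR"
    unfolding cycle_pieces by (auto intro!: infdist_mono)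
  then show "infdist p WL < \<epsilon> \<Longrightarrow> infdist p (cycle u_fix) < \<epsilon>" "infdist p WR < \<epsilon> \<Longrightarrow> infdist p (cycle u_fix) < \<epsilon>"
    by linarith+
qed

lemma shifted_solution:
  assumes "filippov_solution V {0..} z" "\<tau> \<ge> 0"
  shows "filippov_solution V {0..} (\<lambda>t. z (t + \<tau>))"
  by (rule solution_shift[OF assms(1)]) (use assms(2) in auto)

lemma returns_right:
  assumes "\<epsilon> > 0" "\<eta> > 0" "p \<in> WR"
  shows "\<forall>\<^sub>F q in nhds p. q $ 1 \<ge> 0 \<longrightarrow> returns \<epsilon> \<eta> q"
proof -
  have "min \<epsilon> \<eta> > 0" using assms by simp
  from tracks_near_piece[OF right_piece this assms(3)]
  show ?thesis
  proof (rule eventually_mono)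
    fix q assume *: "side_sgn R * q $ 1 \<ge> 0 \<longrightarrow> tracks R (up_pt v_fix) cycle_tR (min \<epsilon> \<eta>) q"
    show "q $ 1 \<ge> 0 \<longrightarrow> returns \<epsilon> \<eta> q"
      unfolding returns_def
    proof (intro impI allI)
      fix z assume "q $ 1 \<ge> 0" and z: "filippov_solution V {0..} z \<and> z 0 = q"
      then obtain \<tau> where "\<tau> \<ge> 0" "z \<tau> $ 1 = 0" "dist (z \<tau>) (down_pt u_fix) < min \<epsilon> \<eta>"
        "\<forall>t\<in>{0..\<tau>}. infdist (z t) WR < min \<epsilon> \<eta>"
        using * unfolding tracks_def flow_cycle_tR by auto
      then show "\<exists>\<tau>\<ge>0. z \<tau> $ 1 = 0 \<and> dist (z \<tau>) (down_pt u_fix) < \<eta> \<and> (\<forall>t\<in>{0..\<tau>}. infdist (z t) (cycle u_fix) < \<epsilon>)"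
        by (intro exI[of _ \<tau>]) (auto intro!: infdist_mono_cycle)
    qed
  qed
qed

text \<open>
  Tracking the left arc leads to a neighbourhood of the upper corner, from which the right arc is tracked.
  The intermediate time is kept in the statement, because near the lower corner it shows that a full turn
  has been made and not only a short passage.
\<close>

lemma returns_left:
  assumes \<epsilon>: "\<epsilon> > 0" and \<eta>: "\<eta> > 0" and \<kappa>: "\<kappa> > 0" and p: "p \<in> WL"
  shows "\<forall>\<^sub>F q in nhds p. q $ 1 \<le> 0 \<longrightarrow> (\<forall>z. filippov_solution V {0..} z \<and> z 0 = q \<longrightarrow>
     (\<exists>\<tau>1\<ge>0. \<exists>\<tau>\<ge>\<tau>1. dist (z \<tau>1) (up_pt v_fix) < \<kappa> \<and> z \<tau> $ 1 = 0 \<and> dist (z \<tau>) (down_pt u_fix) < \<eta> \<and>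
        (\<forall>t\<in>{0..\<tau>}. infdist (z t) (cycle u_fix) < \<epsilon>)))"
proof -
  obtain d where d: "d > 0" "\<And>q. dist q (up_pt v_fix) < d \<Longrightarrow> q $ 1 \<ge> 0 \<Longrightarrow> returns \<epsilon> \<eta> q"
    using returns_right[OF \<epsilon> \<eta> corners(4)] by (auto simp: eventually_nhds_metric)
  define \<delta> where "\<delta> = min (min \<epsilon> \<kappa>) d"
  have "\<delta> > 0" using \<epsilon> \<kappa> d(1) by (simp add: \<delta>_def)
  from tracks_near_piece[OF left_piece this p]
  show ?thesis
  proof (rule eventually_mono)
    fix q assume *: "side_sgn L * q $ 1 \<ge> 0 \<longrightarrow> tracks L (down_pt u_fix) cycle_tL \<delta> q"
    show "q $ 1 \<le> 0 \<longrightarrow> (\<forall>z. filippov_solution V {0..} z \<and> z 0 = q \<longrightarrow>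
     (\<exists>\<tau>1\<ge>0. \<exists>\<tau>\<ge>\<tau>1. dist (z \<tau>1) (up_pt v_fix) < \<kappa> \<and> z \<tau> $ 1 = 0 \<and> dist (z \<tau>) (down_pt u_fix) < \<eta> \<and>
        (\<forall>t\<in>{0..\<tau>}. infdist (z t) (cycle u_fix) < \<epsilon>)))"
    proof (intro impI allI)
      fix z assume "q $ 1 \<le> 0" and z: "filippov_solution V {0..} z \<and> z 0 = q"
      then obtain \<tau>1 where \<tau>1: "\<tau>1 \<ge> 0" "z \<tau>1 $ 1 = 0" "dist (z \<tau>1) (up_pt v_fix) < \<delta>"
        "\<And>t. t \<in> {0..\<tau>1} \<Longrightarrow> infdist (z t) WL < \<delta>"
        using * unfolding tracks_def flow_cycle_tL by auto
      have "returns \<epsilon> \<eta> (z \<tau>1)" using \<tau>1 by (intro d(2)) (auto simp: \<delta>_def)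
      then have "returns \<epsilon> \<eta> (z (0 + \<tau>1))" by simp
      from returnsD[of \<epsilon> \<eta> "\<lambda>t. z (t + \<tau>1)", OF this shifted_solution[OF conjunct1[OF z] \<tau>1(1)]]
      obtain \<tau>2 where \<tau>2: "\<tau>2 \<ge> 0" "z (\<tau>2 + \<tau>1) $ 1 = 0" "dist (z (\<tau>2 + \<tau>1)) (down_pt u_fix) < \<eta>"
        "\<And>t. t \<in> {0..\<tau>2} \<Longrightarrow> infdist (z (t + \<tau>1)) (cycle u_fix) < \<epsilon>" by blast
      have "infdist (z t) (cycle u_fix) < \<epsilon>" if "t \<in> {0..\<tau>2 + \<tau>1}" for t
      proof (cases "t \<le> \<tau>1")
        case True
        then show ?thesis using \<tau>1(4)[of t] that by (intro infdist_mono_cycle) (auto simp: \<delta>_def)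
      next
        case False
        then show ?thesis using \<tau>2(4)[of "t - \<tau>1"] that by simp
      qed
      then show "\<exists>\<tau>1\<ge>0. \<exists>\<tau>\<ge>\<tau>1. dist (z \<tau>1) (up_pt v_fix) < \<kappa> \<and> z \<tau> $ 1 = 0 \<and> dist (z \<tau>) (down_pt u_fix) < \<eta> \<and>
        (\<forall>t\<in>{0..\<tau>}. infdist (z t) (cycle u_fix) < \<epsilon>)"
        using \<tau>1 \<tau>2 by (intro exI[of _ \<tau>1] conjI exI[of _ "\<tau>2 + \<tau>1"]) (auto simp: \<delta>_def)
    qed
  qed
qed

text \<open>
  Points of the cycle off the line have a neighbourhood on one side only; the two corners belong to both
  arcs, and each arc takes care of one of the closed half-planes.
\<close>

lemma returns_near_cycle:
  assumes \<epsilon>: "\<epsilon> > 0" and \<eta>: "\<eta> > 0"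
  shows "\<exists>\<delta>>0. \<forall>q. infdist q (cycle u_fix) < \<delta> \<longrightarrow> returns \<epsilon> \<eta> q"
proof (rule compact_uniform_neighbourhood[OF cycle_compact cycle_nonempty])
  fix p assume p: "p \<in> cycle u_fix"
  have "\<forall>\<^sub>F q in nhds p. q $ 1 \<ge> 0 \<longrightarrow> returns \<epsilon> \<eta> q"
  proof (cases "p \<in> WR")
    case True then show ?thesis by (rule returns_right[OF \<epsilon> \<eta>])
  next
    case False
    then have "p $ 1 \<noteq> 0" using cycle_on_line[OF p] corners by auto
    then have "p $ 1 < 0" using p False WL_left[of p] by (auto simp: cycle_pieces)
    moreover have "open {q :: real^2. q $ 1 < 0}" by (intro open_Collect_less continuous_intros)
    ultimately have "\<forall>\<^sub>F q in nhds p. q $ 1 < 0" using eventually_nhds_in_open by fastforce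
    then show ?thesis by (rule eventually_mono) auto
  qed
  moreover have "\<forall>\<^sub>F q in nhds p. q $ 1 \<le> 0 \<longrightarrow> returns \<epsilon> \<eta> q"
  proof (cases "p \<in> WL")
    case True
    from returns_left[OF \<epsilon> \<eta> zero_less_one True] show ?thesis
    proof (rule eventually_mono, intro impI)
      fix q :: "real^2"
      assume *: "q $ 1 \<le> 0 \<longrightarrow> (\<forall>z. filippov_solution V {0..} z \<and> z 0 = q \<longrightarrow>
        (\<exists>\<tau>1\<ge>0. \<exists>\<tau>\<ge>\<tau>1. dist (z \<tau>1) (up_pt v_fix) < 1 \<and> z \<tau> $ 1 = 0 \<and> dist (z \<tau>) (down_pt u_fix) < \<eta> \<and>
          (\<forall>t\<in>{0..\<tau>}. infdist (z t) (cycle u_fix) < \<epsilon>)))" and q: "q $ 1 \<le> 0"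
      show "returns \<epsilon> \<eta> q" unfolding returns_def
      proof (intro allI impI)
        fix z assume z: "filippov_solution V {0..} z \<and> z 0 = q"
        obtain \<tau>1 \<tau> where "\<tau>1 \<ge> 0" "\<tau> \<ge> \<tau>1" "z \<tau> $ 1 = 0" "dist (z \<tau>) (down_pt u_fix) < \<eta>"
          "\<forall>t\<in>{0..\<tau>}. infdist (z t) (cycle u_fix) < \<epsilon>" using mp[OF spec[OF mp[OF * q]] z] by (elim exE conjE)
        then show "\<exists>\<tau>\<ge>0. z \<tau> $ 1 = 0 \<and> dist (z \<tau>) (down_pt u_fix) < \<eta> \<and> (\<forall>t\<in>{0..\<tau>}. infdist (z t) (cycle u_fix) < \<epsilon>)"
          by (intro exI[of _ \<tau>]) auto
      qed
    qed
  next
    case False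
    then have "p $ 1 \<noteq> 0" using cycle_on_line[OF p] corners by auto
    then have "p $ 1 > 0" using p False WR_right[of p] by (auto simp: cycle_pieces)
    moreover have "open {q :: real^2. q $ 1 > 0}" by (intro open_Collect_less continuous_intros)
    ultimately have "\<forall>\<^sub>F q in nhds p. q $ 1 > 0" using eventually_nhds_in_open by fastforce
    then show ?thesis by (rule eventually_mono) auto
  qed
  ultimately show "\<forall>\<^sub>F q in nhds p. returns \<epsilon> \<eta> q"
    by eventually_elim (meson linear)
qed

lemma dist_down_pt: "dist (down_pt u) (down_pt u') = \<bar>u - u'\<bar>"
proof -
  have "down_pt u - down_pt u' = (u' - u) *\<^sub>R axis 2 1" by (simp add: real2_eq_iff axis_def)
  then show ?thesis by (simp add: dist_norm abs_minus_commute)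
qed

lemma near_down_pt:
  assumes "p $ 1 = 0" "dist p (down_pt u_fix) < \<eta>" "\<eta> \<le> u_fix"
  shows "\<exists>u>0. p = down_pt u \<and> \<bar>u - u_fix\<bar> < \<eta>"
proof -
  define u where "u = tang R - p $ 2"
  have p: "p = down_pt u" using assms(1) by (simp add: u_def real2_eq_iff)
  then have "\<bar>u - u_fix\<bar> < \<eta>" using assms(2) by (simp add: dist_down_pt)
  then show ?thesis using p assms(3) by (intro exI[of _ u]) auto
qed

text \<open>
  The time \<open>\<tau>\<close> of return is positive, since the solution has been near the upper corner before, and at this
  time it is in the section. During the first turn the section is met only at the end.
\<close>

lemma turn_near_cycle:
  assumes \<epsilon>: "\<epsilon> > 0"
  shows "\<exists>\<eta>>0. \<eta> \<le> u_fix \<and> (\<forall>u z. \<bar>u - u_fix\<bar> < \<eta> \<and> filippov_solution V {0..} z \<and> z 0 = down_pt u \<longrightarrow>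
    (\<forall>t\<in>{0..turn_time u}. infdist (z t) (cycle u_fix) < \<epsilon>))"
proof -
  have ne: "up_pt v_fix \<noteq> down_pt u_fix"
    using v_fix_pos u_fix(1) w_nonneg by (auto simp: real2_eq_iff w_def)
  \<comment> \<open>Half the distance of the corners, so that no point is close to both.\<close>
  define \<kappa> where "\<kappa> = dist (up_pt v_fix) (down_pt u_fix) / 2"
  have \<kappa>: "\<kappa> > 0" using ne by (simp add: \<kappa>_def)
  obtain d where d: "d > 0" "\<And>q z. dist q (down_pt u_fix) < d \<Longrightarrow> q $ 1 \<le> 0 \<Longrightarrow> filippov_solution V {0..} z \<Longrightarrow> z 0 = q \<Longrightarrow>
     \<exists>\<tau>1\<ge>0. \<exists>\<tau>\<ge>\<tau>1. dist (z \<tau>1) (up_pt v_fix) < \<kappa> \<and> z \<tau> $ 1 = 0 \<and> dist (z \<tau>) (down_pt u_fix) < u_fix \<and>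
        (\<forall>t\<in>{0..\<tau>}. infdist (z t) (cycle u_fix) < \<epsilon>)"
    using returns_left[OF \<epsilon> u_fix(1) \<kappa> corners(1)] unfolding eventually_nhds_metric by blast
  define \<eta> where "\<eta> = min (min d \<kappa>) u_fix"
  have \<eta>: "\<eta> > 0" "\<eta> \<le> u_fix" "\<eta> \<le> d" "\<eta> \<le> \<kappa>" using d(1) \<kappa> u_fix(1) by (auto simp: \<eta>_def)
  have "infdist (z t) (cycle u_fix) < \<epsilon>"
    if u: "\<bar>u - u_fix\<bar> < \<eta>" and sol: "filippov_solution V {0..} z" and z: "z 0 = down_pt u" and t: "t \<in> {0..turn_time u}" for u z t
  proof -
    have upos: "u > 0" using u \<eta>(2) by linarith
    have near: "dist (down_pt u) (down_pt u_fix) < d" "dist (down_pt u) (down_pt u_fix) < \<kappa>" using u \<eta> by (auto simp: dist_down_pt)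
    obtain \<tau>1 \<tau> where \<tau>: "0 \<le> \<tau>1" "\<tau>1 \<le> \<tau>" "dist (z \<tau>1) (up_pt v_fix) < \<kappa>" "z \<tau> $ 1 = 0"
      "dist (z \<tau>) (down_pt u_fix) < u_fix" "\<And>t. t \<in> {0..\<tau>} \<Longrightarrow> infdist (z t) (cycle u_fix) < \<epsilon>"
      using d(2)[OF near(1) _ sol z] by auto
    have "\<tau>1 \<noteq> 0"
    proof
      assume "\<tau>1 = 0"
      then have "dist (down_pt u) (up_pt v_fix) < \<kappa>" using \<tau>(3) z by simp
      then show False using near(2) dist_triangle[of "up_pt v_fix" "down_pt u_fix" "down_pt u"]
        by (simp add: \<kappa>_def dist_commute)
    qed
    then have "\<tau> > 0" using \<tau> by simp
    have "z \<tau> \<in> section_L" using near_down_pt[OF \<tau>(4,5)] by (auto simp: section_L_iff)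
    have "turn_time u \<le> \<tau>"
    proof (rule ccontr)
      assume "\<not> turn_time u \<le> \<tau>"
      then have "z \<tau> = turn u \<tau>" "turn u \<tau> \<notin> section_L"
        using solution_turns(2)[OF sol z upos, of \<tau> 0] turn_inside[OF upos \<open>\<tau> > 0\<close>] \<open>\<tau> > 0\<close> by auto
      then show False using \<open>z \<tau> \<in> section_L\<close> by simp
    qed
    then show ?thesis using \<tau>(6)[of t] t by simp
  qed
  then show ?thesis using \<eta>(1,2) by blast
qed

text \<open>
  From the \<open>N\<close>-th crossing on, every turn starts close to the fixed point.
\<close>

lemma follows_iterates:
  assumes \<eta>: "\<And>u z t. \<bar>u - u_fix\<bar> < \<eta> \<Longrightarrow> filippov_solution V {0..} z \<Longrightarrow> z 0 = down_pt u \<Longrightarrow>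
      t \<in> {0..turn_time u} \<Longrightarrow> infdist (z t) (cycle u_fix) < \<epsilon>"
    and sol: "filippov_solution V {0..} z" and z: "z 0 = down_pt u" and u: "u > 0"
    and close: "\<And>n. n \<ge> N \<Longrightarrow> \<bar>(ret ^^ n) u - u_fix\<bar> < \<eta>" and t: "t \<ge> cross_time u N"
  shows "infdist (z t) (cycle u_fix) < \<epsilon>"
proof -
  have "t \<ge> 0" using t cross_time_mono[of 0 N u] by simp
  then obtain n where n: "cross_time u n \<le> t" "t < cross_time u (Suc n)" using cross_time_cover by blast
  have "n \<ge> N" using cross_time_mono[of "Suc n" N u] n t by (force simp: not_less_eq_eq)
  have c0: "cross_time u n \<ge> 0" using cross_time_mono[of 0 n u] by simp
  have "infdist (z ((t - cross_time u n) + cross_time u n)) (cycle u_fix) < \<epsilon>"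
    using n solution_turns(1)[OF sol z u, of n]
    by (intro \<eta>[OF close[OF \<open>n \<ge> N\<close>] shifted_solution[OF sol c0]]) (auto simp: cross_time_Suc)
  then show ?thesis by simp
qed

lemma cycle_lyapunov_stable: "lyapunov_stable V (cycle u_fix)"
  unfolding lyapunov_stable_def
proof (intro allI impI)
  fix \<epsilon> :: real assume \<epsilon>: "\<epsilon> > 0"
  obtain \<eta> where \<eta>: "\<eta> > 0" "\<eta> \<le> u_fix" and near: "\<And>u z t. \<bar>u - u_fix\<bar> < \<eta> \<Longrightarrow> filippov_solution V {0..} z \<Longrightarrow> z 0 = down_pt u \<Longrightarrow>
      t \<in> {0..turn_time u} \<Longrightarrow> infdist (z t) (cycle u_fix) < \<epsilon>"
    using turn_near_cycle[OF \<epsilon>] by blast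
  obtain \<delta> where \<delta>: "\<delta> > 0" "\<And>q. infdist q (cycle u_fix) < \<delta> \<Longrightarrow> returns \<epsilon> \<eta> q"
    using returns_near_cycle[OF \<epsilon> \<eta>(1)] by blast
  show "\<exists>\<delta>>0. \<forall>z. filippov_solution V {0..} z \<and> infdist (z 0) (cycle u_fix) < \<delta> \<longrightarrow> (\<forall>t\<ge>0. infdist (z t) (cycle u_fix) < \<epsilon>)"
  proof (intro exI[of _ \<delta>] conjI \<delta>(1) allI impI)
    fix z and t :: real assume z: "filippov_solution V {0..} z \<and> infdist (z 0) (cycle u_fix) < \<delta>" and t: "0 \<le> t"
    then have "returns \<epsilon> \<eta> (z 0)" using \<delta>(2) by blast
    from returnsD[OF this conjunct1[OF z]]
    obtain \<tau> where \<tau>: "\<tau> \<ge> 0" "z \<tau> $ 1 = 0" "dist (z \<tau>) (down_pt u_fix) < \<eta>"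
      "\<And>t. t \<in> {0..\<tau>} \<Longrightarrow> infdist (z t) (cycle u_fix) < \<epsilon>" by blast
    obtain u where u: "u > 0" "z \<tau> = down_pt u" "\<bar>u - u_fix\<bar> < \<eta>" using near_down_pt[OF \<tau>(2,3) \<eta>(2)] by blast
    show "infdist (z t) (cycle u_fix) < \<epsilon>"
    proof (cases "t \<le> \<tau>")
      case True then show ?thesis using \<tau>(4) t by simp
    next
      case False
      have "infdist (z ((t - \<tau>) + \<tau>)) (cycle u_fix) < \<epsilon>"
      proof (rule follows_iterates[where u = u and N = 0 and \<eta> = \<eta> and z = "\<lambda>t. z (t + \<tau>)" and t = "t - \<tau>"])
        show "filippov_solution V {0..} (\<lambda>t. z (t + \<tau>))" using z \<tau>(1) by (intro shifted_solution) auto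
        show "\<bar>(ret ^^ n) u - u_fix\<bar> < \<eta>" for n using ret_iterates(2)[OF u(1), of n] u(3) by linarith
      qed (use near u False in auto)
      then show ?thesis by simp
    qed
  qed
qed

lemma iterates_attracted:
  assumes sol: "filippov_solution V {0..} z" and z: "z 0 = down_pt u" and u: "u > 0"
  shows "((\<lambda>t. infdist (z t) (cycle u_fix)) \<longlongrightarrow> 0) at_top"
proof (rule tendstoI)
  fix \<epsilon> :: real assume \<epsilon>: "\<epsilon> > 0"
  obtain \<eta> where \<eta>: "\<eta> > 0" "\<eta> \<le> u_fix" and near: "\<And>u z t. \<bar>u - u_fix\<bar> < \<eta> \<Longrightarrow> filippov_solution V {0..} z \<Longrightarrow> z 0 = down_pt u \<Longrightarrow>
      t \<in> {0..turn_time u} \<Longrightarrow> infdist (z t) (cycle u_fix) < \<epsilon>"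
    using turn_near_cycle[OF \<epsilon>] by blast
  obtain N where N: "\<And>n. n \<ge> N \<Longrightarrow> \<bar>(ret ^^ n) u - u_fix\<bar> < \<eta>"
    using ret_iterates(1)[OF u] \<eta>(1) unfolding LIMSEQ_def dist_real_def by blast
  have "infdist (z t) (cycle u_fix) < \<epsilon>" if "t \<ge> cross_time u N" for t
    by (rule follows_iterates[where \<eta> = \<eta> and N = N and u = u and z = z])
      (assumption | rule near sol z u N that)+
  then show "\<forall>\<^sub>F t in at_top. dist (infdist (z t) (cycle u_fix)) 0 < \<epsilon>"
    by (auto simp: eventually_at_top_linorder infdist_nonneg)
qed

lemma cycle_asymptotically_stable: "asymptotically_stable V (cycle u_fix)"
  unfolding asymptotically_stable_def
proof (intro conjI cycle_lyapunov_stable)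
  obtain \<delta> where \<delta>: "\<delta> > 0" "\<And>q. infdist q (cycle u_fix) < \<delta> \<Longrightarrow> returns 1 u_fix q"
    using returns_near_cycle[OF zero_less_one u_fix(1)] by blast
  show "\<exists>\<delta>>0. \<forall>z. filippov_solution V {0..} z \<and> infdist (z 0) (cycle u_fix) < \<delta> \<longrightarrow> ((\<lambda>t. infdist (z t) (cycle u_fix)) \<longlongrightarrow> 0) at_top"
  proof (intro exI[of _ \<delta>] conjI \<delta>(1) allI impI)
    fix z assume z: "filippov_solution V {0..} z \<and> infdist (z 0) (cycle u_fix) < \<delta>"
    then have "returns 1 u_fix (z 0)" using \<delta>(2) by blast
    from returnsD[OF this conjunct1[OF z]]
    obtain \<tau> where \<tau>: "\<tau> \<ge> 0" "z \<tau> $ 1 = 0" "dist (z \<tau>) (down_pt u_fix) < u_fix"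
      "\<And>t. t \<in> {0..\<tau>} \<Longrightarrow> infdist (z t) (cycle u_fix) < 1" by blast
    obtain u where u: "u > 0" "z \<tau> = down_pt u" using near_down_pt[OF \<tau>(2,3) order_refl] by blast
    have "((\<lambda>t. infdist (z (t + \<tau>)) (cycle u_fix)) \<longlongrightarrow> 0) at_top"
      using z \<tau>(1) u by (intro iterates_attracted[where u = u] shifted_solution) auto
    then have "((\<lambda>t. infdist (z ((t - \<tau>) + \<tau>)) (cycle u_fix)) \<longlongrightarrow> 0) at_top"
      by (rule filterlim_compose) (intro filterlim_tendsto_add_at_top[of "\<lambda>_. - \<tau>" "- \<tau>" at_top "\<lambda>t. t", simplified] filterlim_ident)
    then show "((\<lambda>t. infdist (z t) (cycle u_fix)) \<longlongrightarrow> 0) at_top" by simp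
  qed
qed

text \<open>
  The orbit that touches the line at \<open>tang L\<close> has a complete past in \<open>x < 0\<close>. Continuing it by further
  turns and shifting time gives solutions on \<open>{..0}\<close> that end at the iterates of \<open>ret (- w)\<close>.
\<close>

lemma grazing_solutions:
  "\<exists>z. filippov_solution V {..0} z \<and> z 0 = down_pt ((ret ^^ n) (ret (- w))) \<and> (\<exists>t\<le>0. z t = vector [0, tang L])"
proof (induction n)
  case 0
  have "filippov_solution V {..0} (\<lambda>t. turn (- w) (t + turn_time (- w)))"
    by (rule solution_shift[OF turn_solution[of "- w" "{..turn_time (- w)}"]]) auto
  moreover have "turn (- w) (- turn_time (- w) + turn_time (- w)) = vector [0, tang L]"
    by (simp add: down_pt_def w_def)
  ultimately show ?case
    using turn_time_pos[of "- w"]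
    by (intro exI[of _ "\<lambda>t. turn (- w) (t + turn_time (- w))"] conjI exI[of _ "- turn_time (- w)"]) (auto simp: turn_end)
next
  case (Suc n)
  let ?u = "(ret ^^ n) (ret (- w))"
  obtain z t where z: "filippov_solution V {..0} z" "z 0 = down_pt ?u" "t \<le> 0" "z t = vector [0, tang L]"
    using Suc by blast
  have u: "?u > 0" by (rule ret_pow_pos[OF ret_pos])
  define y where "y t = (if t \<le> 0 then z t else turn ?u t)" for t
  have "filippov_solution V ({..0} \<union> {0..turn_time ?u}) y"
    unfolding y_def using z u turn_time_pos[of ?u]
    by (intro solution_concat turn_solution) auto
  then have "filippov_solution V {..0} (\<lambda>t. y (t + turn_time ?u))"
    by (rule solution_shift) auto
  then show ?case
    using turn_time_pos[of ?u] z(3,4)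
    by (intro exI[of _ "\<lambda>t. y (t + turn_time ?u)"] conjI exI[of _ "t - turn_time ?u"]) (auto simp: y_def turn_end)
qed

text \<open>
  The point of tangency is not on the cycle, whereas the end points of the solutions through it converge to
  the cycle.
\<close>

lemma cycle_not_stable_in_past:
  "\<exists>\<epsilon>>0. \<forall>\<delta>>0. \<exists>z. filippov_solution V {..0} z \<and> infdist (z 0) (cycle u_fix) < \<delta> \<and> (\<exists>t\<le>0. infdist (z t) (cycle u_fix) \<ge> \<epsilon>)"
proof -
  let ?g = "vector [0, tang L] :: real^2"
  have "?g \<notin> cycle u_fix"
    using cycle_on_line[of ?g] v_fix_pos u_fix(1) w_nonneg by (auto simp: real2_eq_iff w_def)
  then have pos: "infdist ?g (cycle u_fix) > 0"
    using in_closed_iff_infdist_zero[OF compact_imp_closed[OF cycle_compact] cycle_nonempty, of ?g]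
      infdist_nonneg[of ?g "cycle u_fix"] by (simp add: less_le)
  have "\<exists>z. filippov_solution V {..0} z \<and> infdist (z 0) (cycle u_fix) < \<delta> \<and> (\<exists>t\<le>0. infdist (z t) (cycle u_fix) \<ge> infdist ?g (cycle u_fix))"
    if \<delta>: "\<delta> > 0" for \<delta>
  proof -
    obtain n where n: "\<bar>(ret ^^ n) (ret (- w)) - u_fix\<bar> < \<delta>"
      using ret_iterates(1)[OF ret_pos, of "- w"] \<delta> unfolding LIMSEQ_def dist_real_def by blast
    obtain z t where z: "filippov_solution V {..0} z" "z 0 = down_pt ((ret ^^ n) (ret (- w)))" "t \<le> 0" "z t = ?g"
      using grazing_solutions by blast
    have "infdist (z 0) (cycle u_fix) \<le> dist (z 0) (down_pt u_fix)"
      using corners cycle_pieces by (intro infdist_le) auto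
    then have "infdist (z 0) (cycle u_fix) < \<delta>" using n z(2) by (simp add: dist_down_pt)
    then show ?thesis using z by (intro exI[of _ z] conjI exI[of _ t]) auto
  qed
  then show ?thesis using pos by blast
qed

end

section \<open>Changes of variables\<close>

definition scale :: "real \<Rightarrow> real \<Rightarrow> real^2 \<Rightarrow> real^2" where
  "scale c1 c2 z = vector [c1 * z $ 1, c2 * z $ 2]"

text \<open>
  Reversal of time goes with a reflection of \<open>x\<close>, which exchanges the two sides.
\<close>

definition side_perm :: "real \<Rightarrow> side \<Rightarrow> side" where
  "side_perm \<tau> J = (if \<tau> = 1 then J else (case J of L \<Rightarrow> R | R \<Rightarrow> L))"

lemma side_perm_simps [simp]: "side_perm 1 J = J" "side_perm (-1) L = R" "side_perm (-1) R = L"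
  by (auto simp: side_perm_def)

lemma side_perm_involution: "side_perm \<tau> (side_perm \<tau> J) = J"
  by (cases J) (auto simp: side_perm_def)

lemma scale_nth [simp]: "scale c1 c2 z $ 1 = c1 * z $ 1" "scale c1 c2 z $ 2 = c2 * z $ 2"
  by (simp_all add: scale_def)

lemma scale_bounded_linear: "bounded_linear (scale c1 c2)"
  by (intro linear_conv_bounded_linear[THEN iffD1] linearI) (auto simp: real2_eq_iff algebra_simps)

lemma dist_scale:
  assumes "\<bar>c2\<bar> = \<bar>c1\<bar>"
  shows "dist (scale c1 c2 x) (scale c1 c2 y) = \<bar>c1\<bar> * dist x y"
proof -
  have c2: "c2\<^sup>2 = c1\<^sup>2" using assms by (simp add: power2_eq_iff abs_eq_iff)
  have norm2: "norm v = sqrt ((v $ 1)\<^sup>2 + (v $ 2)\<^sup>2)" for v :: "real^2"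
    by (simp add: norm_vec_def L2_set_def sum_2)
  have "(c1 * (x $ 1 - y $ 1))\<^sup>2 + (c2 * (x $ 2 - y $ 2))\<^sup>2 = c1\<^sup>2 * ((x $ 1 - y $ 1)\<^sup>2 + (x $ 2 - y $ 2)\<^sup>2)"
    by (simp add: power_mult_distrib c2 distrib_left)
  then show ?thesis
    by (simp add: dist_norm norm2 real_sqrt_mult right_diff_distrib[symmetric])
qed

lemma infdist_image_similarity:
  assumes T: "\<And>x y. dist (T x) (T y) = c * dist x y" and c: "c > 0" and S: "S \<noteq> {}"
  shows "infdist (T x) (T ` S) = c * infdist x S"
proof (rule antisym)
  have "infdist (T x) (T ` S) / c \<le> infdist x S"
    unfolding infdist_notempty[OF S]
  proof (rule cINF_greatest[OF S])
    fix y assume "y \<in> S"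
    then have "infdist (T x) (T ` S) \<le> dist (T x) (T y)" by (intro infdist_le) auto
    then show "infdist (T x) (T ` S) / c \<le> dist x y" using c by (simp add: T field_simps)
  qed
  then show "infdist (T x) (T ` S) \<le> c * infdist x S" using c by (simp add: field_simps)
  have ne: "T ` S \<noteq> {}" using S by simp
  show "c * infdist x S \<le> infdist (T x) (T ` S)"
    unfolding infdist_notempty[OF ne]
  proof (rule cINF_greatest[OF ne])
    fix y assume "y \<in> T ` S"
    then obtain s where s: "s \<in> S" "y = T s" by auto
    then show "c * infdist x S \<le> dist (T x) y" using infdist_le[OF s(1), of x] c by (simp add: T)
  qed
qed

text \<open>
  A diagonal change of variables combined with the time factor \<open>\<tau>\<close>. The sign condition says that \<open>x\<close> is
  reflected exactly when time is reversed, which preserves the direction of crossing.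
\<close>

locale conjugate_fields = lipschitz_pws V K for V K +
  fixes V' :: pws_field and c1 c2 \<tau> :: real
  assumes tau: "\<tau> = 1 \<or> \<tau> = -1" and c1_sign: "\<tau> * c1 > 0"
    and conj: "\<And>J z. V' J (scale c1 c2 z) = \<tau> *\<^sub>R scale c1 c2 (V (side_perm \<tau> J) z)"
begin

lemma filippov_set_conj:
  assumes v: "v \<in> filippov_set V p"
  shows "\<tau> *\<^sub>R scale c1 c2 v \<in> filippov_set V' (scale c1 c2 p)"
proof -
  consider "p $ 1 < 0" | "p $ 1 > 0" | "p $ 1 = 0" by linarith
  then show ?thesis
  proof cases
    case 1
    then show ?thesis using v tau c1_sign conj[of "side_perm \<tau> L" p]
      by (auto simp: filippov_set_def mult_pos_neg mult_neg_neg mult_less_0_iff)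
  next
    case 2
    then show ?thesis using v tau c1_sign conj[of "side_perm \<tau> R" p]
      by (auto simp: filippov_set_def mult_less_0_iff)
  next
    case 3
    then obtain u where u: "0 \<le> u" "u \<le> 1" "v = (1 - u) *\<^sub>R V L p + u *\<^sub>R V R p"
      using v by (auto simp: filippov_set_def in_segment)
    have lin: "\<tau> *\<^sub>R scale c1 c2 v = (1 - u) *\<^sub>R (\<tau> *\<^sub>R scale c1 c2 (V L p)) + u *\<^sub>R (\<tau> *\<^sub>R scale c1 c2 (V R p))"
      unfolding u(3) by (simp add: real2_eq_iff algebra_simps)
    have "\<tau> *\<^sub>R scale c1 c2 v \<in> closed_segment (\<tau> *\<^sub>R scale c1 c2 (V L p)) (\<tau> *\<^sub>R scale c1 c2 (V R p))"
      unfolding lin in_segment using u by blast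
    moreover have "closed_segment (\<tau> *\<^sub>R scale c1 c2 (V L p)) (\<tau> *\<^sub>R scale c1 c2 (V R p))
        = closed_segment (V' L (scale c1 c2 p)) (V' R (scale c1 c2 p))"
      using tau
    proof
      assume "\<tau> = -1"
      then show ?thesis unfolding conj by (simp only: side_perm_simps closed_segment_commute)
    qed (simp add: conj)
    ultimately have "\<tau> *\<^sub>R scale c1 c2 v \<in> closed_segment (V' L (scale c1 c2 p)) (V' R (scale c1 c2 p))"
      by (simp only:)
    then show ?thesis using 3 by (simp add: filippov_set_def)
  qed
qed

lemma solution_conj:
  assumes "filippov_solution V I z" "\<And>t. t \<in> I' \<Longrightarrow> \<tau> * t \<in> I"
  shows "filippov_solution V' I' (\<lambda>t. scale c1 c2 (z (\<tau> * t)))"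
  using solution_transform[OF assms(1) tau scale_bounded_linear[of c1 c2], of V' I' 0] assms(2) filippov_set_conj
  by simp

lemma scale_inj: "c2 \<noteq> 0 \<Longrightarrow> scale c1 c2 p = scale c1 c2 q \<longleftrightarrow> p = q"
  using c1_sign by (auto simp: real2_eq_iff)

lemma range_tau: "range (\<lambda>t. f (\<tau> * t)) = range f"
proof -
  have "f t \<in> range (\<lambda>t. f (\<tau> * t))" for t using tau by (intro image_eqI[of _ _ "\<tau> * t"]) auto
  then show ?thesis by auto
qed

lemma periodic_orbit_conj:
  assumes "periodic_orbit V \<Gamma>" "c2 \<noteq> 0"
  shows "periodic_orbit V' (scale c1 c2 ` \<Gamma>)"
proof -
  obtain z T s where z: "0 < T" "filippov_solution V UNIV z" "\<And>t. z (t + T) = z t" "z s \<noteq> z 0" "\<Gamma> = range z"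
    using assms unfolding periodic_orbit_def by blast
  define y where "y t = scale c1 c2 (z (\<tau> * t))" for t
  have "filippov_solution V' UNIV y" unfolding y_def by (rule solution_conj[OF z(2)]) simp
  moreover have "y (t + T) = y t" for t
    using tau z(3)[of t] z(3)[of "- t - T"] by (auto simp: y_def)
  moreover have "y (\<tau> * s) \<noteq> y 0" using tau z(4) scale_inj[OF assms(2)] by (auto simp: y_def)
  moreover have "scale c1 c2 ` \<Gamma> = range y"
    unfolding z(5) y_def range_tau[of "\<lambda>t. scale c1 c2 (z t)"] by auto
  ultimately show ?thesis unfolding periodic_orbit_def using z(1) by blast
qed

text \<open>
  Under time reversal the excursion to the right becomes the one to the left. The crossing from left to
  right stays where it is: its time direction and its sides are both exchanged.
\<close>

lemma two_zone_cycle_conj: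
  assumes "two_zone_cycle V \<Gamma> yL yR tL tR"
  shows "two_zone_cycle V' (scale c1 c2 ` \<Gamma>) (c2 * yL) (c2 * yR)
    (if \<tau> = 1 then tL else tR) (if \<tau> = 1 then tR else tL)"
proof -
  obtain z where t: "0 < tL" "0 < tR" and sol: "filippov_solution V UNIV z" and rng: "range z = \<Gamma>"
    and per: "\<And>t. z (t + (tR + tL)) = z t" and z0: "z 0 = vector [0, yR]" "\<And>J. V J (z 0) $ 1 > 0"
    and right: "\<And>t. 0 < t \<Longrightarrow> t < tR \<Longrightarrow> z t $ 1 > 0"
    and zR: "z tR = vector [0, yL]" "\<And>J. V J (z tR) $ 1 < 0"
    and left: "\<And>t. tR < t \<Longrightarrow> t < tR + tL \<Longrightarrow> z t $ 1 < 0"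
    using assms unfolding two_zone_cycle_def by blast
  define y where "y t = scale c1 c2 (z (\<tau> * t))" for t
  have soly: "filippov_solution V' UNIV y" unfolding y_def by (rule solution_conj[OF sol]) simp
  have rngy: "range y = scale c1 c2 ` \<Gamma>"
    unfolding rng[symmetric] y_def range_tau[of "\<lambda>t. scale c1 c2 (z t)"] by auto
  have pos: "V' J (scale c1 c2 p) $ 1 > 0" if "\<And>J. V J p $ 1 > 0" for J p
    using that[of "side_perm \<tau> J"] c1_sign unfolding conj by (simp add: zero_less_mult_iff mult.assoc[symmetric])
  have neg: "V' J (scale c1 c2 p) $ 1 < 0" if "\<And>J. V J p $ 1 < 0" for J p
    using that[of "side_perm \<tau> J"] c1_sign unfolding conj by (simp add: mult_pos_neg mult.assoc[symmetric])
  have sc: "scale c1 c2 (vector [0, q]) = vector [0, c2 * q]" for q by (simp add: real2_eq_iff)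
  have c1: "\<tau> = 1 \<Longrightarrow> c1 > 0" "\<tau> = -1 \<Longrightarrow> c1 < 0" using c1_sign by auto
  have wrap: "z (- t) = z (tR + tL - t)" for t using per[of "- t"] by (simp add: algebra_simps)
  have y0: "y 0 = vector [0, c2 * yR]" "\<And>J. V' J (y 0) $ 1 > 0"
  proof -
    show "y 0 = vector [0, c2 * yR]" by (simp add: y_def z0(1) sc)
    show "V' J (y 0) $ 1 > 0" for J using pos[of "z 0"] z0(2) by (simp add: y_def)
  qed
  show ?thesis
  proof (cases "\<tau> = 1")
    case True
    have "\<exists>y. filippov_solution V' UNIV y \<and> range y = scale c1 c2 ` \<Gamma> \<and> (\<forall>t. y (t + (tR + tL)) = y t) \<and>
          y 0 = vector [0, c2 * yR] \<and> (\<forall>J. V' J (y 0) $ 1 > 0) \<and>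
          (\<forall>t. 0 < t \<and> t < tR \<longrightarrow> y t $ 1 > 0) \<and>
          y tR = vector [0, c2 * yL] \<and> (\<forall>J. V' J (y tR) $ 1 < 0) \<and>
          (\<forall>t. tR < t \<and> t < tR + tL \<longrightarrow> y t $ 1 < 0)"
    proof (intro exI[of _ y] conjI soly rngy y0 allI impI)
      show "y tR = vector [0, c2 * yL]" "\<And>J. V' J (y tR) $ 1 < 0"
        using zR neg[of "z tR"] True by (simp_all add: y_def sc)
    qed (use True per right left c1 in \<open>auto simp: y_def mult_pos_neg\<close>)
    then show ?thesis unfolding two_zone_cycle_def using t True by simp
  next
    case False
    then have \<tau>: "\<tau> = -1" using tau by simp
    have "\<exists>y. filippov_solution V' UNIV y \<and> range y = scale c1 c2 ` \<Gamma> \<and> (\<forall>t. y (t + (tL + tR)) = y t) \<and>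
          y 0 = vector [0, c2 * yR] \<and> (\<forall>J. V' J (y 0) $ 1 > 0) \<and>
          (\<forall>t. 0 < t \<and> t < tL \<longrightarrow> y t $ 1 > 0) \<and>
          y tL = vector [0, c2 * yL] \<and> (\<forall>J. V' J (y tL) $ 1 < 0) \<and>
          (\<forall>t. tL < t \<and> t < tL + tR \<longrightarrow> y t $ 1 < 0)"
    proof (intro exI[of _ y] conjI soly rngy y0 allI impI)
      show "y tL = vector [0, c2 * yL]" "\<And>J. V' J (y tL) $ 1 < 0"
        using zR neg[of "z tR"] wrap[of tL] by (simp_all add: y_def \<tau> sc)
      show "y (t + (tL + tR)) = y t" for t
      proof -
        have "- (t + (tL + tR)) + (tR + tL) = - t" by simp
        then have "z (- (t + (tL + tR))) = z (- t)" using per[of "- (t + (tL + tR))"] by (simp only:)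
        then show ?thesis by (simp only: y_def \<tau> mult_minus_left mult_1)
      qed
      show "y t $ 1 > 0" if "0 < t \<and> t < tL" for t
        using left[of "tR + tL - t"] that wrap[of t] c1(2)[OF \<tau>] by (simp add: y_def \<tau> mult_neg_neg)
      show "y t $ 1 < 0" if "tL < t \<and> t < tL + tR" for t
        using right[of "tR + tL - t"] that wrap[of t] c1(2)[OF \<tau>] by (simp add: y_def \<tau> mult_neg_pos)
    qed
    then show ?thesis unfolding two_zone_cycle_def using t \<tau> by simp
  qed
qed

end

section \<open>The family of systems\<close>

text \<open>
  An eigenvector makes the characteristic polynomial vanish at \<open>l + i w\<close>; its real and imaginary parts give
  the two equations.
\<close>

lemma eigenvalues_trace_det:
  assumes eig: "eigenvalues (vector [vector [a1, a2], vector [b1, b2]] :: real^2^2)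
      = {Complex l w, Complex l (- w)}" and w: "w \<noteq> 0"
  shows "a1 + b2 = 2 * l" "a1 * b2 - a2 * b1 = l\<^sup>2 + w\<^sup>2"
proof -
  let ?k = "Complex l w"
  have "?k \<in> eigenvalues (vector [vector [a1, a2], vector [b1, b2]] :: real^2^2)" using eig by simp
  then obtain v :: "complex^2" where v: "v \<noteq> 0"
    and ev: "(\<chi> i j. complex_of_real ((vector [vector [a1, a2], vector [b1, b2]] :: real^2^2) $ i $ j)) *v v = ?k *s v"
    unfolding eigenvalues_def by blast
  have 1: "of_real a1 * v $ 1 + of_real a2 * v $ 2 = ?k * v $ 1"
    and 2: "of_real b1 * v $ 1 + of_real b2 * v $ 2 = ?k * v $ 2"
    using arg_cong[OF ev, of "\<lambda>x. x $ 1"] arg_cong[OF ev, of "\<lambda>x. x $ 2"]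
    by (simp_all add: matrix_vector_mult_def sum_2)
  define c where "c = (?k - of_real a1) * (?k - of_real b2) - of_real a2 * of_real b1"
  have e1: "(?k - of_real a1) * v $ 1 = of_real a2 * v $ 2" and e2: "(?k - of_real b2) * v $ 2 = of_real b1 * v $ 1"
    using 1 2 by (simp_all add: algebra_simps)
  have "c * v $ 1 = (?k - of_real b2) * ((?k - of_real a1) * v $ 1) - of_real a2 * (of_real b1 * v $ 1)"
    by (simp add: c_def algebra_simps)
  also have "\<dots> = of_real a2 * ((?k - of_real b2) * v $ 2 - of_real b1 * v $ 1)"
    unfolding e1 by (simp add: algebra_simps)
  also have "\<dots> = 0" using e2 by simp
  finally have c1: "c * v $ 1 = 0" .
  have "c * v $ 2 = (?k - of_real a1) * ((?k - of_real b2) * v $ 2) - of_real b1 * (of_real a2 * v $ 2)"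
    by (simp add: c_def algebra_simps)
  also have "\<dots> = of_real b1 * ((?k - of_real a1) * v $ 1 - of_real a2 * v $ 2)"
    unfolding e2 by (simp add: algebra_simps)
  also have "\<dots> = 0" using e1 by simp
  finally have c2: "c * v $ 2 = 0" .
  have "c = 0" using v c1 c2 by (auto simp: vec_eq_iff forall_2)
  then have re: "(l - a1) * (l - b2) - w * w - a2 * b1 = 0" and im: "(l - a1) * w + w * (l - b2) = 0"
    by (auto simp: c_def complex_eq_iff)
  have "w * (2 * l - a1 - b2) = 0" using im by (simp add: algebra_simps)
  then show tr: "a1 + b2 = 2 * l" using w by simp
  have "(l - a1) * (l - b2) = l * l - l * (a1 + b2) + a1 * b2" by (simp add: algebra_simps)
  with re show "a1 * b2 - a2 * b1 = l\<^sup>2 + w\<^sup>2" unfolding tr by (simp add: power2_eq_square)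
qed

locale focus_family =
  fixes a1 a2 a3 b1 b2 b3 lam \<omega> :: "side \<Rightarrow> real" and F :: "real \<Rightarrow> side \<Rightarrow> real^2 \<Rightarrow> real^2"
  assumes F: "\<And>\<mu> J z. F \<mu> J z = vector [a1 J * z$1 + a2 J * z$2 + a3 J * \<mu>,
                                         b1 J * z$1 + b2 J * z$2 + b3 J * \<mu>]"
    and trace: "\<And>J. a1 J + b2 J = 2 * lam J"
    and det: "\<And>J. a1 J * b2 J - a2 J * b1 J = (lam J)\<^sup>2 + (\<omega> J)\<^sup>2"
    and omega: "\<And>J. \<omega> J > 0" and lamL: "lam L > 0" and lamR: "lam R < 0"
    and beta: "\<And>J. a3 J * b2 J - a2 J * b3 J > 0"
    and a2_sign: "a2 L * a2 R > 0" and gamma: "a2 L * (a2 L * a3 R - a3 L * a2 R) \<ge> 0"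
begin

abbreviation normalised :: "real \<Rightarrow> real \<Rightarrow> bool" where
  "normalised \<tau> \<sigma> \<equiv> two_foci (\<lambda>J. \<tau> * a1 (side_perm \<tau> J)) (\<lambda>J. \<sigma> * a2 (side_perm \<tau> J)) (\<lambda>J. \<tau> * a3 (side_perm \<tau> J))
    (\<lambda>J. \<sigma> * b1 (side_perm \<tau> J)) (\<lambda>J. \<tau> * b2 (side_perm \<tau> J)) (\<lambda>J. \<sigma> * b3 (side_perm \<tau> J))
    (\<lambda>J. \<tau> * lam (side_perm \<tau> J)) (\<lambda>J. \<omega> (side_perm \<tau> J))"

text \<open>
  For \<open>\<tau> = - 1\<close> the sides are exchanged and \<open>a3\<close>, \<open>lam\<close> change sign, so the stable right focus becomes an
  unstable left one; the order of the tangencies survives two changes of sign.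
\<close>

lemma normal_form:
  assumes \<tau>: "\<tau> = 1 \<or> \<tau> = -1" and \<sigma>: "\<sigma> = 1 \<or> \<sigma> = -1" and \<sigma>a: "\<sigma> * a2 L > 0"
  shows "normalised \<tau> \<sigma>"
proof -
  have \<sigma>a': "\<sigma> * a2 J > 0" for J using \<sigma>a a2_sign \<sigma> by (cases J) (auto simp: zero_less_mult_iff)
  have \<sigma>\<sigma>: "\<sigma> * \<sigma> = 1" and \<tau>\<tau>: "\<tau> * \<tau> = 1" using \<sigma> \<tau> by auto
  have ord: "\<sigma> * (a3 R / a2 R - a3 L / a2 L) \<ge> 0"
  proof -
    have "a2 L \<noteq> 0" "a2 R \<noteq> 0" using a2_sign by auto
    then have "\<sigma> * (a3 R / a2 R - a3 L / a2 L) = (\<sigma> * a2 L) * (a2 L * (a2 L * a3 R - a3 L * a2 R)) / (a2 L * a2 L * (a2 L * a2 R))"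
      by (simp add: field_simps)
    also have "\<dots> \<ge> 0"
      using \<sigma>a gamma a2_sign by (intro divide_nonneg_nonneg mult_nonneg_nonneg[of "\<sigma> * a2 L"] mult_nonneg_nonneg[of "a2 L * a2 L"]) auto
    finally show ?thesis .
  qed
  show ?thesis
  proof
    fix J
    let ?J = "side_perm \<tau> J"
    show "\<tau> * a1 ?J + \<tau> * b2 ?J = 2 * (\<tau> * lam ?J)" using trace[of ?J] by (simp add: distrib_left[symmetric])
    have "\<tau> * a1 ?J * (\<tau> * b2 ?J) - \<sigma> * a2 ?J * (\<sigma> * b1 ?J) = (\<tau> * \<tau>) * (a1 ?J * b2 ?J) - (\<sigma> * \<sigma>) * (a2 ?J * b1 ?J)"
      by (simp add: algebra_simps)
    then show "\<tau> * a1 ?J * (\<tau> * b2 ?J) - \<sigma> * a2 ?J * (\<sigma> * b1 ?J) = (\<tau> * lam ?J)\<^sup>2 + (\<omega> ?J)\<^sup>2"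
      using det[of ?J] \<sigma>\<sigma> \<tau>\<tau> \<tau> by auto
    have "\<tau> * a3 ?J * (\<tau> * b2 ?J) - \<sigma> * a2 ?J * (\<sigma> * b3 ?J) = (\<tau> * \<tau>) * (a3 ?J * b2 ?J) - (\<sigma> * \<sigma>) * (a2 ?J * b3 ?J)"
      by (simp add: algebra_simps)
    then show "\<tau> * a3 ?J * (\<tau> * b2 ?J) - \<sigma> * a2 ?J * (\<sigma> * b3 ?J) > 0"
      using beta[of ?J] \<sigma>\<sigma> \<tau>\<tau> by simp
    show "0 < \<tau> * lam (side_perm \<tau> L)" "\<tau> * lam (side_perm \<tau> R) < 0" using \<tau> lamL lamR by auto
    show "- (\<tau> * a3 (side_perm \<tau> R)) / (\<sigma> * a2 (side_perm \<tau> R)) \<le> - (\<tau> * a3 (side_perm \<tau> L)) / (\<sigma> * a2 (side_perm \<tau> L))"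
      using ord \<tau> \<sigma> by auto
  qed (use omega \<sigma>a' in auto)
qed

lemma F_lipschitz: "\<exists>K. lipschitz_pws (F \<mu>) K"
  by (rule affine_field_lipschitz[of "F \<mu>" a1 a2 "\<lambda>J. a3 J * \<mu>" b1 b2 "\<lambda>J. b3 J * \<mu>"]) (rule F)

text \<open>
  The conjugacy rescales by \<open>\<bar>\<mu>\<bar>\<close>, reflects \<open>y\<close> according to \<open>\<sigma>\<close>, and reflects \<open>x\<close> and time according to
  \<open>\<tau>\<close>, the sign of \<open>\<mu>\<close>. The normal form depends on \<open>\<mu>\<close> only through this sign.
\<close>

lemma conjugate_to_normal_form:
  assumes \<tau>: "\<tau> = 1 \<or> \<tau> = -1" and \<sigma>: "\<sigma> = 1 \<or> \<sigma> = -1" and \<sigma>a: "\<sigma> * a2 L > 0" and \<mu>: "\<tau> * \<mu> > 0"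
  defines "V' \<equiv> two_foci.V (\<lambda>J. \<tau> * a1 (side_perm \<tau> J)) (\<lambda>J. \<sigma> * a2 (side_perm \<tau> J)) (\<lambda>J. \<tau> * a3 (side_perm \<tau> J))
    (\<lambda>J. \<sigma> * b1 (side_perm \<tau> J)) (\<lambda>J. \<tau> * b2 (side_perm \<tau> J)) (\<lambda>J. \<sigma> * b3 (side_perm \<tau> J))"
  shows "\<exists>K. conjugate_fields (F \<mu>) K V' (1 / \<mu>) (\<sigma> * \<tau> / \<mu>) \<tau>"
    and "\<exists>K. conjugate_fields V' K (F \<mu>) \<mu> (\<sigma> * \<tau> * \<mu>) \<tau>"
proof -
  interpret N: two_foci "\<lambda>J. \<tau> * a1 (side_perm \<tau> J)" "\<lambda>J. \<sigma> * a2 (side_perm \<tau> J)" "\<lambda>J. \<tau> * a3 (side_perm \<tau> J)"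
    "\<lambda>J. \<sigma> * b1 (side_perm \<tau> J)" "\<lambda>J. \<tau> * b2 (side_perm \<tau> J)" "\<lambda>J. \<sigma> * b3 (side_perm \<tau> J)"
    "\<lambda>J. \<tau> * lam (side_perm \<tau> J)" "\<lambda>J. \<omega> (side_perm \<tau> J)"
    by (rule normal_form[OF \<tau> \<sigma> \<sigma>a])
  have V': "V' = N.V" by (simp add: V'_def)
  have \<mu>0: "\<mu> \<noteq> 0" using \<mu> by auto
  have \<tau>': "\<tau> * (1 / \<mu>) > 0" using \<mu> \<tau> by (auto simp: zero_less_divide_iff)
  have fwd: "V' J (scale (1 / \<mu>) (\<sigma> * \<tau> / \<mu>) z) = \<tau> *\<^sub>R scale (1 / \<mu>) (\<sigma> * \<tau> / \<mu>) (F \<mu> (side_perm \<tau> J) z)" for J z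
    unfolding V' N.V_def F real2_eq_iff using \<mu>0 \<tau> \<sigma> by (auto simp: field_simps)
  obtain K where "lipschitz_pws (F \<mu>) K" using F_lipschitz by blast
  then interpret lipschitz_pws "F \<mu>" K .
  show "\<exists>K. conjugate_fields (F \<mu>) K V' (1 / \<mu>) (\<sigma> * \<tau> / \<mu>) \<tau>"
    by (rule exI[of _ K]) (unfold_locales; fact \<tau> \<tau>' fwd)
  have bwd: "F \<mu> J (scale \<mu> (\<sigma> * \<tau> * \<mu>) z) = \<tau> *\<^sub>R scale \<mu> (\<sigma> * \<tau> * \<mu>) (V' (side_perm \<tau> J) z)" for J z
    unfolding V' N.V_def F real2_eq_iff using \<tau> \<sigma> by (auto simp: side_perm_involution[of "-1", simplified] algebra_simps)
  show "\<exists>K. conjugate_fields V' K (F \<mu>) \<mu> (\<sigma> * \<tau> * \<mu>) \<tau>"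
    unfolding V' by (rule exI) (unfold_locales; fact \<tau> \<mu> bwd[unfolded V'])
qed

lemma no_limit_cycle:
  assumes \<tau>: "\<tau> = 1 \<or> \<tau> = -1" and \<mu>: "\<tau> * \<mu> > 0" and \<alpha>: "\<tau> * (lam L / \<omega> L + lam R / \<omega> R) \<ge> 0"
  shows "\<not> limit_cycle (F \<mu>) \<Gamma>"
proof
  assume "limit_cycle (F \<mu>) \<Gamma>"
  then have per: "periodic_orbit (F \<mu>) \<Gamma>" by (simp add: limit_cycle_def)
  define \<sigma> where "\<sigma> = sgn (a2 L)"
  have "a2 L \<noteq> 0" using a2_sign by auto
  then have \<sigma>: "\<sigma> = 1 \<or> \<sigma> = -1" "\<sigma> * a2 L > 0" by (auto simp: \<sigma>_def sgn_if)
  interpret N: two_foci "\<lambda>J. \<tau> * a1 (side_perm \<tau> J)" "\<lambda>J. \<sigma> * a2 (side_perm \<tau> J)" "\<lambda>J. \<tau> * a3 (side_perm \<tau> J)"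
    "\<lambda>J. \<sigma> * b1 (side_perm \<tau> J)" "\<lambda>J. \<tau> * b2 (side_perm \<tau> J)" "\<lambda>J. \<sigma> * b3 (side_perm \<tau> J)"
    "\<lambda>J. \<tau> * lam (side_perm \<tau> J)" "\<lambda>J. \<omega> (side_perm \<tau> J)"
    by (rule normal_form[OF \<tau> \<sigma>])
  obtain K where "conjugate_fields (F \<mu>) K N.V (1 / \<mu>) (\<sigma> * \<tau> / \<mu>) \<tau>"
    using conjugate_to_normal_form(1)[OF \<tau> \<sigma> \<mu>] by blast
  then interpret C: conjugate_fields "F \<mu>" K N.V "1 / \<mu>" "\<sigma> * \<tau> / \<mu>" \<tau> .
  have "\<sigma> * \<tau> / \<mu> \<noteq> 0" using \<tau> \<sigma> \<mu> by auto
  from C.periodic_orbit_conj[OF per this]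
  show False
    using N.no_periodic_orbit_expanding \<alpha> \<tau> by (auto simp: N.\<nu>_def algebra_simps)
qed

text \<open>
  The data of the cycle of the normal form, transported back. Heights are multiplied by \<open>\<sigma> \<tau> \<mu>\<close>, so the
  quotients by \<open>\<mu>\<close> are the same for all \<open>\<mu>\<close> of one sign; for \<open>\<tau> = - 1\<close> the two durations exchange
  their roles and the four equations are permuted accordingly. Asymptotic stability is preserved for
  \<open>\<tau> = 1\<close>, while for \<open>\<tau> = - 1\<close> the instability in the past becomes instability.
\<close>

lemma limit_cycle_exists:
  assumes \<tau>: "\<tau> = 1 \<or> \<tau> = -1" and \<alpha>: "\<tau> * (lam L / \<omega> L + lam R / \<omega> R) < 0"
  defines "\<xi> \<equiv> \<lambda>J. (a3 J * b2 J - a2 J * b3 J) * \<omega> J / (a2 J * ((lam J)\<^sup>2 + (\<omega> J)\<^sup>2))"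
  shows "\<exists>qL qR tL tR.
     qR + a3 R / a2 R = \<xi> R * exp (- lam R * tR) * \<rho> (\<omega> R * tR) (lam R / \<omega> R) / sin (\<omega> R * tR) \<and>
     qL + a3 R / a2 R = - \<xi> R * exp (lam R * tR) * \<rho> (\<omega> R * tR) (- (lam R / \<omega> R)) / sin (\<omega> R * tR) \<and>
     qL + a3 L / a2 L = \<xi> L * exp (- lam L * tL) * \<rho> (\<omega> L * tL) (lam L / \<omega> L) / sin (\<omega> L * tL) \<and>
     qR + a3 L / a2 L = - \<xi> L * exp (lam L * tL) * \<rho> (\<omega> L * tL) (- (lam L / \<omega> L)) / sin (\<omega> L * tL) \<and>
     (\<forall>\<mu>. \<tau> * \<mu> > 0 \<longrightarrow> (\<exists>\<Gamma>. (\<forall>\<Gamma>'. limit_cycle (F \<mu>) \<Gamma>' \<longleftrightarrow> \<Gamma>' = \<Gamma>) \<and>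
       (\<tau> = 1 \<longrightarrow> asymptotically_stable (F \<mu>) \<Gamma>) \<and> (\<tau> = -1 \<longrightarrow> \<not> lyapunov_stable (F \<mu>) \<Gamma>) \<and>
       (\<forall>yL yR sL sR. two_zone_cycle (F \<mu>) \<Gamma> yL yR sL sR \<longleftrightarrow>
          yL = qL * \<mu> \<and> yR = qR * \<mu> \<and> sL = tL \<and> sR = tR)))"
proof -
  define \<sigma> where "\<sigma> = sgn (a2 L)"
  have "a2 L \<noteq> 0" using a2_sign by auto
  then have \<sigma>: "\<sigma> = 1 \<or> \<sigma> = -1" "\<sigma> * a2 L > 0" by (auto simp: \<sigma>_def sgn_if)
  interpret N: contracting_foci "\<lambda>J. \<tau> * a1 (side_perm \<tau> J)" "\<lambda>J. \<sigma> * a2 (side_perm \<tau> J)" "\<lambda>J. \<tau> * a3 (side_perm \<tau> J)"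
    "\<lambda>J. \<sigma> * b1 (side_perm \<tau> J)" "\<lambda>J. \<tau> * b2 (side_perm \<tau> J)" "\<lambda>J. \<sigma> * b3 (side_perm \<tau> J)"
    "\<lambda>J. \<tau> * lam (side_perm \<tau> J)" "\<lambda>J. \<omega> (side_perm \<tau> J)"
    by (intro contracting_foci.intro contracting_foci_axioms.intro normal_form[OF \<tau> \<sigma>])
      (use \<tau> \<alpha> in \<open>auto simp: two_foci.\<nu>_def[OF normal_form[OF \<tau> \<sigma>]] algebra_simps\<close>)
  define s where "s = \<sigma> * \<tau>"
  have s: "s = 1 \<or> s = -1" "s * s = 1" using \<sigma> \<tau> by (auto simp: s_def)
  define qL qR where "qL = s * N.cycle_yL" and "qR = s * N.cycle_yR"
  define tL tR where "tL = (if \<tau> = 1 then N.cycle_tL else N.cycle_tR)" and "tR = (if \<tau> = 1 then N.cycle_tR else N.cycle_tL)"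
  have tang: "a3 (side_perm \<tau> J) / a2 (side_perm \<tau> J) = - (s * N.tang J)" for J
    using \<sigma>(1) \<tau> by (auto simp: N.tang_def s_def)
  have xi: "N.\<xi> J = \<sigma> * \<xi> (side_perm \<tau> J)" for J
    using \<sigma>(1) \<tau> by (auto simp: N.\<xi>_def N.D_def \<xi>_def)
  have eqs: "s * (N.cycle_yR - N.tang R) + 0 = qR + a3 (side_perm \<tau> R) / a2 (side_perm \<tau> R)"
    "s * (N.cycle_yL - N.tang R) + 0 = qL + a3 (side_perm \<tau> R) / a2 (side_perm \<tau> R)"
    "s * (N.cycle_yL - N.tang L) + 0 = qL + a3 (side_perm \<tau> L) / a2 (side_perm \<tau> L)"
    "s * (N.cycle_yR - N.tang L) + 0 = qR + a3 (side_perm \<tau> L) / a2 (side_perm \<tau> L)"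
    unfolding tang qL_def qR_def by (simp_all add: algebra_simps)
  have s\<sigma>: "s * \<sigma> = \<tau>" using \<sigma>(1) by (auto simp: s_def)
  have eq1: "qR + a3 R / a2 R = \<xi> R * exp (- lam R * tR) * \<rho> (\<omega> R * tR) (lam R / \<omega> R) / sin (\<omega> R * tR)"
   and eq2: "qL + a3 R / a2 R = - \<xi> R * exp (lam R * tR) * \<rho> (\<omega> R * tR) (- (lam R / \<omega> R)) / sin (\<omega> R * tR)"
   and eq3: "qL + a3 L / a2 L = \<xi> L * exp (- lam L * tL) * \<rho> (\<omega> L * tL) (lam L / \<omega> L) / sin (\<omega> L * tL)"
   and eq4: "qR + a3 L / a2 L = - \<xi> L * exp (lam L * tL) * \<rho> (\<omega> L * tL) (- (lam L / \<omega> L)) / sin (\<omega> L * tL)"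
    using eqs[unfolded N.cycle_equations xi] \<tau> \<sigma>(1)
    by (auto simp: s_def tL_def tR_def)
  have cyc: "\<exists>\<Gamma>. (\<forall>\<Gamma>'. limit_cycle (F \<mu>) \<Gamma>' \<longleftrightarrow> \<Gamma>' = \<Gamma>) \<and>
       (\<tau> = 1 \<longrightarrow> asymptotically_stable (F \<mu>) \<Gamma>) \<and> (\<tau> = -1 \<longrightarrow> \<not> lyapunov_stable (F \<mu>) \<Gamma>) \<and>
       (\<forall>yL yR sL sR. two_zone_cycle (F \<mu>) \<Gamma> yL yR sL sR \<longleftrightarrow>
          yL = qL * \<mu> \<and> yR = qR * \<mu> \<and> sL = tL \<and> sR = tR)" if \<mu>: "\<tau> * \<mu> > 0" for \<mu>
  proof -
    have \<mu>0: "\<mu> \<noteq> 0" using \<mu> by auto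
    obtain K where "conjugate_fields (F \<mu>) K N.V (1 / \<mu>) (\<sigma> * \<tau> / \<mu>) \<tau>"
      using conjugate_to_normal_form(1)[OF \<tau> \<sigma> \<mu>] by blast
    then interpret C: conjugate_fields "F \<mu>" K N.V "1 / \<mu>" "s / \<mu>" \<tau> unfolding s_def .
    obtain K' where "conjugate_fields N.V K' (F \<mu>) \<mu> (\<sigma> * \<tau> * \<mu>) \<tau>"
      using conjugate_to_normal_form(2)[OF \<tau> \<sigma> \<mu>] by blast
    then interpret B: conjugate_fields N.V K' "F \<mu>" \<mu> "s * \<mu>" \<tau> unfolding s_def .
    let ?T = "scale (1 / \<mu>) (s / \<mu>)" and ?U = "scale \<mu> (s * \<mu>)"
    have nz: "s / \<mu> \<noteq> 0" "s * \<mu> \<noteq> 0" using s \<mu>0 by auto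
    have UT: "?U (?T p) = p" and TU: "?T (?U p) = p" for p
      using \<mu>0 s by (auto simp: real2_eq_iff)
    define C0 where "C0 = N.cycle N.u_fix"
    define \<Gamma> where "\<Gamma> = ?U ` C0"
    have T\<Gamma>: "?T ` \<Gamma> = C0" by (simp add: \<Gamma>_def image_image TU)
    have per: "periodic_orbit (F \<mu>) \<Gamma>" unfolding \<Gamma>_def C0_def
      using B.periodic_orbit_conj[OF N.cycle_periodic_orbit[OF N.u_fix(1,2)] nz(2)] .
    have uniq: "\<Gamma>' = \<Gamma>" if "periodic_orbit (F \<mu>) \<Gamma>'" for \<Gamma>'
    proof -
      have "?T ` \<Gamma>' = C0" unfolding C0_def
        using N.periodic_orbit_unique[OF C.periodic_orbit_conj[OF that nz(1)]] .
      then have "?U ` ?T ` \<Gamma>' = \<Gamma>" by (simp add: \<Gamma>_def)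
      then show ?thesis by (simp add: image_image UT)
    qed
    have lc: "limit_cycle (F \<mu>) \<Gamma>' \<longleftrightarrow> \<Gamma>' = \<Gamma>" for \<Gamma>'
      unfolding limit_cycle_def using per uniq open_UNIV by (metis subset_UNIV)
    have dU: "dist (?U x) (?U y) = \<bar>\<mu>\<bar> * dist x y" for x y
      by (rule dist_scale) (use s in \<open>auto simp: abs_mult\<close>)
    have infd: "infdist (?U x) \<Gamma> = \<bar>\<mu>\<bar> * infdist x C0" for x
      unfolding \<Gamma>_def C0_def by (rule infdist_image_similarity[OF dU _ N.cycle_nonempty]) (use \<mu>0 in simp)
    have infdT: "infdist x \<Gamma> = \<bar>\<mu>\<bar> * infdist (?T x) C0" for x using infd[of "?T x"] by (simp add: UT)
    have stable: "asymptotically_stable (F \<mu>) \<Gamma>" if "\<tau> = 1"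
    proof -
      have sol: "filippov_solution N.V {0..} (\<lambda>t. ?T (z t))" if "filippov_solution (F \<mu>) {0..} z" for z
        using C.solution_conj[OF that, of "{0..}"] \<open>\<tau> = 1\<close> by simp
      note as = N.cycle_asymptotically_stable[folded C0_def, unfolded asymptotically_stable_def]
      show ?thesis unfolding asymptotically_stable_def
      proof
        show "lyapunov_stable (F \<mu>) \<Gamma>" unfolding lyapunov_stable_def
        proof (intro allI impI)
          fix \<epsilon> :: real assume "\<epsilon> > 0"
          then have "\<epsilon> / \<bar>\<mu>\<bar> > 0" using \<mu>0 by simp
          then obtain \<delta> where \<delta>: "\<delta> > 0" "\<And>z t. filippov_solution N.V {0..} z \<Longrightarrow> infdist (z 0) C0 < \<delta> \<Longrightarrow>
              t \<ge> 0 \<Longrightarrow> infdist (z t) C0 < \<epsilon> / \<bar>\<mu>\<bar>"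
            using conjunct1[OF as] unfolding lyapunov_stable_def by blast
          have "infdist (z t) \<Gamma> < \<epsilon>" if "filippov_solution (F \<mu>) {0..} z" "infdist (z 0) \<Gamma> < \<delta> * \<bar>\<mu>\<bar>" "t \<ge> 0" for z t
            using \<delta>(2)[OF sol[OF that(1)] _ that(3)] that(2) \<mu>0 by (simp add: infdT field_simps)
          then show "\<exists>\<delta>>0. \<forall>z. filippov_solution (F \<mu>) {0..} z \<and> infdist (z 0) \<Gamma> < \<delta> \<longrightarrow> (\<forall>t\<ge>0. infdist (z t) \<Gamma> < \<epsilon>)"
            using \<delta>(1) \<mu>0 by (intro exI[of _ "\<delta> * \<bar>\<mu>\<bar>"]) auto
        qed
        obtain \<delta> where \<delta>: "\<delta> > 0" "\<And>z. filippov_solution N.V {0..} z \<Longrightarrow> infdist (z 0) C0 < \<delta> \<Longrightarrow>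
            ((\<lambda>t. infdist (z t) C0) \<longlongrightarrow> 0) at_top"
          using conjunct2[OF as] by blast
        have "((\<lambda>t. infdist (z t) \<Gamma>) \<longlongrightarrow> 0) at_top"
          if "filippov_solution (F \<mu>) {0..} z" "infdist (z 0) \<Gamma> < \<delta> * \<bar>\<mu>\<bar>" for z
        proof -
          have "((\<lambda>t. infdist (?T (z t)) C0) \<longlongrightarrow> 0) at_top"
            using \<delta>(2)[OF sol[OF that(1)]] that(2) \<mu>0 by (simp add: infdT field_simps)
          from tendsto_mult_left[OF this, of "\<bar>\<mu>\<bar>"] show ?thesis by (simp add: infdT)
        qed
        then show "\<exists>\<delta>>0. \<forall>z. filippov_solution (F \<mu>) {0..} z \<and> infdist (z 0) \<Gamma> < \<delta> \<longrightarrow>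
            ((\<lambda>t. infdist (z t) \<Gamma>) \<longlongrightarrow> 0) at_top"
          using \<delta>(1) \<mu>0 by (intro exI[of _ "\<delta> * \<bar>\<mu>\<bar>"]) auto
      qed
    qed
    have unstable: "\<not> lyapunov_stable (F \<mu>) \<Gamma>" if "\<tau> = -1"
    proof
      assume ls: "lyapunov_stable (F \<mu>) \<Gamma>"
      obtain \<epsilon> where \<epsilon>: "\<epsilon> > 0" "\<And>\<delta>. \<delta> > 0 \<Longrightarrow> \<exists>z. filippov_solution N.V {..0} z \<and> infdist (z 0) C0 < \<delta> \<and>
          (\<exists>t\<le>0. infdist (z t) C0 \<ge> \<epsilon>)"
        using N.cycle_not_stable_in_past[folded C0_def] by blast
      have "\<epsilon> * \<bar>\<mu>\<bar> > 0" using \<epsilon>(1) \<mu>0 by simp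
      then obtain \<delta> where \<delta>: "\<delta> > 0" "\<And>z t. filippov_solution (F \<mu>) {0..} z \<Longrightarrow> infdist (z 0) \<Gamma> < \<delta> \<Longrightarrow>
          t \<ge> 0 \<Longrightarrow> infdist (z t) \<Gamma> < \<epsilon> * \<bar>\<mu>\<bar>"
        using ls unfolding lyapunov_stable_def by blast
      have "\<delta> / \<bar>\<mu>\<bar> > 0" using \<delta>(1) \<mu>0 by simp
      then obtain z t where z: "filippov_solution N.V {..0} z" "infdist (z 0) C0 < \<delta> / \<bar>\<mu>\<bar>" "t \<le> 0" "infdist (z t) C0 \<ge> \<epsilon>"
        using \<epsilon>(2) by blast
      define y where "y t = ?U (z (\<tau> * t))" for t
      have soly: "filippov_solution (F \<mu>) {0..} y"
        unfolding y_def by (rule B.solution_conj[OF z(1)]) (use that in auto)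
      have infy: "infdist (y r) \<Gamma> = \<bar>\<mu>\<bar> * infdist (z (- r)) C0" for r
        unfolding y_def infd using that by simp
      have "infdist (y 0) \<Gamma> < \<delta>" using z(2) \<mu>0 by (simp add: infy field_simps)
      from \<delta>(2)[OF soly this, of "- t"] show False
        using z(3,4) \<mu>0 by (simp add: infy field_simps)
    qed
    have data: "two_zone_cycle (F \<mu>) \<Gamma> yL yR sL sR \<longleftrightarrow> yL = qL * \<mu> \<and> yR = qR * \<mu> \<and> sL = tL \<and> sR = tR" for yL yR sL sR
    proof
      assume "two_zone_cycle (F \<mu>) \<Gamma> yL yR sL sR"
      from N.two_zone_unique[OF C.two_zone_cycle_conj[OF this]]
      have *: "s / \<mu> * yL = N.cycle_yL" "s / \<mu> * yR = N.cycle_yR" "(if \<tau> = 1 then sL else sR) = N.cycle_tL" "(if \<tau> = 1 then sR else sL) = N.cycle_tR"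
        by auto
      have unscale: "s * (s / \<mu> * y) * \<mu> = y" for y using s \<mu>0 by auto
      have "yL = qL * \<mu>" "yR = qR * \<mu>"
        using unscale[of yL] unscale[of yR] unfolding qL_def qR_def *(1)[symmetric] *(2)[symmetric] by simp_all
      moreover have "sL = tL" "sR = tR"
        using *(3,4) unfolding tL_def tR_def by (simp_all split: if_splits)
      ultimately show "yL = qL * \<mu> \<and> yR = qR * \<mu> \<and> sL = tL \<and> sR = tR" by blast
    next
      assume *: "yL = qL * \<mu> \<and> yR = qR * \<mu> \<and> sL = tL \<and> sR = tR"
      have tz: "two_zone_cycle (F \<mu>) \<Gamma> (s * \<mu> * N.cycle_yL) (s * \<mu> * N.cycle_yR) tL tR"
        unfolding \<Gamma>_def C0_def tL_def tR_def by (rule B.two_zone_cycle_conj[OF N.cycle_two_zone])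
      have "s * \<mu> * N.cycle_yL = qL * \<mu>" "s * \<mu> * N.cycle_yR = qR * \<mu>"
        unfolding qL_def qR_def by (simp_all only: mult.assoc mult.commute[of \<mu>])
      with tz show "two_zone_cycle (F \<mu>) \<Gamma> yL yR sL sR" using * by (simp only:)
    qed
    show ?thesis using lc stable unstable data by (intro exI[of _ \<Gamma>]) auto
  qed
  show ?thesis using eq1 eq2 eq3 eq4 cyc by (intro exI[of _ qL] exI[of _ qR] exI[of _ tL] exI[of _ tR]) blast
qed

end

lemma affine_field_focus:
  fixes f :: "real^2 \<Rightarrow> real^2"
  assumes f: "\<And>z. f z = vector [a1 * z$1 + a2 * z$2 + a3, b1 * z$1 + b2 * z$2 + b3]"
  shows "f differentiable (at p)" "jacobian f (at p) = vector [vector [a1, a2], vector [b1, b2]]"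
proof -
  let ?A = "vector [vector [a1, a2], vector [b1, b2]] :: real^2^2"
  have Av: "?A *v d = vector [a1 * d$1 + a2 * d$2, b1 * d$1 + b2 * d$2]" for d
    by (simp add: real2_eq_iff matrix_vector_mult_def sum_2)
  have "f = (\<lambda>z. ?A *v z + vector [a3, b3])"
    by (rule ext) (simp add: f Av real2_eq_iff)
  moreover have "((\<lambda>z. ?A *v z + vector [a3, b3]) has_derivative (\<lambda>h. ?A *v h + 0)) (at p)"
    by (intro has_derivative_add has_derivative_const bounded_linear.has_derivative[OF matrix_vector_mul_bounded_linear] has_derivative_ident)
  ultimately have d: "(f has_derivative (*v) ?A) (at p)" by simp
  then show "f differentiable (at p)" by (rule differentiableI)
  have "frechet_derivative f (at p) = (*v) ?A" using d by (rule frechet_derivative_at[symmetric])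
  then show "jacobian f (at p) = ?A" by (simp add: jacobian_def matrix_of_matrix_vector_mul)
qed

theorem theorem2p2:
  fixes a1 a2 a3 b1 b2 b3 :: "side \<Rightarrow> real"
    and F :: "real \<Rightarrow> side \<Rightarrow> real^2 \<Rightarrow> real^2"
    and A :: "side \<Rightarrow> real^2^2"
    and lam \<omega> \<beta> \<xi> :: "side \<Rightarrow> real"
    and \<gamma> \<alpha> :: real
    and M :: "real set"
  assumes F: "\<And>\<mu> J z. F \<mu> J z = vector [a1 J * z$1 + a2 J * z$2 + a3 J * \<mu>,
                                         b1 J * z$1 + b2 J * z$2 + b3 J * \<mu>]"
    and A: "\<And>J. A J = vector [vector [a1 J, a2 J], vector [b1 J, b2 J]]"
    and eig: "\<And>J. eigenvalues (A J) = {Complex (lam J) (\<omega> J), Complex (lam J) (- \<omega> J)}"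
    and L_eig: "lam L > 0" "\<omega> L > 0"
    and R_eig: "lam R < 0" "\<omega> R > 0"
    and \<beta>: "\<And>J. \<beta> J = a3 J * b2 J - a2 J * b3 J"
    and \<gamma>: "\<gamma> = a2 L * a3 R - a3 L * a2 R"
    and \<alpha>: "\<alpha> = lam L / \<omega> L + lam R / \<omega> R"
    and \<xi>: "\<And>J. \<xi> J = \<beta> J * \<omega> J / (a2 J * ((lam J)\<^sup>2 + (\<omega> J)\<^sup>2))"
    and M: "M = (if \<alpha> < 0 then {0<..} else {..<0})"
    and signs: "\<beta> L > 0" "\<beta> R > 0" "a2 L * a2 R > 0" "a2 L * \<gamma> \<ge> 0"
  shows "(\<forall>\<mu><0. \<exists>p. p$1 > 0 \<and> stable_focus (F \<mu> R) p) \<and>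
         (\<forall>\<mu>>0. \<exists>p. p$1 < 0 \<and> unstable_focus (F \<mu> L) p) \<and>
         (\<alpha> < 0 \<longrightarrow>
           (\<forall>\<mu>>0. (\<exists>!\<Gamma>. limit_cycle (F \<mu>) \<Gamma>) \<and>
                   (\<forall>\<Gamma>. limit_cycle (F \<mu>) \<Gamma> \<longrightarrow> asymptotically_stable (F \<mu>) \<Gamma>)) \<and>
           (\<forall>\<mu><0. \<nexists>\<Gamma>. limit_cycle (F \<mu>) \<Gamma>)) \<and>
         (\<alpha> > 0 \<longrightarrow>
           (\<forall>\<mu><0. (\<exists>!\<Gamma>. limit_cycle (F \<mu>) \<Gamma>) \<and>
                   (\<forall>\<Gamma>. limit_cycle (F \<mu>) \<Gamma> \<longrightarrow> \<not> lyapunov_stable (F \<mu>) \<Gamma>)) \<and>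
           (\<forall>\<mu>>0. \<nexists>\<Gamma>. limit_cycle (F \<mu>) \<Gamma>)) \<and>
         (\<alpha> \<noteq> 0 \<longrightarrow>
           (\<exists>!(qL, qR, tL, tR). cycle_data F M qL qR tL tR) \<and>
           (\<forall>qL qR tL tR. cycle_data F M qL qR tL tR \<longrightarrow>
              qR + a3 R / a2 R
                = \<xi> R * exp (- lam R * tR) * \<rho> (\<omega> R * tR) (lam R / \<omega> R) / sin (\<omega> R * tR) \<and>
              qL + a3 R / a2 R
                = - \<xi> R * exp (lam R * tR) * \<rho> (\<omega> R * tR) (- (lam R / \<omega> R)) / sin (\<omega> R * tR) \<and>
              qL + a3 L / a2 L
                = \<xi> L * exp (- lam L * tL) * \<rho> (\<omega> L * tL) (lam L / \<omega> L) / sin (\<omega> L * tL) \<and>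
              qR + a3 L / a2 L
                = - \<xi> L * exp (lam L * tL) * \<rho> (\<omega> L * tL) (- (lam L / \<omega> L)) / sin (\<omega> L * tL)))"
proof -
  have om: "\<omega> J > 0" for J using L_eig R_eig by (cases J) auto
  have bt: "a3 J * b2 J - a2 J * b3 J > 0" for J using signs(1,2) \<beta>[of J] by (cases J) auto
  note td = eigenvalues_trace_det[OF eig[unfolded A] less_imp_neq[OF om, symmetric]]
  interpret focus_family a1 a2 a3 b1 b2 b3 lam \<omega> F
    by unfold_locales (use F td om bt L_eig R_eig signs(3,4) in \<open>auto simp: \<gamma>\<close>)
  have xi: "\<xi> = (\<lambda>J. (a3 J * b2 J - a2 J * b3 J) * \<omega> J / (a2 J * ((lam J)\<^sup>2 + (\<omega> J)\<^sup>2)))"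
    by (rule ext) (simp add: \<xi> \<beta>)

  have focus: "\<exists>p. (\<mu> < 0 \<longrightarrow> p $ 1 > 0) \<and> (\<mu> > 0 \<longrightarrow> p $ 1 < 0) \<and> F \<mu> J p = 0 \<and> F \<mu> J differentiable (at p) \<and>
      eigenvalues (jacobian (F \<mu> J) (at p)) = {Complex (lam J) (\<omega> J), Complex (lam J) (- \<omega> J)}" for \<mu> J
  proof -
    define D where "D = a1 J * b2 J - a2 J * b1 J"
    have D: "D > 0" using td(2)[of J] om[of J] by (simp add: D_def add_nonneg_pos)
    define p :: "real^2" where "p = vector [- (a3 J * b2 J - a2 J * b3 J) * \<mu> / D, (b1 J * a3 J - a1 J * b3 J) * \<mu> / D]"
    have "F \<mu> J p = 0"
      unfolding F real2_eq_iff p_def using D by (auto simp: divide_simps) (auto simp: D_def algebra_simps)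
    moreover have "\<mu> < 0 \<longrightarrow> p $ 1 > 0" "\<mu> > 0 \<longrightarrow> p $ 1 < 0"
      using bt[of J] D by (auto simp: p_def divide_less_0_iff zero_less_divide_iff mult_pos_neg mult_pos_pos mult_less_0_iff zero_less_mult_iff)
    moreover have "jacobian (F \<mu> J) (at p) = A J" "F \<mu> J differentiable (at p)"
      using affine_field_focus[of "F \<mu> J" "a1 J" "a2 J" "a3 J * \<mu>" "b1 J" "b2 J" "b3 J * \<mu>" p] F by (auto simp: A)
    ultimately show ?thesis using eig[of J] by (intro exI[of _ p]) auto
  qed
  have stable: "\<forall>\<mu><0. \<exists>p. p$1 > 0 \<and> stable_focus (F \<mu> R) p"
  proof (intro allI impI)
    fix \<mu> :: real assume "\<mu> < 0"
    with focus[of \<mu> R] obtain p where "p $ 1 > 0" "F \<mu> R p = 0" "F \<mu> R differentiable (at p)"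
      "eigenvalues (jacobian (F \<mu> R) (at p)) = {Complex (lam R) (\<omega> R), Complex (lam R) (- \<omega> R)}" by blast
    then show "\<exists>p. p$1 > 0 \<and> stable_focus (F \<mu> R) p"
      using R_eig by (intro exI[of _ p]) (auto simp: stable_focus_def)
  qed
  have unstable: "\<forall>\<mu>>0. \<exists>p. p$1 < 0 \<and> unstable_focus (F \<mu> L) p"
  proof (intro allI impI)
    fix \<mu> :: real assume "\<mu> > 0"
    with focus[of \<mu> L] obtain p where "p $ 1 < 0" "F \<mu> L p = 0" "F \<mu> L differentiable (at p)"
      "eigenvalues (jacobian (F \<mu> L) (at p)) = {Complex (lam L) (\<omega> L), Complex (lam L) (- \<omega> L)}" by blast
    then show "\<exists>p. p$1 < 0 \<and> unstable_focus (F \<mu> L) p"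
      using L_eig by (intro exI[of _ p]) (auto simp: unstable_focus_def)
  qed

  have none: "\<not> limit_cycle (F \<mu>) \<Gamma>" if "\<alpha> * \<mu> > 0" for \<mu> \<Gamma>
    using no_limit_cycle[of 1 \<mu> \<Gamma>] no_limit_cycle[of "-1" \<mu> \<Gamma>] that
    unfolding \<alpha>[symmetric] by (auto simp: zero_less_mult_iff)
  have cycles: "\<exists>qL qR tL tR.
     (qR + a3 R / a2 R = \<xi> R * exp (- lam R * tR) * \<rho> (\<omega> R * tR) (lam R / \<omega> R) / sin (\<omega> R * tR) \<and>
     qL + a3 R / a2 R = - \<xi> R * exp (lam R * tR) * \<rho> (\<omega> R * tR) (- (lam R / \<omega> R)) / sin (\<omega> R * tR) \<and>
     qL + a3 L / a2 L = \<xi> L * exp (- lam L * tL) * \<rho> (\<omega> L * tL) (lam L / \<omega> L) / sin (\<omega> L * tL) \<and>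
     qR + a3 L / a2 L = - \<xi> L * exp (lam L * tL) * \<rho> (\<omega> L * tL) (- (lam L / \<omega> L)) / sin (\<omega> L * tL)) \<and>
     (\<forall>\<mu>\<in>M. \<exists>\<Gamma>. (\<forall>\<Gamma>'. limit_cycle (F \<mu>) \<Gamma>' \<longleftrightarrow> \<Gamma>' = \<Gamma>) \<and>
       (\<alpha> < 0 \<longrightarrow> asymptotically_stable (F \<mu>) \<Gamma>) \<and> (\<alpha> > 0 \<longrightarrow> \<not> lyapunov_stable (F \<mu>) \<Gamma>) \<and>
       (\<forall>yL yR sL sR. two_zone_cycle (F \<mu>) \<Gamma> yL yR sL sR \<longleftrightarrow>
          yL = qL * \<mu> \<and> yR = qR * \<mu> \<and> sL = tL \<and> sR = tR))" if "\<alpha> \<noteq> 0"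
  proof (cases "\<alpha> < 0")
    case True
    then show ?thesis using limit_cycle_exists[of 1] unfolding \<alpha>[symmetric] xi M by (simp add: Ball_def)
  next
    case False
    then have "\<alpha> > 0" using that by simp
    then show ?thesis using limit_cycle_exists[of "-1"] unfolding \<alpha>[symmetric] xi M by (simp add: Ball_def)
  qed
  have last: "(\<exists>!(qL, qR, tL, tR). cycle_data F M qL qR tL tR) \<and>
           (\<forall>qL qR tL tR. cycle_data F M qL qR tL tR \<longrightarrow>
              qR + a3 R / a2 R
                = \<xi> R * exp (- lam R * tR) * \<rho> (\<omega> R * tR) (lam R / \<omega> R) / sin (\<omega> R * tR) \<and>
              qL + a3 R / a2 R
                = - \<xi> R * exp (lam R * tR) * \<rho> (\<omega> R * tR) (- (lam R / \<omega> R)) / sin (\<omega> R * tR) \<and>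
              qL + a3 L / a2 L
                = \<xi> L * exp (- lam L * tL) * \<rho> (\<omega> L * tL) (lam L / \<omega> L) / sin (\<omega> L * tL) \<and>
              qR + a3 L / a2 L
                = - \<xi> L * exp (lam L * tL) * \<rho> (\<omega> L * tL) (- (lam L / \<omega> L)) / sin (\<omega> L * tL))"
    (is "_ \<and> (\<forall>qL qR tL tR. _ \<longrightarrow> ?eqs qL qR tL tR)")
    if nz: "\<alpha> \<noteq> 0"
  proof -
    obtain qL qR tL tR where eqs:
     "qR + a3 R / a2 R = \<xi> R * exp (- lam R * tR) * \<rho> (\<omega> R * tR) (lam R / \<omega> R) / sin (\<omega> R * tR) \<and>
     qL + a3 R / a2 R = - \<xi> R * exp (lam R * tR) * \<rho> (\<omega> R * tR) (- (lam R / \<omega> R)) / sin (\<omega> R * tR) \<and>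
     qL + a3 L / a2 L = \<xi> L * exp (- lam L * tL) * \<rho> (\<omega> L * tL) (lam L / \<omega> L) / sin (\<omega> L * tL) \<and>
     qR + a3 L / a2 L = - \<xi> L * exp (lam L * tL) * \<rho> (\<omega> L * tL) (- (lam L / \<omega> L)) / sin (\<omega> L * tL)"
     and cyc: "\<forall>\<mu>\<in>M. \<exists>\<Gamma>. (\<forall>\<Gamma>'. limit_cycle (F \<mu>) \<Gamma>' \<longleftrightarrow> \<Gamma>' = \<Gamma>) \<and>
       (\<alpha> < 0 \<longrightarrow> asymptotically_stable (F \<mu>) \<Gamma>) \<and> (\<alpha> > 0 \<longrightarrow> \<not> lyapunov_stable (F \<mu>) \<Gamma>) \<and>
       (\<forall>yL yR sL sR. two_zone_cycle (F \<mu>) \<Gamma> yL yR sL sR \<longleftrightarrow>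
          yL = qL * \<mu> \<and> yR = qR * \<mu> \<and> sL = tL \<and> sR = tR)"
      using cycles[OF nz] by (elim exE conjE) (rule that; (intro conjI)?; assumption)
    obtain \<mu>0 where \<mu>0: "\<mu>0 \<in> M" "\<mu>0 \<noteq> 0" using M by (cases "\<alpha> < 0") (auto intro: that[of 1] that[of "-1"])
    have iff: "cycle_data F M qL' qR' tL' tR' \<longleftrightarrow> qL' = qL \<and> qR' = qR \<and> tL' = tL \<and> tR' = tR" for qL' qR' tL' tR'
    proof
      assume cd: "cycle_data F M qL' qR' tL' tR'"
      obtain \<Gamma> where lc: "\<forall>\<Gamma>'. limit_cycle (F \<mu>0) \<Gamma>' \<longleftrightarrow> \<Gamma>' = \<Gamma>"
        and data: "\<forall>yL yR sL sR. two_zone_cycle (F \<mu>0) \<Gamma> yL yR sL sR \<longleftrightarrow>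
          yL = qL * \<mu>0 \<and> yR = qR * \<mu>0 \<and> sL = tL \<and> sR = tR"
        using bspec[OF cyc \<mu>0(1)] by (elim exE conjE)
      have "two_zone_cycle (F \<mu>0) \<Gamma> (qL' * \<mu>0) (qR' * \<mu>0) tL' tR'"
        using cd \<mu>0(1) lc unfolding cycle_data_def by blast
      then show "qL' = qL \<and> qR' = qR \<and> tL' = tL \<and> tR' = tR" using data \<mu>0(2) by simp
    next
      assume eq: "qL' = qL \<and> qR' = qR \<and> tL' = tL \<and> tR' = tR"
      show "cycle_data F M qL' qR' tL' tR'"
        unfolding cycle_data_def
      proof (intro ballI allI impI)
        fix \<mu> \<Gamma> assume "\<mu> \<in> M" "limit_cycle (F \<mu>) \<Gamma>"
        obtain \<Gamma>0 where "\<forall>\<Gamma>'. limit_cycle (F \<mu>) \<Gamma>' \<longleftrightarrow> \<Gamma>' = \<Gamma>0"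
          "\<forall>yL yR sL sR. two_zone_cycle (F \<mu>) \<Gamma>0 yL yR sL sR \<longleftrightarrow>
            yL = qL * \<mu> \<and> yR = qR * \<mu> \<and> sL = tL \<and> sR = tR"
          using bspec[OF cyc \<open>\<mu> \<in> M\<close>] by (elim exE conjE)
        with \<open>limit_cycle (F \<mu>) \<Gamma>\<close> show "two_zone_cycle (F \<mu>) \<Gamma> (qL' * \<mu>) (qR' * \<mu>) tL' tR'" using eq by simp
      qed
    qed
    show ?thesis
    proof
      show "\<exists>!(qL, qR, tL, tR). cycle_data F M qL qR tL tR"
        by (rule ex1I[of _ "(qL, qR, tL, tR)"]) (auto simp: iff)
      show "\<forall>qL qR tL tR. cycle_data F M qL qR tL tR \<longrightarrow> ?eqs qL qR tL tR"
      proof (intro allI impI)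
        fix qL' qR' tL' tR' assume "cycle_data F M qL' qR' tL' tR'"
        then have "qL' = qL" "qR' = qR" "tL' = tL" "tR' = tR" by (auto simp: iff)
        with eqs show "?eqs qL' qR' tL' tR'" by (simp only:)
      qed
    qed
  qed

  have neg: "(\<exists>!\<Gamma>. limit_cycle (F \<mu>) \<Gamma>) \<and> (\<forall>\<Gamma>. limit_cycle (F \<mu>) \<Gamma> \<longrightarrow> asymptotically_stable (F \<mu>) \<Gamma>)"
    if a: "\<alpha> < 0" "\<mu> > 0" for \<mu>
  proof -
    have "\<mu> \<in> M" using a M by simp
    then obtain \<Gamma> where "\<And>\<Gamma>'. limit_cycle (F \<mu>) \<Gamma>' \<longleftrightarrow> \<Gamma>' = \<Gamma>" "asymptotically_stable (F \<mu>) \<Gamma>"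
      using cycles a(1) by blast
    then show ?thesis by simp
  qed
  have pos: "(\<exists>!\<Gamma>. limit_cycle (F \<mu>) \<Gamma>) \<and> (\<forall>\<Gamma>. limit_cycle (F \<mu>) \<Gamma> \<longrightarrow> \<not> lyapunov_stable (F \<mu>) \<Gamma>)"
    if a: "\<alpha> > 0" "\<mu> < 0" for \<mu>
  proof -
    have "\<mu> \<in> M" using a M by simp
    then obtain \<Gamma> where "\<And>\<Gamma>'. limit_cycle (F \<mu>) \<Gamma>' \<longleftrightarrow> \<Gamma>' = \<Gamma>" "\<not> lyapunov_stable (F \<mu>) \<Gamma>"
      using cycles a(1) by blast
    then show ?thesis by simp
  qed
  show ?thesis
    using stable unstable neg pos last none by (simp add: mult_pos_pos mult_neg_neg)
qed

end
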